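(* For every $n\ge1$, the number of Yukawa 1PI tadpole graphs with loop number $n$ equals $C_n$, the number of connected chord diagrams with $n$ chords. Equivalently, if $T(x)=\sum_\Gamma x^{b(\Gamma)}$, the sum over isomorphism classes of Yukawa 1PI tadpoles and $b(\Gamma)$ the number of boson edges including the external leg, then $T(x)=C(x)$, and $T$ satisfies $2xT(x)T'(x)=T(x)^2+T(x)-x$. (In the paper's notation, $[\hbar^n]\partial_{\phi_c}G^{\mathrm{Yuk}}|_{\phi_c=\psi_c=0}=C_n$.)
   Context: Yukawa graphs: vertices each incident to exactly one incoming fermion half-edge, one outgoing fermion half-edge and one boson half-edge; internal edges are directed fermion edges (outgoing paired with incoming half-edge) or boson edges (two boson half-edges); unpaired half-edges are external legs; fermion cycles are allowed. A graph is 1PI if connected and it stays connected after removing any one internal edge. A tadpole is a 1PI Yukawa graph whose only external leg is a single boson leg. Graphs are counted up to isomorphisms preserving edge types and orientations and fixing the external legs. Loop number $=|E|-|V|+1$ with $E$ the internal edges; for tadpoles it equals the total number of boson edges including the external leg. Chord diagrams are perfect matchings of $\{1,\dots,2n\}$; connected means the intersection graph (chords adjacent iff $\{a<b\},\{c<d\}$ satisfy $a<c<b<d$ or $c<a<d<b$) is connected; $C(x)=\sum C_nx^n$ is their generating function. *)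

theory Defs
  imports "HOL-Computational_Algebra.Formal_Power_Series"
begin

section \<open>Yukawa graphs\<close>

text \<open>
A Yukawa graph is represented as a triple (m, fo, bo):
 - the vertices are 0, ..., m-1; every vertex carries exactly one incoming fermion
   half-edge, one outgoing fermion half-edge and one boson half-edge;
 - fo v = Some w means that the outgoing fermion half-edge of v is paired with the
   incoming fermion half-edge of w (a directed fermion edge v -> w; v = w allowed);
   fo v = None means the outgoing fermion half-edge of v is an external leg;
 - bo u = Some v means the boson half-edge of u is paired with the boson half-edge
   of v (a boson edge); bo u = None means the boson half-edge of u is external.
Since the three half-edges at a vertex have distinct types, the half-edge structure
is completely determined by these data.\<close>

type_synonym ygraph = "nat \<times> (nat \<Rightarrow> nat option) \<times> (nat \<Rightarrow> nat option)"

definition yukawa_graph :: "ygraph \<Rightarrow> bool" where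
  "yukawa_graph G = (case G of (m, fo, bo) \<Rightarrow>
      (\<forall>v w. fo v = Some w \<longrightarrow> v < m \<and> w < m) \<and>
      (\<forall>v v' w. fo v = Some w \<and> fo v' = Some w \<longrightarrow> v = v') \<and>
      (\<forall>u v. bo u = Some v \<longrightarrow> u < m \<and> v < m \<and> u \<noteq> v \<and> bo v = Some u) \<and>
      (\<forall>v. m \<le> v \<longrightarrow> fo v = None \<and> bo v = None))"

text \<open>Internal edges: Inl v is the fermion edge leaving v; Inr u is the boson edge
{u, v} with u < v (each boson edge listed once).\<close>

definition yedges :: "ygraph \<Rightarrow> (nat + nat) set" where
  "yedges G = (case G of (m, fo, bo) \<Rightarrow>
      Inl ` {v. v < m \<and> fo v \<noteq> None} \<union> Inr ` {u. u < m \<and> (\<exists>v. bo u = Some v \<and> u < v)})"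

definition yends :: "ygraph \<Rightarrow> nat + nat \<Rightarrow> nat \<times> nat" where
  "yends G e = (case G of (m, fo, bo) \<Rightarrow>
      (case e of Inl v \<Rightarrow> (v, the (fo v)) | Inr u \<Rightarrow> (u, the (bo u))))"

text \<open>Number of external legs of each kind.\<close>

definition ext_fermion_out :: "ygraph \<Rightarrow> nat set" where
  "ext_fermion_out G = (case G of (m, fo, bo) \<Rightarrow> {v. v < m \<and> fo v = None})"

definition ext_fermion_in :: "ygraph \<Rightarrow> nat set" where
  "ext_fermion_in G = (case G of (m, fo, bo) \<Rightarrow> {w. w < m \<and> (\<forall>v. fo v \<noteq> Some w)})"

definition ext_boson :: "ygraph \<Rightarrow> nat set" where
  "ext_boson G = (case G of (m, fo, bo) \<Rightarrow> {v. v < m \<and> bo v = None})"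

text \<open>Connectivity of the vertex set using only the edges in E.\<close>

definition connected_via :: "ygraph \<Rightarrow> (nat + nat) set \<Rightarrow> bool" where
  "connected_via G E = (let adj = {(a, b). \<exists>e\<in>E. yends G e = (a, b) \<or> yends G e = (b, a)}
     in \<forall>a b. a < fst G \<and> b < fst G \<longrightarrow> (a, b) \<in> adj\<^sup>*)"

definition one_PI :: "ygraph \<Rightarrow> bool" where
  "one_PI G = (connected_via G (yedges G) \<and>
               (\<forall>e\<in>yedges G. connected_via G (yedges G - {e})))"

definition tadpole :: "ygraph \<Rightarrow> bool" where
  "tadpole G = (yukawa_graph G \<and> one_PI G \<and>
                ext_fermion_out G = {} \<and> ext_fermion_in G = {} \<and> card (ext_boson G) = 1)"

definition loop_number :: "ygraph \<Rightarrow> int" where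
  "loop_number G = int (card (yedges G)) - int (fst G) + 1"

text \<open>Isomorphism: a bijection of vertices preserving fermion edges (with orientation)
and boson edges; it then automatically maps external legs to external legs (for a
tadpole the unique external leg to the unique external leg).\<close>

definition yiso :: "ygraph \<Rightarrow> ygraph \<Rightarrow> bool" where
  "yiso G H = (case G of (m, fo, bo) \<Rightarrow> case H of (m', fo', bo') \<Rightarrow>
      m = m' \<and> (\<exists>f. bij_betw f {..<m} {..<m} \<and>
         (\<forall>v<m. fo' (f v) = map_option f (fo v) \<and> bo' (f v) = map_option f (bo v))))"

definition tadpoles_loops :: "nat \<Rightarrow> ygraph set" where
  "tadpoles_loops n = {G. tadpole G \<and> loop_number G = int n}"

text \<open>Number of isomorphism classes of 1PI Yukawa tadpoles with loop number n.\<close>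

definition tadpole_count :: "nat \<Rightarrow> nat" where
  "tadpole_count n = card (tadpoles_loops n //
      {(G, H). G \<in> tadpoles_loops n \<and> H \<in> tadpoles_loops n \<and> yiso G H})"

section \<open>Connected chord diagrams\<close>

text \<open>A chord diagram with n chords: a perfect matching of {1..2n}, given as a set of
chords (a, b) with a < b, such that every point of {1..2n} lies in exactly one chord.\<close>

definition chord_diagram :: "nat \<Rightarrow> (nat \<times> nat) set \<Rightarrow> bool" where
  "chord_diagram n P = ((\<forall>(a, b)\<in>P. 1 \<le> a \<and> a < b \<and> b \<le> 2 * n) \<and>
      (\<forall>x\<in>{1..2 * n}. \<exists>!c. c \<in> P \<and> (fst c = x \<or> snd c = x)))"

definition crossing :: "nat \<times> nat \<Rightarrow> nat \<times> nat \<Rightarrow> bool" where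
  "crossing c d = (case c of (a, b) \<Rightarrow> case d of (c', d') \<Rightarrow>
      (a < c' \<and> c' < b \<and> b < d') \<or> (c' < a \<and> a < d' \<and> d' < b))"

definition connected_chord_diagram :: "(nat \<times> nat) set \<Rightarrow> bool" where
  "connected_chord_diagram P =
     (\<forall>c\<in>P. \<forall>d\<in>P. (c, d) \<in> {(x, y). x \<in> P \<and> y \<in> P \<and> crossing x y}\<^sup>*)"

definition connected_chord_count :: "nat \<Rightarrow> nat" where
  "connected_chord_count n = card {P. chord_diagram n P \<and> connected_chord_diagram P}"

end

(* Both sides satisfy f 1 = 1 and f n = (SUM k=1..n-1. (2k-1) f k f (n-k)), which is the
   differential equation read off coefficientwise.

   Graphs.  Deleting the vertex of a boson leg merges its two fermion edges and keeps a graph 1PI,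
   so a leg may be inserted into any fermion edge; thus a 1PI graph with two legs and k boson
   edges (one leg counted) is a tadpole with k loops and one of its 2k-1 fermion edges.  A 1PI
   graph without legs, cut open at the boson edge of a vertex b, is a chain of two-legged 1PI
   graphs joined by bridges; splitting off the first link gives the recursion.  All this is done
   with labelled vertices, so no isomorphisms occur; since a tadpole has no automorphism, its
   isomorphism class consists of (2n-1)! labelled graphs.

   Chord diagrams.  Delete the root chord (a, p) from a connected diagram and let C be the component
   of the second point.  The points outside C are a and a block lying in one of the 2k-1 gaps
   between consecutive points of C, and they form a connected diagram with the root chord. *)
theory Submission
  imports Defs "HOL-Combinatorics.Permutations" "HOL-Library.Infinite_Set"
begin

section \<open>Labelled 1PI Yukawa graphs\<close>

text \<open>No bijection between graphs and diagrams is built: the factor 2k-1 is a number of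
  fermion edges on one side and of gaps on the other, and only the two recursions are compared. A
  recursion on isomorphism classes is blocked by the graphs without legs, which may have
  automorphisms, so that classes of pieces do not multiply. Labelled counts do multiply, and the
  binomial coefficients for distributing the labels absorb all factorials. On both sides
  connectivity is stated by cuts and not by paths: every nonempty proper set closed under fermion
  edges, or under chords, is left by enough edges. In this form a piece is found as a smallest set
  with some property, complements may be taken freely, and a gluing is checked set by set. Boson
  edges and chords alike are involutions that are the identity outside their set of points. Equality
  of matchings is then equality of functions, and pieces live on subsets without
  renumbering.\<close>

definition matching :: "nat set \<Rightarrow> (nat \<Rightarrow> nat) \<Rightarrow> bool" where
  "matching M \<beta> \<longleftrightarrow> (\<forall>x. \<beta> (\<beta> x) = x) \<and> (\<forall>x. \<beta> x \<noteq> x \<longleftrightarrow> x \<in> M)"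

lemma matching_invol [simp]: "matching M \<beta> \<Longrightarrow> \<beta> (\<beta> x) = x"
  by (simp add: matching_def)

lemma matching_fix_iff: "matching M \<beta> \<Longrightarrow> \<beta> x = x \<longleftrightarrow> x \<notin> M"
  by (auto simp: matching_def)

lemma matching_in_iff: "matching M \<beta> \<Longrightarrow> \<beta> x \<in> M \<longleftrightarrow> x \<in> M"
  unfolding matching_def by metis

lemma matching_eq_iff: "matching M \<beta> \<Longrightarrow> \<beta> x = \<beta> y \<longleftrightarrow> x = y"
  unfolding matching_def by metis

lemma matching_permutes: "matching M \<beta> \<Longrightarrow> \<beta> permutes M"
  unfolding permutes_def matching_def by metis

lemma finite_matchings: "finite M \<Longrightarrow> finite {\<beta>. matching M \<beta>}"
  by (rule finite_subset[OF _ finite_permutations]) (auto intro: matching_permutes)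

lemma matching_empty_iff: "matching {} \<beta> \<longleftrightarrow> \<beta> = id"
  by (auto simp: matching_def)

lemma matching_ends:
  assumes "matching M \<beta>"
  shows "M = {x \<in> M. x < \<beta> x} \<union> \<beta> ` {x \<in> M. x < \<beta> x}"
    and "{x \<in> M. x < \<beta> x} \<inter> \<beta> ` {x \<in> M. x < \<beta> x} = {}"
proof -
  have "x \<in> \<beta> ` {x \<in> M. x < \<beta> x}" if "x \<in> M" "\<not> x < \<beta> x" for x
  proof (rule image_eqI)
    show "x = \<beta> (\<beta> x)" using assms by simp
    have "\<beta> x \<noteq> x" using that assms by (simp add: matching_fix_iff)
    then show "\<beta> x \<in> {x \<in> M. x < \<beta> x}" using that assms by (simp add: matching_in_iff)
  qed
  then show "M = {x \<in> M. x < \<beta> x} \<union> \<beta> ` {x \<in> M. x < \<beta> x}"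
    using assms by (auto simp: matching_in_iff)
  show "{x \<in> M. x < \<beta> x} \<inter> \<beta> ` {x \<in> M. x < \<beta> x} = {}"
    using assms by auto
qed

lemma card_matching:
  assumes "matching M \<beta>" "finite M"
  shows "card M = 2 * card {x \<in> M. x < \<beta> x}"
proof -
  have "inj_on \<beta> {x \<in> M. x < \<beta> x}" using assms by (auto simp: inj_on_def matching_eq_iff)
  then have "card (\<beta> ` {x \<in> M. x < \<beta> x}) = card {x \<in> M. x < \<beta> x}" by (rule card_image)
  moreover have "card M = card {x \<in> M. x < \<beta> x} + card (\<beta> ` {x \<in> M. x < \<beta> x})"
    by (subst matching_ends(1)[OF assms(1)], subst card_Un_disjoint)
       (use assms matching_ends(2)[OF assms(1)] in auto)
  ultimately show ?thesis by simp
qed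

lemma even_card_matching: "matching M \<beta> \<Longrightarrow> finite M \<Longrightarrow> even (card M)"
  by (metis card_matching dvd_triv_left)

text \<open>A boson edge leaving \<open>S\<close> has just one end in \<open>S\<close>, so two
  points stand for two edges; a leg is a fixed point of \<open>\<beta>\<close> and never counts as
  leaving.\<close>

definition crossed_twice :: "(nat \<Rightarrow> nat) \<Rightarrow> nat set \<Rightarrow> bool" where
  "crossed_twice \<beta> S \<longleftrightarrow> (\<exists>x\<in>S. \<exists>y\<in>S. x \<noteq> y \<and> \<beta> x \<notin> S \<and> \<beta> y \<notin> S)"

text \<open>Fermion edges form cycles, so only boson edges can disconnect: a graph is 1PI iff every
  nonempty proper union of fermion cycles is left by at least two boson edges.\<close>
definition bridgeless :: "nat set \<Rightarrow> (nat \<Rightarrow> nat) \<Rightarrow> (nat \<Rightarrow> nat) \<Rightarrow> bool" where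
  "bridgeless V \<sigma> \<beta> \<longleftrightarrow>
     (\<forall>S. S \<subseteq> V \<and> S \<noteq> {} \<and> S \<noteq> V \<and> \<sigma> ` S = S \<longrightarrow> crossed_twice \<beta> S)"

text \<open>The 1PI graphs with vertex set \<open>V\<close> whose boson half-edges at \<open>F\<close> are legs: the fermion
  edges are \<open>v \<rightarrow> \<sigma> v\<close>, and a leg is encoded as a fixed point of \<open>\<beta>\<close>.\<close>
definition yuk :: "nat set \<Rightarrow> nat set \<Rightarrow> ((nat \<Rightarrow> nat) \<times> (nat \<Rightarrow> nat)) set" where
  "yuk V F = {(\<sigma>, \<beta>). \<sigma> permutes V \<and> matching (V - F) \<beta> \<and> bridgeless V \<sigma> \<beta>}"

lemma finite_yuk: "finite V \<Longrightarrow> finite (yuk V F)"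
  by (rule finite_subset[of _ "{\<sigma>. \<sigma> permutes V} \<times> {\<beta>. matching (V - F) \<beta>}"])
     (auto simp: yuk_def intro: finite_permutations finite_matchings)

lemma permutes_image_Diff: "\<sigma> permutes V \<Longrightarrow> S \<subseteq> V \<Longrightarrow> \<sigma> ` S = S \<Longrightarrow> \<sigma> ` (V - S) = V - S"
  by (metis image_set_diff permutes_image permutes_inj)

text \<open>A boson edge between \<open>S\<close> and its complement has one end on each side. A set
  may thus be replaced by its complement, so as to contain or to avoid a chosen vertex.\<close>

lemma crossed_twice_Diff:
  assumes "matching M \<beta>" "M \<subseteq> V" "S \<subseteq> V" "crossed_twice \<beta> (V - S)"
  shows "crossed_twice \<beta> S"
proof -
  obtain x y where *: "x \<in> V - S" "y \<in> V - S" "x \<noteq> y" "\<beta> x \<notin> V - S" "\<beta> y \<notin> V - S"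
    using assms(4) unfolding crossed_twice_def by blast
  have in_S: "\<beta> z \<in> S" if "z \<in> V - S" "\<beta> z \<notin> V - S" for z
  proof -
    have "\<beta> z \<noteq> z" using that by auto
    then have "\<beta> z \<in> M" using assms(1) by (simp add: matching_fix_iff matching_in_iff)
    then show ?thesis using that assms(2) by auto
  qed
  have "\<beta> x \<in> S" "\<beta> y \<in> S" using * in_S by blast+
  moreover have "\<beta> x \<noteq> \<beta> y" "\<beta> (\<beta> x) \<notin> S" "\<beta> (\<beta> y) \<notin> S"
    using * assms(1) by (auto simp: matching_eq_iff)
  ultimately show ?thesis unfolding crossed_twice_def by blast
qed

lemma bridgelessD:
  "bridgeless V \<sigma> \<beta> \<Longrightarrow> S \<subseteq> V \<Longrightarrow> S \<noteq> {} \<Longrightarrow> S \<noteq> V \<Longrightarrow> \<sigma> ` S = S \<Longrightarrow> crossed_twice \<beta> S"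
  by (simp add: bridgeless_def)

lemma crossed_twice_other:
  assumes "crossed_twice \<beta> S"
  obtains x where "x \<in> S" "\<beta> x \<notin> S" "x \<noteq> y"
  using assms unfolding crossed_twice_def by metis

section \<open>Inserting a leg into a fermion edge\<close>

text \<open>Composing with the transposition puts \<open>v\<close> on the fermion edge from
  \<open>e\<close> to \<open>\<sigma> e\<close>. Then \<open>v\<close> shares the cycle of
  \<open>e\<close>, so the closed sets are the old ones, with \<open>v\<close> added exactly when
  they contain \<open>e\<close>.\<close>

lemma image_insert_point:
  assumes "\<sigma> permutes V" "v \<notin> V" "e \<in> V"
  shows "S \<subseteq> insert v V \<and> (\<sigma> \<circ> transpose e v) ` S = S \<longleftrightarrow>
         S - {v} \<subseteq> V \<and> \<sigma> ` (S - {v}) = S - {v} \<and> (v \<in> S \<longleftrightarrow> e \<in> S)"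
proof -
  let ?p = "\<sigma> \<circ> transpose e v"
  have ev: "e \<noteq> v" and sv: "\<sigma> v = v" using assms by (auto simp: permutes_not_in)
  have inj: "inj \<sigma>" using assms(1) by (rule permutes_inj)
  have p: "?p e = v" "?p v = \<sigma> e" "\<And>x. x \<noteq> e \<Longrightarrow> x \<noteq> v \<Longrightarrow> ?p x = \<sigma> x"
    using sv by (auto simp: transpose_def)
  have injp: "inj ?p" using inj by (intro inj_compose) auto
  show ?thesis
  proof (cases "v \<in> S \<longleftrightarrow> e \<in> S")
    case True
    have "transpose e v ` S = S"
      using True by (rule transpose_image_eq[OF sym])
    then have "?p ` S = \<sigma> ` S" by (simp only: image_comp[symmetric])
    moreover have "\<sigma> ` S = S \<longleftrightarrow> \<sigma> ` (S - {v}) = S - {v}"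
    proof (cases "v \<in> S")
      case True
      then have S: "S = insert v (S - {v})" by auto
      have "v \<notin> \<sigma> ` (S - {v})" using inj sv by (metis DiffD2 image_iff injD singletonI)
      moreover have "\<sigma> ` S = insert v (\<sigma> ` (S - {v}))" 
        using arg_cong[OF S, of "image \<sigma>"] by (simp only: image_insert sv)
      ultimately show ?thesis using True by auto
    qed simp
    ultimately show ?thesis using True by auto
  next
    case False
    have "?p ` S \<noteq> S"
      using False p(1) injp by (metis (no_types) imageI inj_image_mem_iff)
    then show ?thesis using False by auto
  qed
qed

lemma bridgeless_insert_point:
  assumes \<sigma>: "\<sigma> permutes V" and v: "v \<notin> V" and e: "e \<in> V" and \<beta>: "matching M \<beta>" "M \<subseteq> V"
  shows "bridgeless (insert v V) (\<sigma> \<circ> transpose e v) \<beta> \<longleftrightarrow> bridgeless V \<sigma> \<beta>"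
proof -
  have bv: "\<beta> v = v" using \<beta> v by (metis matching_fix_iff subsetD)
  have bx: "\<beta> x \<noteq> v" if "x \<noteq> v" for x using that bv \<beta>(1) by (metis matching_invol)
  have ct: "crossed_twice \<beta> S \<longleftrightarrow> crossed_twice \<beta> (S - {v})" for S
    unfolding crossed_twice_def using bv bx by (metis Diff_iff singletonD)
  show ?thesis
  proof
    assume L: "bridgeless (insert v V) (\<sigma> \<circ> transpose e v) \<beta>"
    show "bridgeless V \<sigma> \<beta>" unfolding bridgeless_def
    proof (intro allI impI)
      fix S assume S: "S \<subseteq> V \<and> S \<noteq> {} \<and> S \<noteq> V \<and> \<sigma> ` S = S"
      define S' where "S' = (if e \<in> S then insert v S else S)"
      have 1: "S' - {v} = S" "v \<in> S' \<longleftrightarrow> e \<in> S'" using S v by (auto simp: S'_def)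
      then have "S' \<subseteq> insert v V \<and> (\<sigma> \<circ> transpose e v) ` S' = S'"
        using image_insert_point[OF \<sigma> v e] S by simp
      moreover have "S' \<noteq> {}" "S' \<noteq> insert v V" using 1(1) S v by blast+
      ultimately have "crossed_twice \<beta> S'" using L by (simp add: bridgeless_def)
      then show "crossed_twice \<beta> S" using ct[of S'] 1 by simp
    qed
  next
    assume R: "bridgeless V \<sigma> \<beta>"
    show "bridgeless (insert v V) (\<sigma> \<circ> transpose e v) \<beta>" unfolding bridgeless_def
    proof (intro allI impI)
      fix S assume S: "S \<subseteq> insert v V \<and> S \<noteq> {} \<and> S \<noteq> insert v V \<and> (\<sigma> \<circ> transpose e v) ` S = S"
      then have 1: "S - {v} \<subseteq> V" "\<sigma> ` (S - {v}) = S - {v}" "v \<in> S \<longleftrightarrow> e \<in> S"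
        using image_insert_point[OF \<sigma> v e, of S] by auto
      have "S - {v} \<noteq> {}" using 1(3) S v e by blast
      moreover have "S - {v} \<noteq> V" using 1(3) S v e by blast
      ultimately show "crossed_twice \<beta> S" using ct[of S] bridgelessD[OF R 1(1) _ _ 1(2)] by simp
    qed
  qed
qed

text \<open>A fermion edge is named by its tail, which gives \<open>card V\<close> places for the
  new leg. Conversely the leg \<open>v\<close> is removed by joining its two fermion edges.\<close>

lemma card_yuk_insert:
  assumes V: "finite V" "V \<noteq> {}" "v \<notin> V"
  shows "card (yuk (insert v V) (insert v F)) = card V * card (yuk V F)"
proof -
  have M: "insert v V - insert v F = V - F" using V by auto
  let ?f = "\<lambda>(e, \<sigma>, \<beta>). (\<sigma> \<circ> transpose e v, \<beta> :: nat \<Rightarrow> nat)"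
  have "bij_betw ?f (V \<times> yuk V F) (yuk (insert v V) (insert v F))"
  proof (rule bij_betw_imageI)
    show "inj_on ?f (V \<times> yuk V F)"
    proof (rule inj_onI)
      fix p q assume pq: "p \<in> V \<times> yuk V F" "q \<in> V \<times> yuk V F" "?f p = ?f q"
      obtain e \<sigma> \<beta> where p: "p = (e, \<sigma>, \<beta>)" by (rule prod_cases3)
      obtain e' \<sigma>' \<beta>' where q: "q = (e', \<sigma>', \<beta>')" by (rule prod_cases3)
      have *: "e \<in> V" "(\<sigma>, \<beta>) \<in> yuk V F" "e' \<in> V" "(\<sigma>', \<beta>') \<in> yuk V F"
        "\<sigma> \<circ> transpose e v = \<sigma>' \<circ> transpose e' v" "\<beta> = \<beta>'"
        using pq unfolding p q by simp_all
      then have "\<sigma> v = v" "\<sigma>' v = v" using V by (auto simp: yuk_def permutes_not_in)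
      then have "(\<sigma> \<circ> transpose e v) e = v" "(\<sigma>' \<circ> transpose e' v) e' = v" by auto
      moreover have "inj (\<sigma> \<circ> transpose e v)"
        using * by (intro inj_compose) (auto simp: yuk_def permutes_inj)
      ultimately have e: "e = e'" using *(5) by (metis injD)
      have "\<sigma> \<circ> transpose e v \<circ> transpose e v = \<sigma>' \<circ> transpose e v \<circ> transpose e v"
        using * e by simp
      then have "\<sigma> = \<sigma>'" by (simp add: comp_assoc)
      with e *(6) show "p = q" by (simp only: p q)
    qed
    show "?f ` (V \<times> yuk V F) = yuk (insert v V) (insert v F)"
    proof (intro equalityI subsetI)
      fix p assume "p \<in> ?f ` (V \<times> yuk V F)"
      then obtain e \<sigma> \<beta> where *: "e \<in> V" "(\<sigma>, \<beta>) \<in> yuk V F" "p = (\<sigma> \<circ> transpose e v, \<beta>)" by auto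
      have "\<sigma> permutes insert v V" using * by (auto simp: yuk_def intro: permutes_imp_permutes_insert)
      then have "\<sigma> \<circ> transpose e v permutes insert v V"
        using * by (intro permutes_compose permutes_swap_id) auto
      then show "p \<in> yuk (insert v V) (insert v F)"
        using * bridgeless_insert_point[OF _ V(3) *(1), of \<sigma> "V - F" \<beta>] by (auto simp: yuk_def M)
    next
      fix p assume "p \<in> yuk (insert v V) (insert v F)"
      then obtain \<tau> \<beta> where p: "p = (\<tau>, \<beta>)" and \<tau>: "\<tau> permutes insert v V"
        and \<beta>: "matching (V - F) \<beta>" and bl: "bridgeless (insert v V) \<tau> \<beta>"
        by (auto simp: yuk_def M)
      have bv: "\<beta> v = v" using \<beta> V by (simp add: matching_fix_iff)
      \<comment> \<open>A leg on its own fermion loop would be a component: \<open>{v}\<close> is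
        left by no boson edge, and it is a proper subset because \<open>V\<close> is
        nonempty.\<close>
      have "\<tau> v \<noteq> v"
      proof
        assume "\<tau> v = v"
        then have "crossed_twice \<beta> {v}" using bl V by (intro bridgelessD[OF bl]) auto
        then show False by (auto simp: crossed_twice_def)
      qed
      define e where "e = inv \<tau> v"
      have te: "\<tau> e = v" using \<tau> by (simp add: e_def permutes_inverses)
      have e: "e \<in> V" using te \<tau> \<open>\<tau> v \<noteq> v\<close> by (metis insertE insertI1 permutes_in_image)
      define \<sigma> where "\<sigma> = \<tau> \<circ> transpose e v"
      have \<tau>': "\<tau> = \<sigma> \<circ> transpose e v" by (simp add: \<sigma>_def comp_assoc)
      have "\<sigma> permutes insert v V" unfolding \<sigma>_def using \<tau> e by (intro permutes_compose permutes_swap_id) auto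
      moreover have "\<sigma> v = v" by (simp add: \<sigma>_def te)
      ultimately have \<sigma>: "\<sigma> permutes V" using permutes_superset[of \<sigma> "insert v V" V] by auto
      have "bridgeless V \<sigma> \<beta>"
        using bl bridgeless_insert_point[OF \<sigma> V(3) e \<beta>] unfolding \<tau>' by blast
      then have "(\<sigma>, \<beta>) \<in> yuk V F" using \<sigma> \<beta> by (simp add: yuk_def)
      then show "p \<in> ?f ` (V \<times> yuk V F)" using e p \<tau>' by force
    qed
  qed
  from bij_betw_same_card[OF this] show ?thesis by (simp add: card_cartesian_product)
qed

section \<open>Splitting off the first link of a chain\<close>

lemma permutes_restrict: "\<sigma> permutes V \<Longrightarrow> \<sigma> ` W = W \<Longrightarrow> restrict_id \<sigma> W permutes W"
  by (intro permutes_restrict_id bij_betw_imageI) (auto intro: permutes_inj_on)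

lemma permutes_restrict_image: "S \<subseteq> W \<Longrightarrow> restrict_id \<sigma> W ` S = \<sigma> ` S"
  by (auto simp: restrict_id_def image_iff subset_iff)

lemma bridgeless_add_edge:
  "bridgeless V \<sigma> \<beta> \<Longrightarrow> \<beta> b = b \<Longrightarrow> \<beta> c = c \<Longrightarrow> bridgeless V \<sigma> (\<beta>(b := c, c := b))"
  unfolding bridgeless_def crossed_twice_def by (metis fun_upd_apply)

definition unlink :: "nat \<Rightarrow> (nat \<Rightarrow> nat) \<Rightarrow> nat \<Rightarrow> nat" where
  "unlink b \<beta> = \<beta>(b := b, \<beta> b := \<beta> b)"

lemma matching_unlink: "matching V \<beta> \<Longrightarrow> matching (V - {b, \<beta> b}) (unlink b \<beta>)"
  unfolding matching_def unlink_def by simp metis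

text \<open>The chain has a single link: cutting the boson edge at \<open>b\<close> leaves a 1PI
  graph with legs at \<open>b\<close> and at its former partner \<open>c\<close>. This supplies the
  last term of the recursion.\<close>

lemma card_yuk_linked:
  assumes V: "finite V" "b \<in> V"
  shows "card {p \<in> yuk V {}. bridgeless V (fst p) (unlink b (snd p))}
           = (\<Sum>c\<in>V - {b}. card (yuk V {b, c}))"
proof -
  let ?f = "\<lambda>(c, \<sigma> :: nat \<Rightarrow> nat, \<beta>). (\<sigma>, \<beta>(b := c, c := b))"
  let ?X = "SIGMA c:V - {b}. yuk V {b, c}"
  let ?Y = "{p \<in> yuk V {}. bridgeless V (fst p) (unlink b (snd p))}"
  have fix_ends: "\<beta> b = b" "\<beta> c = c" if "matching (V - {b, c}) \<beta>" for \<beta> c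
    using that by (auto simp: matching_fix_iff)
  have unlink_link: "unlink b (\<beta>(b := c, c := b)) = \<beta>" if "matching (V - {b, c}) \<beta>" "c \<noteq> b" for \<beta> c
    using fix_ends[OF that(1)] that(2) by (auto simp: unlink_def fun_eq_iff)
  have link_matching: "matching V (\<beta>(b := c, c := b))" if "matching (V - {b, c}) \<beta>" "c \<in> V" "c \<noteq> b" for \<beta> c
    using that V(2) unfolding matching_def by (simp, metis)
  have "bij_betw ?f ?X ?Y"
  proof (rule bij_betw_imageI)
    show "inj_on ?f ?X"
    proof (rule inj_onI)
      fix p q assume pq: "p \<in> ?X" "q \<in> ?X" "?f p = ?f q"
      obtain c \<sigma> \<beta> where p: "p = (c, \<sigma>, \<beta>)" by (rule prod_cases3)
      obtain c' \<sigma>' \<beta>' where q: "q = (c', \<sigma>', \<beta>')" by (rule prod_cases3)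
      have *: "c \<noteq> b" "c' \<noteq> b" "matching (V - {b, c}) \<beta>" "matching (V - {b, c'}) \<beta>'"
        "\<sigma> = \<sigma>'" "\<beta>(b := c, c := b) = \<beta>'(b := c', c' := b)"
        using pq unfolding p q by (auto simp: yuk_def)
      have "c = c'" using fun_cong[OF *(6), of b] *(1,2) by simp
      moreover have "\<beta> = \<beta>'" using * unlink_link by metis
      ultimately show "p = q" using * p q by simp
    qed
    show "?f ` ?X = ?Y"
    proof (intro equalityI subsetI)
      fix p assume "p \<in> ?f ` ?X"
      then obtain c \<sigma> \<beta> where *: "c \<in> V" "c \<noteq> b" "(\<sigma>, \<beta>) \<in> yuk V {b, c}"
        "p = (\<sigma>, \<beta>(b := c, c := b))" by auto
      then have **: "\<sigma> permutes V" "matching (V - {b, c}) \<beta>" "bridgeless V \<sigma> \<beta>" by (auto simp: yuk_def)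
      then show "p \<in> ?Y"
        using * link_matching[OF **(2) *(1,2)] unlink_link[OF **(2) *(2)]
          bridgeless_add_edge[OF **(3) fix_ends[OF **(2)]] by (simp add: yuk_def)
    next
      fix p assume "p \<in> ?Y"
      then obtain \<sigma> \<beta> where p: "p = (\<sigma>, \<beta>)" and *: "\<sigma> permutes V" "matching V \<beta>"
        "bridgeless V \<sigma> (unlink b \<beta>)" by (auto simp: yuk_def)
      have c: "\<beta> b \<in> V - {b}" using * V by (auto simp: matching_in_iff matching_fix_iff)
      have "(unlink b \<beta>)(b := \<beta> b, \<beta> b := b) = \<beta>"
        using *(2) by (auto simp: unlink_def fun_eq_iff)
      moreover have "(\<beta> b, \<sigma>, unlink b \<beta>) \<in> ?X" using * c matching_unlink by (simp add: yuk_def)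
      ultimately show "p \<in> ?f ` ?X" unfolding p by (intro image_eqI) auto
    qed
  qed
  from bij_betw_same_card[OF this] show ?thesis using V by (simp add: card_SigmaI finite_yuk)
qed

text \<open>The first link on \<open>W\<close>, with legs \<open>b\<close> and \<open>e\<close>, is spliced into the boson edge between \<open>d\<close>
  and \<open>\<beta>\<^sub>2 d\<close> of the closed-up rest of the chain.\<close>
definition glue where
  "glue b = (\<lambda>(W, e, d, (\<sigma>\<^sub>1, \<beta>\<^sub>1), (\<sigma>\<^sub>2, \<beta>\<^sub>2)).
     (\<lambda>x. if x \<in> W then \<sigma>\<^sub>1 x else \<sigma>\<^sub>2 x :: nat,
      (\<lambda>x. if x \<in> W then \<beta>\<^sub>1 x else \<beta>\<^sub>2 x)(b := \<beta>\<^sub>2 d, \<beta>\<^sub>2 d := b, e := d, d := e :: nat)))"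

text \<open>The vertex \<open>d\<close>, and not only its edge, belongs to the data: it is the end
  that gets joined to \<open>e\<close>, while \<open>\<beta>\<^sub>2 d\<close> is joined to
  \<open>b\<close>. Stated as a relation between pieces and whole, the gluing serves injectivity and
  surjectivity of \<open>glue\<close> alike.\<close>

locale glued =
  fixes V W :: "nat set" and b e d :: nat and \<sigma>\<^sub>1 \<beta>\<^sub>1 \<sigma>\<^sub>2 \<beta>\<^sub>2 \<sigma> \<beta> :: "nat \<Rightarrow> nat"
  assumes V: "finite V" and W: "W \<subset> V" and b: "b \<in> W" and e: "e \<in> W" "e \<noteq> b" and d: "d \<in> V - W"
    and head: "(\<sigma>\<^sub>1, \<beta>\<^sub>1) \<in> yuk W {b, e}" and tail: "(\<sigma>\<^sub>2, \<beta>\<^sub>2) \<in> yuk (V - W) {}"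
    and glued: "(\<sigma>, \<beta>) = glue b (W, e, d, (\<sigma>\<^sub>1, \<beta>\<^sub>1), (\<sigma>\<^sub>2, \<beta>\<^sub>2))"
begin

lemma s1: "\<sigma>\<^sub>1 permutes W" and m1: "matching (W - {b, e}) \<beta>\<^sub>1" and bl1: "bridgeless W \<sigma>\<^sub>1 \<beta>\<^sub>1"
  using head by (auto simp: yuk_def)

lemma s2: "\<sigma>\<^sub>2 permutes V - W" and m2: "matching (V - W) \<beta>\<^sub>2" and bl2: "bridgeless (V - W) \<sigma>\<^sub>2 \<beta>\<^sub>2"
  using tail by (auto simp: yuk_def)

lemma sigma_eq: "\<sigma> x = (if x \<in> W then \<sigma>\<^sub>1 x else \<sigma>\<^sub>2 x)"
  using glued by (simp add: glue_def)

lemma d': "\<beta>\<^sub>2 d \<in> V - W" "\<beta>\<^sub>2 d \<noteq> d"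
  using d matching_in_iff[OF m2, of d] matching_fix_iff[OF m2, of d] by auto

lemma neqs: "d \<noteq> b" "d \<noteq> e" "\<beta>\<^sub>2 d \<noteq> b" "\<beta>\<^sub>2 d \<noteq> e"
  using b e d d' by auto

lemma beta_simps: "\<beta> b = \<beta>\<^sub>2 d" "\<beta> (\<beta>\<^sub>2 d) = b" "\<beta> e = d" "\<beta> d = e"
  using glued neqs e d' by (auto simp: glue_def)

lemma beta_head: "x \<in> W \<Longrightarrow> x \<noteq> b \<Longrightarrow> x \<noteq> e \<Longrightarrow> \<beta> x = \<beta>\<^sub>1 x"
  using glued d d' by (auto simp: glue_def)

lemma beta_tail: "x \<notin> W \<Longrightarrow> x \<noteq> d \<Longrightarrow> x \<noteq> \<beta>\<^sub>2 d \<Longrightarrow> \<beta> x = \<beta>\<^sub>2 x"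
  using glued b e by (auto simp: glue_def)

lemma beta1_fix: "\<beta>\<^sub>1 b = b" "\<beta>\<^sub>1 e = e"
  using m1 by (auto simp: matching_fix_iff)

lemma beta1_in: "x \<in> W \<Longrightarrow> \<beta>\<^sub>1 x \<in> W"
  using m1 beta1_fix by (metis Diff_iff insert_iff matching_fix_iff matching_in_iff singletonD)

text \<open>The head hangs on the rest by exactly two boson edges; the bridge created by cutting at
  \<open>b\<close> and the uniqueness of the head both rest on this.\<close>

lemma leaves_head_iff: "x \<in> W \<Longrightarrow> \<beta> x \<notin> W \<longleftrightarrow> x = b \<or> x = e"
  using beta_head beta1_in beta_simps d d' by (metis DiffD2)

lemma beta_invol: "\<beta> (\<beta> x) = x"
proof (cases "x \<in> {b, e, d, \<beta>\<^sub>2 d}")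
  case True
  then show ?thesis using beta_simps by auto
next
  case False
  show ?thesis
  proof (cases "x \<in> W")
    case True
    have "\<beta>\<^sub>1 x \<notin> {b, e}" using False m1 beta1_fix by (metis insert_iff matching_invol singletonD)
    then show ?thesis using False True beta_head[of x] beta_head[of "\<beta>\<^sub>1 x"] beta1_in[of x] m1 by simp
  next
    case F2: False
    have "\<beta>\<^sub>2 x \<notin> {d, \<beta>\<^sub>2 d}" using False m2 by (metis insert_iff matching_invol singletonD)
    moreover have "\<beta>\<^sub>2 x \<notin> W" using F2 m2 by (metis DiffD2 matching_fix_iff matching_in_iff)
    ultimately show ?thesis using False F2 beta_tail[of x] beta_tail[of "\<beta>\<^sub>2 x"] m2 by simp
  qed
qed

lemma beta_fix_iff: "\<beta> x \<noteq> x \<longleftrightarrow> x \<in> V"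
proof (cases "x \<in> {b, e, d, \<beta>\<^sub>2 d}")
  case True
  then show ?thesis using beta_simps neqs neqs[symmetric] b e d d' W by auto
next
  case False
  then show ?thesis
  proof (cases "x \<in> W")
    case True
    then show ?thesis using False beta_head[of x] m1 W by (auto simp: matching_fix_iff)
  next
    case F2: False
    then show ?thesis using False beta_tail[of x] m2 W by (auto simp: matching_fix_iff)
  qed
qed

lemma matching_glued: "matching V \<beta>"
  unfolding matching_def using beta_invol beta_fix_iff by blast

lemma sigma_comp: "\<sigma> = \<sigma>\<^sub>1 \<circ> \<sigma>\<^sub>2"
proof
  fix x show "\<sigma> x = (\<sigma>\<^sub>1 \<circ> \<sigma>\<^sub>2) x"
  proof (cases "x \<in> W")
    case True
    then have "\<sigma>\<^sub>2 x = x" using s2 by (auto simp: permutes_not_in)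
    then show ?thesis using True by (simp add: sigma_eq)
  next
    case False
    then have "\<sigma>\<^sub>2 x \<notin> W" using s2 by (metis DiffD2 permutes_in_image permutes_not_in)
    then show ?thesis using False s1 by (simp add: sigma_eq permutes_not_in)
  qed
qed

lemma sigma_permutes: "\<sigma> permutes V"
  unfolding sigma_comp using W s1 s2 by (intro permutes_compose) (auto intro: permutes_subset)

lemma sigma_W: "\<sigma> ` W = W"
proof -
  have "\<sigma> ` W = \<sigma>\<^sub>1 ` W" by (auto simp: sigma_eq image_iff)
  then show ?thesis using s1 by (simp add: permutes_image)
qed

text \<open>The two crossings of \<open>\<beta>\<^sub>1\<close> avoid its fixed points
  \<open>b\<close> and \<open>e\<close>, so they are boson edges of the glued graph that stay inside
  \<open>W\<close>. That neither starts at \<open>b\<close> matters for uniqueness.\<close>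

lemma head_crossed:
  assumes "S \<subset> W" "S \<noteq> {}" "\<sigma> ` S = S"
  obtains x y where "x \<in> S" "y \<in> S" "x \<noteq> y" "\<beta> x \<in> W - S" "\<beta> y \<in> W - S"
    "x \<noteq> b" "y \<noteq> b"
proof -
  have "\<sigma> ` S = \<sigma>\<^sub>1 ` S" using assms(1) by (auto simp: sigma_eq image_iff)
  then have "crossed_twice \<beta>\<^sub>1 S" using assms by (intro bridgelessD[OF bl1]) auto
  then obtain x y where *: "x \<in> S" "y \<in> S" "x \<noteq> y" "\<beta>\<^sub>1 x \<notin> S" "\<beta>\<^sub>1 y \<notin> S"
    unfolding crossed_twice_def by blast
  have "\<beta> z \<in> W - S \<and> z \<noteq> b" if "z \<in> S" "\<beta>\<^sub>1 z \<notin> S" for z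
  proof -
    have "z \<in> W" "z \<noteq> b" "z \<noteq> e" using that assms(1) beta1_fix by auto
    then show ?thesis using that beta_head[of z] beta1_in[of z] by simp
  qed
  with * that show ?thesis by blast
qed

text \<open>A closed set that splits the head is crossed twice inside the head. One that avoids the
  head and splits the tail keeps its crossings, since splicing only redirects an edge into the head.
  The whole tail is left at \<open>d\<close> and at \<open>\<beta>\<^sub>2 d\<close>. Sets
  containing the head are treated through their complements.\<close>

lemma bridgeless_glued: "bridgeless V \<sigma> \<beta>"
  unfolding bridgeless_def
proof (intro allI impI)
  have main: "crossed_twice \<beta> S"
    if S: "S \<subseteq> V" "S \<noteq> {}" "S \<noteq> V" "\<sigma> ` S = S" and disj: "\<not> W \<subseteq> S" for S
  proof (cases "S \<inter> W = {}")
    case False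
    have "\<sigma> ` (S \<inter> W) = S \<inter> W"
      using image_Int[OF permutes_inj[OF sigma_permutes]] S(4) sigma_W by metis
    moreover have "S \<inter> W \<subset> W" using disj by blast
    ultimately obtain x y where "x \<in> S \<inter> W" "y \<in> S \<inter> W" "x \<noteq> y"
      "\<beta> x \<in> W - S \<inter> W" "\<beta> y \<in> W - S \<inter> W" "x \<noteq> b" "y \<noteq> b"
      using False by (elim head_crossed)
    then show ?thesis unfolding crossed_twice_def by blast
  next
    case True
    show ?thesis
    proof (cases "S = V - W")
      case True
      then show ?thesis unfolding crossed_twice_def
        using d d' beta_simps b e by (metis DiffD2)
    next
      case False
      have "\<sigma> ` S = \<sigma>\<^sub>2 ` S" using True by (auto simp: sigma_eq image_iff)
      then have "crossed_twice \<beta>\<^sub>2 S" using True False S by (intro bridgelessD[OF bl2]) auto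
      moreover have "\<beta> x \<notin> S" if "x \<in> S" "\<beta>\<^sub>2 x \<notin> S" for x
        using that True b e beta_simps beta_tail[of x] by (metis disjoint_iff)
      ultimately show ?thesis unfolding crossed_twice_def by blast
    qed
  qed
  fix S assume S: "S \<subseteq> V \<and> S \<noteq> {} \<and> S \<noteq> V \<and> \<sigma> ` S = S"
  show "crossed_twice \<beta> S"
  proof (cases "W \<subseteq> S")
    case True
    have "crossed_twice \<beta> (V - S)"
      using S True W b permutes_image_Diff[OF sigma_permutes] by (intro main) auto
    then show ?thesis using crossed_twice_Diff[OF matching_glued] S by blast
  next
    case False
    then show ?thesis using S by (intro main) auto
  qed
qed

lemma not_bridgeless_unlink: "\<not> bridgeless V \<sigma> (unlink b \<beta>)"
proof
  assume "bridgeless V \<sigma> (unlink b \<beta>)"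
  then have "crossed_twice (unlink b \<beta>) W"
    using W b sigma_W by (intro bridgelessD[of V \<sigma>]) auto
  then obtain x where x: "x \<in> W" "unlink b \<beta> x \<notin> W" "x \<noteq> e" by (rule crossed_twice_other)
  then show False using leaves_head_iff[of x] b by (auto simp: unlink_def split: if_splits)
qed

text \<open>If \<open>W\<close> were not inside \<open>W'\<close>, the part
  \<open>W \<inter> W'\<close> of the head would be left by two boson edges not starting at
  \<open>b\<close>; both also leave \<open>W'\<close>, so both start at \<open>e'\<close>. Applied
  to two decompositions in both directions, this makes the first link unique.\<close>

lemma head_le:
  assumes "b \<in> W'" "\<sigma> ` W' = W'" "\<And>x. x \<in> W' \<Longrightarrow> \<beta> x \<notin> W' \<Longrightarrow> x = b \<or> x = e'"
  shows "W \<subseteq> W'"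
proof (rule ccontr)
  assume "\<not> W \<subseteq> W'"
  then have "W \<inter> W' \<subset> W" "W \<inter> W' \<noteq> {}" using b assms(1) by blast+
  moreover have "\<sigma> ` (W \<inter> W') = W \<inter> W'"
    using image_Int[OF permutes_inj[OF sigma_permutes]] assms(2) sigma_W by metis
  ultimately obtain x y where "x \<in> W \<inter> W'" "y \<in> W \<inter> W'" "x \<noteq> y"
    "\<beta> x \<in> W - W \<inter> W'" "\<beta> y \<in> W - W \<inter> W'" "x \<noteq> b" "y \<noteq> b"
    by (rule head_crossed)
  then show False using assms(3)[of x] assms(3)[of y] by auto
qed

text \<open>This and the next three lemmas express the pieces by the whole graph, \<open>W\<close>,
  \<open>b\<close> and \<open>d\<close>, so that uniqueness of \<open>W\<close> and \<open>d\<close>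
  settles injectivity.\<close>

lemma beta1_eq: "\<beta>\<^sub>1 = (\<lambda>x. if x \<in> W \<and> \<beta> x \<in> W then \<beta> x else x)"
proof
  fix x show "\<beta>\<^sub>1 x = (if x \<in> W \<and> \<beta> x \<in> W then \<beta> x else x)"
    using leaves_head_iff[of x] beta_head[of x] beta1_fix m1 by (auto simp: matching_fix_iff)
qed

lemma beta2_eq: "\<beta>\<^sub>2 = (\<lambda>x. if x = d then \<beta> b else if x = \<beta> b then d else if x \<in> W then x else \<beta> x)"
proof
  fix x show "\<beta>\<^sub>2 x = (if x = d then \<beta> b else if x = \<beta> b then d else if x \<in> W then x else \<beta> x)"
    using beta_tail[of x] beta_simps m2 by (auto simp: matching_fix_iff)
qed

lemma sigma1_eq: "\<sigma>\<^sub>1 = restrict_id \<sigma> W"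
  using s1 by (auto simp: fun_eq_iff restrict_id_def sigma_eq permutes_not_in)

lemma sigma2_eq: "\<sigma>\<^sub>2 = (\<lambda>x. if x \<in> W then x else \<sigma> x)"
  using s2 by (auto simp: fun_eq_iff sigma_eq permutes_not_in)

end

section \<open>Existence of the first link\<close>

lemma crossed_twice_unlink:
  assumes "matching V \<beta>" "b \<in> S" "\<beta> b \<in> S" "crossed_twice \<beta> S"
  shows "crossed_twice (unlink b \<beta>) S"
proof -
  have "unlink b \<beta> x \<notin> S" if "x \<in> S" "\<beta> x \<notin> S" for x
    using that assms(1-3) by (auto simp: unlink_def)
  then show ?thesis using assms(4) unfolding crossed_twice_def by blast
qed

text \<open>After the cut at \<open>b\<close> some closed set is left by at most one boson edge. The
  smallest such set containing \<open>b\<close> but not its partner is the first link; minimality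
  makes it 1PI.\<close>

lemma unlinked_head:
  assumes V: "finite V" "b \<in> V" and p: "(\<sigma>, \<beta>) \<in> yuk V {}" and nb: "\<not> bridgeless V \<sigma> (unlink b \<beta>)"
  obtains W e d \<sigma>\<^sub>1 \<beta>\<^sub>1 \<sigma>\<^sub>2 \<beta>\<^sub>2 where "glued V W b e d \<sigma>\<^sub>1 \<beta>\<^sub>1 \<sigma>\<^sub>2 \<beta>\<^sub>2 \<sigma> \<beta>"
proof -
  have s: "\<sigma> permutes V" and m: "matching V \<beta>" and bl: "bridgeless V \<sigma> \<beta>"
    using p by (auto simp: yuk_def)
  define c where "c = \<beta> b"
  have c: "c \<in> V" "c \<noteq> b" "\<beta> c = b"
    using V m by (auto simp: c_def matching_in_iff matching_fix_iff)
  define \<gamma> where "\<gamma> = unlink b \<beta>"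
  have \<gamma>: "\<gamma> x = (if x = b \<or> x = c then x else \<beta> x)" for x
    by (auto simp: \<gamma>_def unlink_def c_def)
  have m\<gamma>: "matching (V - {b, c}) \<gamma>" using matching_unlink[OF m] by (simp add: \<gamma>_def c_def)
  define P where "P S \<longleftrightarrow> S \<subseteq> V \<and> b \<in> S \<and> c \<notin> S \<and> \<sigma> ` S = S \<and> \<not> crossed_twice \<gamma> S" for S
  \<comment> \<open>The condition \<open>c \<notin> S\<close> is automatic: if both ends of the cut
    edge lie in \<open>S\<close>, the cut does not change its crossings, and the uncut graph is
    1PI.\<close>
  have P_I: "P S" if S: "S \<subseteq> V" "S \<noteq> V" "b \<in> S" "\<sigma> ` S = S" "\<not> crossed_twice \<gamma> S" for S
  proof -
    have "crossed_twice \<beta> S" using S by (intro bridgelessD[OF bl]) auto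
    then have "c \<notin> S" using S(3,5) crossed_twice_unlink[OF m, of b S] by (auto simp: \<gamma>_def c_def)
    then show ?thesis using S by (simp add: P_def)
  qed
  obtain S0 where S0: "S0 \<subseteq> V" "S0 \<noteq> {}" "S0 \<noteq> V" "\<sigma> ` S0 = S0" "\<not> crossed_twice \<gamma> S0"
    using nb unfolding bridgeless_def \<gamma>_def by blast
  have "\<exists>S. P S"
  proof (cases "b \<in> S0")
    case True
    then show ?thesis using P_I S0 by blast
  next
    case False
    \<comment> \<open>A set and its complement are left by the same boson edges, so the one
      containing \<open>b\<close> can be taken.\<close>
    have "\<not> crossed_twice \<gamma> (V - S0)" using crossed_twice_Diff[OF m\<gamma> _ S0(1)] S0(5) by blast
    then have "P (V - S0)"
      using S0 False V(2) permutes_image_Diff[OF s S0(1,4)] by (intro P_I) auto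
    then show ?thesis by blast
  qed
  then obtain W where PW: "P W" and W_min: "\<And>S. P S \<Longrightarrow> card W \<le> card S"
    using ex_has_least_nat[of P _ card] by metis
  have W: "W \<subseteq> V" "b \<in> W" "c \<notin> W" "\<sigma> ` W = W" "\<not> crossed_twice \<gamma> W" "W \<noteq> V"
    using PW c by (auto simp: P_def)
  \<comment> \<open>Of the two crossings in the uncut graph one is not at \<open>b\<close>; it gives
    the second exit \<open>e\<close>.\<close>
  have "crossed_twice \<beta> W" using W by (intro bridgelessD[OF bl]) auto
  then obtain e where e: "e \<in> W" "\<beta> e \<notin> W" "e \<noteq> b" by (rule crossed_twice_other)
  define d where "d = \<beta> e"
  have de: "\<beta> d = e" using m by (simp add: d_def)
  have d: "d \<in> V - W" "d \<noteq> c" "d \<noteq> b"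
    using e W m by (auto simp: d_def c_def matching_in_iff matching_eq_iff)
  have leave: "x = b \<or> x = e" if "x \<in> W" "\<beta> x \<notin> W" for x
  proof (rule ccontr)
    assume x: "\<not> (x = b \<or> x = e)"
    have "\<gamma> x \<notin> W" "\<gamma> e \<notin> W" using that x e W by (auto simp: \<gamma>)
    then show False using W(5) x that e unfolding crossed_twice_def by blast
  qed
  define \<beta>\<^sub>1 where "\<beta>\<^sub>1 = (\<lambda>x. if x \<in> W \<and> x \<noteq> b \<and> x \<noteq> e then \<beta> x else x)"
  \<comment> \<open>Taking away the first link leaves \<open>c\<close> and \<open>d\<close>
    unmatched; joining them closes up the rest of the chain.\<close>
  define \<beta>\<^sub>2 where "\<beta>\<^sub>2 = (\<lambda>x. if x = d then c else if x = c then d else if x \<in> W then x else \<beta> x)"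
  define \<sigma>\<^sub>1 where "\<sigma>\<^sub>1 = restrict_id \<sigma> W"
  define \<sigma>\<^sub>2 where "\<sigma>\<^sub>2 = restrict_id \<sigma> (V - W)"
  have im: "\<sigma> ` (V - W) = V - W" using permutes_image_Diff[OF s W(1,4)] .
  have s1: "\<sigma>\<^sub>1 permutes W" and s2: "\<sigma>\<^sub>2 permutes V - W"
    unfolding \<sigma>\<^sub>1_def \<sigma>\<^sub>2_def using permutes_restrict[OF s] W(4) im by blast+
  have m1: "matching (W - {b, e}) \<beta>\<^sub>1"
  proof -
    have *: "\<beta> x \<in> W - {b, e}" if "x \<in> W - {b, e}" for x
      using that leave[of x] m de W d by (auto simp: c_def d_def)
    show ?thesis unfolding matching_def
    proof (intro conjI allI)
      fix x
      show "\<beta>\<^sub>1 (\<beta>\<^sub>1 x) = x" using *[of x] m by (auto simp: \<beta>\<^sub>1_def)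
      show "\<beta>\<^sub>1 x \<noteq> x \<longleftrightarrow> x \<in> W - {b, e}"
        using W(1) m by (auto simp: \<beta>\<^sub>1_def matching_fix_iff)
    qed
  qed
  have m2: "matching (V - W) \<beta>\<^sub>2"
  proof -
    have *: "\<beta> x \<in> V - W - {c, d}" if "x \<in> V - W - {c, d}" for x
    proof -
      have "\<beta> x \<in> V" "\<beta> x \<noteq> d" "\<beta> x \<noteq> c" "\<beta> x \<noteq> e" "\<beta> x \<noteq> b"
        using that m e(1) W(2) c de by (auto simp: matching_in_iff c_def d_def matching_eq_iff)
      moreover have "\<beta> x \<notin> W" using leave[of "\<beta> x"] that m calculation by auto
      ultimately show ?thesis by blast
    qed
    show ?thesis unfolding matching_def
    proof (intro conjI allI)
      fix x
      show "\<beta>\<^sub>2 (\<beta>\<^sub>2 x) = x"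
      proof (cases "x \<in> V - W - {c, d}")
        case True
        then show ?thesis using *[of x] m by (simp add: \<beta>\<^sub>2_def)
      next
        case False
        then show ?thesis using d matching_fix_iff[OF m, of x] by (auto simp: \<beta>\<^sub>2_def)
      qed
      show "\<beta>\<^sub>2 x \<noteq> x \<longleftrightarrow> x \<in> V - W"
        using c W d matching_fix_iff[OF m, of x] by (auto simp: \<beta>\<^sub>2_def)
    qed
  qed
  text \<open>A set violating 1PI-ness of the link would, by minimality of \<open>W\<close>, have been chosen instead.\<close>
  have bl1: "bridgeless W \<sigma>\<^sub>1 \<beta>\<^sub>1" unfolding bridgeless_def
  proof (intro allI impI)
    have main: "crossed_twice \<beta>\<^sub>1 S"
      if S: "S \<subseteq> W" "S \<noteq> W" "\<sigma> ` S = S" and bS: "b \<in> S" for S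
    proof (cases "e \<in> S")
      case False
      have "card S < card W" using S W V by (intro psubset_card_mono) (auto intro: finite_subset)
      then have "\<not> P S" using W_min[of S] by linarith
      then have "crossed_twice \<gamma> S" using S W bS unfolding P_def by blast
      moreover have "\<beta>\<^sub>1 x = \<gamma> x" if "x \<in> S" for x
        using that False S W by (auto simp: \<gamma> \<beta>\<^sub>1_def)
      ultimately show ?thesis unfolding crossed_twice_def by metis
    next
      \<comment> \<open>Minimality says nothing when \<open>e\<close> lies in \<open>S\<close>. But
        then \<open>W - S\<close> avoids both legs, its boson edges are those of the uncut graph,
        and that graph is 1PI.\<close>
      case True
      have "\<sigma> ` (W - S) = W - S" using image_set_diff[OF permutes_inj[OF s]] S W by metis
      then have "crossed_twice \<beta> (W - S)" using S W by (intro bridgelessD[OF bl]) auto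
      moreover have "\<beta>\<^sub>1 x = \<beta> x" if "x \<in> W - S" for x
        using that True bS by (auto simp: \<beta>\<^sub>1_def)
      ultimately have "crossed_twice \<beta>\<^sub>1 (W - S)" unfolding crossed_twice_def by metis
      then show ?thesis using crossed_twice_Diff[OF m1 _ S(1)] by blast
    qed
    fix S assume "S \<subseteq> W \<and> S \<noteq> {} \<and> S \<noteq> W \<and> \<sigma>\<^sub>1 ` S = S"
    then have S: "S \<subseteq> W" "S \<noteq> {}" "S \<noteq> W" "\<sigma> ` S = S"
      by (auto simp: \<sigma>\<^sub>1_def permutes_restrict_image)
    show "crossed_twice \<beta>\<^sub>1 S"
    proof (cases "b \<in> S")
      case True
      then show ?thesis using main S by blast
    next
      case False
      have "\<sigma> ` (W - S) = W - S" using image_set_diff[OF permutes_inj[OF s]] S W by metis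
      then have "crossed_twice \<beta>\<^sub>1 (W - S)" using S False W(2) by (intro main) auto
      then show ?thesis using crossed_twice_Diff[OF m1 _ S(1)] by blast
    qed
  qed
  have bl2: "bridgeless (V - W) \<sigma>\<^sub>2 \<beta>\<^sub>2" unfolding bridgeless_def
  proof (intro allI impI)
    \<comment> \<open>If \<open>S\<close> misses an end of the new edge between \<open>c\<close> and
      \<open>d\<close>, every crossing of \<open>\<beta>\<close> survives; otherwise the complement
      within \<open>V - W\<close> misses both ends.\<close>
    have main: "crossed_twice \<beta>\<^sub>2 S"
      if S: "S \<subseteq> V - W" "S \<noteq> {}" "\<sigma> ` S = S" and cd: "\<not> (c \<in> S \<and> d \<in> S)" for S
    proof -
      have "crossed_twice \<beta> S" using S W by (intro bridgelessD[OF bl]) auto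
      moreover have "\<beta>\<^sub>2 x \<notin> S" if "x \<in> S" "\<beta> x \<notin> S" for x
        using that S(1) cd by (auto simp: \<beta>\<^sub>2_def)
      ultimately show ?thesis unfolding crossed_twice_def by blast
    qed
    fix S assume "S \<subseteq> V - W \<and> S \<noteq> {} \<and> S \<noteq> V - W \<and> \<sigma>\<^sub>2 ` S = S"
    then have S: "S \<subseteq> V - W" "S \<noteq> {}" "S \<noteq> V - W" "\<sigma> ` S = S"
      by (auto simp: \<sigma>\<^sub>2_def permutes_restrict_image)
    show "crossed_twice \<beta>\<^sub>2 S"
    proof (cases "c \<in> S \<and> d \<in> S")
      case False
      then show ?thesis using main S by blast
    next
      case True
      have "\<sigma> ` (V - W - S) = V - W - S" using image_set_diff[OF permutes_inj[OF s]] S im by metis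
      then have "crossed_twice \<beta>\<^sub>2 (V - W - S)" using S True by (intro main) auto
      then show ?thesis using crossed_twice_Diff[OF m2 _ S(1)] by blast
    qed
  qed
  have "\<beta>\<^sub>2 d = c" by (simp add: \<beta>\<^sub>2_def)
  have "\<sigma> x = (if x \<in> W then \<sigma>\<^sub>1 x else \<sigma>\<^sub>2 x)" for x
    using s W(1) by (auto simp: \<sigma>\<^sub>1_def \<sigma>\<^sub>2_def restrict_id_def permutes_not_in)
  moreover have "\<beta> = (\<lambda>x. if x \<in> W then \<beta>\<^sub>1 x else \<beta>\<^sub>2 x)(b := c, c := b, e := d, d := e)"
  proof
    fix x
    show "\<beta> x = ((\<lambda>x. if x \<in> W then \<beta>\<^sub>1 x else \<beta>\<^sub>2 x)(b := c, c := b, e := d, d := e)) x"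
    proof (cases "x \<in> {b, c, d, e}")
      case True
      then show ?thesis using c d e W de by (auto simp: c_def[symmetric] d_def[symmetric])
    next
      case False
      then show ?thesis by (simp add: \<beta>\<^sub>1_def \<beta>\<^sub>2_def)
    qed
  qed
  ultimately have "(\<sigma>, \<beta>) = glue b (W, e, d, (\<sigma>\<^sub>1, \<beta>\<^sub>1), (\<sigma>\<^sub>2, \<beta>\<^sub>2))"
    using \<open>\<beta>\<^sub>2 d = c\<close> by (simp add: glue_def fun_eq_iff)
  then have "glued V W b e d \<sigma>\<^sub>1 \<beta>\<^sub>1 \<sigma>\<^sub>2 \<beta>\<^sub>2 \<sigma> \<beta>"
    using V W e d s1 s2 m1 m2 bl1 bl2 by unfold_locales (auto simp: yuk_def)
  then show ?thesis by (rule that)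
qed

lemma glued_iff:
  "finite V \<Longrightarrow> glued V W b e d \<sigma>\<^sub>1 \<beta>\<^sub>1 \<sigma>\<^sub>2 \<beta>\<^sub>2 \<sigma> \<beta> \<longleftrightarrow>
   (W, e, d, (\<sigma>\<^sub>1, \<beta>\<^sub>1), (\<sigma>\<^sub>2, \<beta>\<^sub>2))
     \<in> (SIGMA W:{W. b \<in> W \<and> W \<subset> V}. SIGMA e:W - {b}. SIGMA d:V - W. yuk W {b, e} \<times> yuk (V - W) {})
   \<and> (\<sigma>, \<beta>) = glue b (W, e, d, (\<sigma>\<^sub>1, \<beta>\<^sub>1), (\<sigma>\<^sub>2, \<beta>\<^sub>2))"
  unfolding glued_def by auto

lemma glued_unique:
  assumes 1: "glued V W b e d \<sigma>\<^sub>1 \<beta>\<^sub>1 \<sigma>\<^sub>2 \<beta>\<^sub>2 \<sigma> \<beta>" and 2: "glued V W' b e' d' \<sigma>\<^sub>1' \<beta>\<^sub>1' \<sigma>\<^sub>2' \<beta>\<^sub>2' \<sigma> \<beta>"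
  shows "W = W'" "e = e'" "d = d'" "\<sigma>\<^sub>1 = \<sigma>\<^sub>1'" "\<beta>\<^sub>1 = \<beta>\<^sub>1'" "\<sigma>\<^sub>2 = \<sigma>\<^sub>2'" "\<beta>\<^sub>2 = \<beta>\<^sub>2'"
proof -
  have "W \<subseteq> W'"
    using glued.leaves_head_iff[OF 2] by (intro glued.head_le[OF 1, of _ e'] glued.b[OF 2] glued.sigma_W[OF 2]) blast
  moreover have "W' \<subseteq> W"
    using glued.leaves_head_iff[OF 1] by (intro glued.head_le[OF 2, of _ e] glued.b[OF 1] glued.sigma_W[OF 1]) blast
  ultimately show W: "W = W'" by blast
  show e: "e = e'"
    using glued.leaves_head_iff[OF 1, of e'] glued.leaves_head_iff[OF 2, of e'] glued.e[OF 2] W by blast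
  show d: "d = d'"
    using glued.beta_simps(3)[OF 1] glued.beta_simps(3)[OF 2] e by simp
  note 2 = 2[folded W d]
  show "\<sigma>\<^sub>1 = \<sigma>\<^sub>1'" using glued.sigma1_eq[OF 1] glued.sigma1_eq[OF 2] by (rule trans[OF _ sym])
  show "\<sigma>\<^sub>2 = \<sigma>\<^sub>2'" using glued.sigma2_eq[OF 1] glued.sigma2_eq[OF 2] by (rule trans[OF _ sym])
  show "\<beta>\<^sub>1 = \<beta>\<^sub>1'" using glued.beta1_eq[OF 1] glued.beta1_eq[OF 2] by (rule trans[OF _ sym])
  show "\<beta>\<^sub>2 = \<beta>\<^sub>2'" using glued.beta2_eq[OF 1] glued.beta2_eq[OF 2] by (rule trans[OF _ sym])
qed

lemma card_yuk_unlinked: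
  assumes V: "finite V" "b \<in> V"
  shows "card {p \<in> yuk V {}. \<not> bridgeless V (fst p) (unlink b (snd p))}
     = (\<Sum>W | b \<in> W \<and> W \<subset> V. \<Sum>e\<in>W - {b}. \<Sum>d\<in>V - W. card (yuk W {b, e}) * card (yuk (V - W) {}))"
proof -
  let ?X = "SIGMA W:{W. b \<in> W \<and> W \<subset> V}. SIGMA e:W - {b}. SIGMA d:V - W. yuk W {b, e} \<times> yuk (V - W) {}"
  let ?Y = "{p \<in> yuk V {}. \<not> bridgeless V (fst p) (unlink b (snd p))}"
  have gl: "glued V W b e d \<sigma>\<^sub>1 \<beta>\<^sub>1 \<sigma>\<^sub>2 \<beta>\<^sub>2 \<sigma> \<beta>"
    if "p \<in> ?X" "p = (W, e, d, (\<sigma>\<^sub>1, \<beta>\<^sub>1), (\<sigma>\<^sub>2, \<beta>\<^sub>2))" "(\<sigma>, \<beta>) = glue b p" for p W e d \<sigma>\<^sub>1 \<beta>\<^sub>1 \<sigma>\<^sub>2 \<beta>\<^sub>2 \<sigma> \<beta>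
    using that unfolding glued_iff[OF V(1)] by blast
  have "bij_betw (glue b) ?X ?Y"
  proof (rule bij_betw_imageI)
    show "inj_on (glue b) ?X"
    proof (rule inj_onI)
      fix p q assume pq: "p \<in> ?X" "q \<in> ?X" "glue b p = glue b q"
      obtain W e d \<sigma>\<^sub>1 \<beta>\<^sub>1 \<sigma>\<^sub>2 \<beta>\<^sub>2 where p: "p = (W, e, d, (\<sigma>\<^sub>1, \<beta>\<^sub>1), (\<sigma>\<^sub>2, \<beta>\<^sub>2))"
        by (metis prod.exhaust)
      obtain W' e' d' \<sigma>\<^sub>1' \<beta>\<^sub>1' \<sigma>\<^sub>2' \<beta>\<^sub>2' where q: "q = (W', e', d', (\<sigma>\<^sub>1', \<beta>\<^sub>1'), (\<sigma>\<^sub>2', \<beta>\<^sub>2'))"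
        by (metis prod.exhaust)
      obtain \<sigma> \<beta> where g: "(\<sigma>, \<beta>) = glue b p" by (metis prod.exhaust)
      show "p = q"
        using glued_unique[OF gl[OF pq(1) p g] gl[OF pq(2) q, unfolded pq(3)[symmetric], OF g]]
        by (simp add: p q)
    qed
    show "glue b ` ?X = ?Y"
    proof (intro equalityI subsetI)
      fix r assume "r \<in> glue b ` ?X"
      then obtain p where p: "p \<in> ?X" "r = glue b p" by blast
      obtain W e d \<sigma>\<^sub>1 \<beta>\<^sub>1 \<sigma>\<^sub>2 \<beta>\<^sub>2 where p': "p = (W, e, d, (\<sigma>\<^sub>1, \<beta>\<^sub>1), (\<sigma>\<^sub>2, \<beta>\<^sub>2))"
        by (metis prod.exhaust)
      obtain \<sigma> \<beta> where r: "r = (\<sigma>, \<beta>)" by (metis prod.exhaust)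
      have G: "glued V W b e d \<sigma>\<^sub>1 \<beta>\<^sub>1 \<sigma>\<^sub>2 \<beta>\<^sub>2 \<sigma> \<beta>" using gl[OF p(1) p'] p(2) r by simp
      show "r \<in> ?Y"
        using glued.sigma_permutes[OF G] glued.matching_glued[OF G] glued.bridgeless_glued[OF G]
          glued.not_bridgeless_unlink[OF G] by (simp add: r yuk_def)
    next
      fix r assume "r \<in> ?Y"
      moreover obtain \<sigma> \<beta> where r: "r = (\<sigma>, \<beta>)" by (metis prod.exhaust)
      ultimately have "(\<sigma>, \<beta>) \<in> yuk V {}" "\<not> bridgeless V \<sigma> (unlink b \<beta>)" by auto
      then obtain W e d \<sigma>\<^sub>1 \<beta>\<^sub>1 \<sigma>\<^sub>2 \<beta>\<^sub>2 where "glued V W b e d \<sigma>\<^sub>1 \<beta>\<^sub>1 \<sigma>\<^sub>2 \<beta>\<^sub>2 \<sigma> \<beta>"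
        by (rule unlinked_head[OF V])
      then show "r \<in> glue b ` ?X" unfolding glued_iff[OF V(1)] r by blast
    qed
  qed
  then have "card ?Y = card ?X" by (rule bij_betw_same_card[symmetric])
  also have "\<dots> = (\<Sum>W | b \<in> W \<and> W \<subset> V. card (SIGMA e:W - {b}. SIGMA d:V - W. yuk W {b, e} \<times> yuk (V - W) {}))"
  proof (rule card_SigmaI)
    show "finite {W. b \<in> W \<and> W \<subset> V}" by (rule finite_subset[of _ "Pow V"]) (use V in auto)
    show "\<forall>W\<in>{W. b \<in> W \<and> W \<subset> V}. finite (SIGMA e:W - {b}. SIGMA d:V - W. yuk W {b, e} \<times> yuk (V - W) {})"
    proof
      fix W assume "W \<in> {W. b \<in> W \<and> W \<subset> V}"
      then have "finite W" using V by (auto intro: finite_subset)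
      then show "finite (SIGMA e:W - {b}. SIGMA d:V - W. yuk W {b, e} \<times> yuk (V - W) {})"
        using V by (intro finite_SigmaI finite_cartesian_product finite_yuk) auto
    qed
  qed
  also have "\<dots> = (\<Sum>W | b \<in> W \<and> W \<subset> V. \<Sum>e\<in>W - {b}. \<Sum>d\<in>V - W. card (yuk W {b, e}) * card (yuk (V - W) {}))"
  proof (intro sum.cong refl)
    fix W assume W: "W \<in> {W. b \<in> W \<and> W \<subset> V}"
    have fin: "finite (W - {b})" "finite (V - W)" "finite (yuk W {b, e})" "finite (yuk (V - W) {})" for e
      using W V by (auto intro: finite_subset finite_yuk)
    show "card (SIGMA e:W - {b}. SIGMA d:V - W. yuk W {b, e} \<times> yuk (V - W) {})
      = (\<Sum>e\<in>W - {b}. \<Sum>d\<in>V - W. card (yuk W {b, e}) * card (yuk (V - W) {}))"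
      using fin by (simp add: card_SigmaI card_cartesian_product)
  qed
  finally show ?thesis .
qed

section \<open>Counting labelled graphs\<close>

text \<open>The values are 0, 1, 1, 4, 27, 248, and so on. Averaging the terms for \<open>k\<close>
  and \<open>n - k\<close> turns the factor into \<open>n - 1\<close>, which is Stein's recursion
  for connected chord diagrams.\<close>

fun ccn :: "nat \<Rightarrow> nat" where
  "ccn n = (if n \<le> 1 then n else \<Sum>k = 1..<n. (2 * k - 1) * ccn k * ccn (n - k))"

declare ccn.simps [simp del]

lemma ccn_0 [simp]: "ccn 0 = 0" and ccn_1 [simp]: "ccn (Suc 0) = 1"
  by (simp_all add: ccn.simps)

lemma ccn_rec: "n > 1 \<Longrightarrow> ccn n = (\<Sum>k = 1..<n. (2 * k - 1) * ccn k * ccn (n - k))"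
  by (simp add: ccn.simps[of n])

lemma sum_psubset_card:
  fixes g :: "nat \<Rightarrow> nat"
  assumes "finite A"
  shows "(\<Sum>B | B \<subset> A. g (card B)) = (\<Sum>j<card A. (card A choose j) * g j)"
proof -
  have fin: "finite {B. B \<subset> A}" by (rule finite_subset[of _ "Pow A"]) (use assms in auto)
  have "(\<Sum>B | B \<subset> A. g (card B)) = (\<Sum>j<card A. \<Sum>B | B \<in> {B. B \<subset> A} \<and> card B = j. g (card B))"
    by (rule sum.group[symmetric]) (use fin assms in \<open>auto intro: psubset_card_mono\<close>)
  also have "\<dots> = (\<Sum>j<card A. (card A choose j) * g j)"
  proof (rule sum.cong[OF refl])
    fix j assume "j \<in> {..<card A}"
    then have "{B. B \<in> {B. B \<subset> A} \<and> card B = j} = {B. B \<subseteq> A \<and> card B = j}" by auto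
    then show "(\<Sum>B | B \<in> {B. B \<subset> A} \<and> card B = j. g (card B)) = (card A choose j) * g j"
      by (simp add: n_subsets[OF assms])
  qed
  finally show ?thesis .
qed

lemma yuk_odd_empty:
  assumes "finite V" "F \<subseteq> V" "odd (card V - card F)"
  shows "yuk V F = {}"
proof -
  have "card (V - F) = card V - card F" using assms by (simp add: card_Diff_subset finite_subset)
  then show ?thesis using assms even_card_matching[of "V - F"] by (auto simp: yuk_def)
qed

text \<open>The one-loop tadpole, a leg on a fermion loop. It is counted by hand because without its
  vertex there is no fermion edge to insert the leg into.\<close>

lemma card_yuk_single: "card (yuk {r} {r}) = 1"
proof -
  have "yuk {r} {r} = {(id, id)}"
    by (auto simp: yuk_def matching_empty_iff bridgeless_def)
  then show ?thesis by simp
qed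

text \<open>The vacuum count enters as a hypothesis because the induction proving it uses this
  formula for fewer boson edges. The \<open>2 * k\<close> fermion edges available for the leg raise
  \<open>fact (2 * k - 1)\<close> to \<open>fact (2 * k)\<close>.\<close>

lemma card_yuk_one_leg:
  assumes vac: "\<And>U. finite U \<Longrightarrow> card U = 2 * k \<Longrightarrow> k \<ge> 1 \<Longrightarrow> card (yuk U {}) = fact (2 * k - 1) * ccn (Suc k)"
    and V: "finite V" "r \<in> V" "card V = 2 * k + 1"
  shows "card (yuk V {r}) = fact (2 * k) * ccn (Suc k)"
proof (cases "k = 0")
  case True
  then have "V = {r}" using V by (auto simp: card_1_singleton_iff)
  then show ?thesis using True card_yuk_single by simp
next
  case False
  define U where "U = V - {r}"
  have U: "finite U" "card U = 2 * k" "r \<notin> U" "V = insert r U" using V by (auto simp: U_def)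
  then have "U \<noteq> {}" using False by auto
  have "fact (2 * k) = 2 * k * fact (2 * k - 1)" using False by (subst fact_reduce) auto
  then show ?thesis using card_yuk_insert[OF U(1) \<open>U \<noteq> {}\<close> U(3), of "{}"] vac[OF U(1,2)] U False by simp
qed

lemma card_yuk_two_legs:
  assumes vac: "\<And>U. finite U \<Longrightarrow> card U = 2 * k \<Longrightarrow> k \<ge> 1 \<Longrightarrow> card (yuk U {}) = fact (2 * k - 1) * ccn (Suc k)"
    and V: "finite V" "r \<in> V" "e \<in> V" "r \<noteq> e" "card V = 2 * Suc k"
  shows "card (yuk V {r, e}) = fact (2 * k + 1) * ccn (Suc k)"
proof -
  define U where "U = V - {e}"
  have U: "finite U" "card U = 2 * k + 1" "e \<notin> U" "V = insert e U" "r \<in> U" using V by (auto simp: U_def)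
  then have "U \<noteq> {}" by auto
  have "card (yuk V {r, e}) = (2 * k + 1) * (fact (2 * k) * ccn (Suc k))"
    using card_yuk_insert[OF U(1) \<open>U \<noteq> {}\<close> U(3), of "{r}"] card_yuk_one_leg[OF vac U(1) U(5) U(2)] U(2,4)
    by (simp add: insert_commute)
  then show ?thesis by (simp add: algebra_simps)
qed

text \<open>Behind the formula, \<open>ccn (Suc m)\<close> counts leg-free graphs with
  \<open>m\<close> boson edges and a marked vertex. A marked graph has no automorphism, so with the
  label of the mark fixed the others are distributed in \<open>fact (2 * m - 1)\<close> ways.
  Inserting a leg into the fermion edge leaving the mark gives a tadpole with \<open>m + 1\<close>
  loops, hence the shift.\<close>

lemma card_yuk_vacuum:
  "finite V \<Longrightarrow> card V = 2 * m \<Longrightarrow> m \<ge> 1 \<Longrightarrow> card (yuk V {}) = fact (2 * m - 1) * ccn (Suc m)"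
proof (induction m arbitrary: V rule: less_induct)
  case (less m)
  note V = less.prems(1,2)
  obtain b where b: "b \<in> V" using less.prems by (metis all_not_in_conv card.empty mult_is_0 not_one_le_zero zero_neq_numeral)
  have two: "card (yuk W {b, e}) = fact (2 * k - 1) * ccn k"
    if W: "W \<subseteq> V" "b \<in> W" "e \<in> W - {b}" "card W = 2 * k" for W e k
  proof -
    have fW: "finite W" using W V by (auto intro: finite_subset)
    then have "k \<ge> 1" using W by (cases k) auto
    then obtain j where j: "k = Suc j" by (cases k) auto
    have "2 * k \<le> 2 * m" using W V by (metis card_mono)
    then have "j < m" using j by simp
    then show ?thesis
      using card_yuk_two_legs[of j W b e] less.IH[of j] fW W j by auto
  qed
  \<comment> \<open>The chain with one link: the \<open>2 * m - 1\<close> choices of the second leg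
    give the summand \<open>k = m\<close>, whose last factor is \<open>ccn 1 = 1\<close>.\<close>
  have linked: "(\<Sum>c\<in>V - {b}. card (yuk V {b, c})) = (2 * m - 1) * (fact (2 * m - 1) * ccn m)"
    using two[OF subset_refl b _ V(2)] V b by simp
  \<comment> \<open>The sum over \<open>k\<close> with \<open>j = 2 * k\<close> has at most one
    term. It makes \<open>g\<close> a function of the size of \<open>W\<close> alone that vanishes
    at odd sizes, which parity excludes.\<close>
  define g where "g j = (\<Sum>k | j = 2 * k. (2 * k - 1) * (2 * m - 2 * k) *
      ((fact (2 * k - 1) * ccn k) * (fact (2 * m - 2 * k - 1) * ccn (Suc (m - k)))))" for j
  have g_even: "g (2 * k) = (2 * k - 1) * (2 * m - 2 * k) *
      ((fact (2 * k - 1) * ccn k) * (fact (2 * m - 2 * k - 1) * ccn (Suc (m - k))))" for k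
    by (simp add: g_def)
  have g_odd: "g j = 0" if "odd j" for j
  proof -
    have "{k. j = 2 * k} = {}" using that by auto
    then show ?thesis by (simp add: g_def)
  qed
  have unlinked_W: "(\<Sum>e\<in>W - {b}. \<Sum>d\<in>V - W. card (yuk W {b, e}) * card (yuk (V - W) {})) = g (card W)"
    if W: "b \<in> W" "W \<subset> V" for W
  proof -
    have fW: "finite W" using W V by (auto intro: finite_subset)
    have cW: "card (V - W) = 2 * m - card W" "card W < 2 * m"
      using W V fW psubset_card_mono[OF V(1) W(2)] by (auto simp: card_Diff_subset)
    show ?thesis
    proof (cases "even (card W)")
      case True
      then obtain k where k: "card W = 2 * k" by (auto elim: evenE)
      have k0: "k \<ge> 1" using k W fW by (cases k) auto
      have "card (yuk (V - W) {}) = fact (2 * (m - k) - 1) * ccn (Suc (m - k))"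
        using V k k0 cW by (intro less.IH) auto
      moreover have "card (yuk W {b, e}) = fact (2 * k - 1) * ccn k" if "e \<in> W - {b}" for e
        using two[of W e k] W that k by blast
      ultimately show ?thesis
        using cW fW W k by (simp add: g_even diff_mult_distrib2 mult.assoc)
    next
      case False
      have "yuk (V - W) {} = {}" using V False cW by (intro yuk_odd_empty) auto
      then show ?thesis using False by (simp add: g_odd)
    qed
  qed
  \<comment> \<open>The link always contains \<open>b\<close>, so only its other vertices are
    chosen; sizes shift by one and the binomial coefficients have top
    \<open>2 * m - 1\<close>.\<close>
  let ?A = "V - {b}"
  have cA: "card ?A = 2 * m - 1" "finite ?A" using V b by auto
  have "bij_betw (insert b) {B. B \<subset> ?A} {W. b \<in> W \<and> W \<subset> V}"
    by (rule bij_betw_byWitness[of _ "\<lambda>W. W - {b}"]) (use b in auto)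
  then have "(\<Sum>W | b \<in> W \<and> W \<subset> V. g (card W)) = (\<Sum>B | B \<subset> ?A. g (card (insert b B)))"
    by (rule sum.reindex_bij_betw[symmetric])
  also have "\<dots> = (\<Sum>B | B \<subset> ?A. g (Suc (card B)))"
  proof (rule sum.cong[OF refl])
    fix B assume "B \<in> {B. B \<subset> ?A}"
    then have "finite B" "b \<notin> B" using cA by (auto intro: finite_subset)
    then show "g (card (insert b B)) = g (Suc (card B))" by simp
  qed
  also have "\<dots> = (\<Sum>j<2 * m - 1. (2 * m - 1 choose j) * g (Suc j))"
    using sum_psubset_card[OF cA(2), of "\<lambda>j. g (Suc j)"] cA(1) by simp
  also have "\<dots> = (\<Sum>j\<in>(\<lambda>k. 2 * k - 1) ` {1..<m}. (2 * m - 1 choose j) * g (Suc j))"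
  proof (rule sum.mono_neutral_right)
    show "\<forall>j\<in>{..<2 * m - 1} - (\<lambda>k. 2 * k - 1) ` {1..<m}. (2 * m - 1 choose j) * g (Suc j) = 0"
    proof
      fix j assume j: "j \<in> {..<2 * m - 1} - (\<lambda>k. 2 * k - 1) ` {1..<m}"
      have "even j"
      proof (rule ccontr)
        assume "odd j"
        then obtain i where "j = 2 * i + 1" by (auto elim: oddE)
        then have "j = 2 * Suc i - 1" "Suc i \<in> {1..<m}" using j by auto
        then show False using j by blast
      qed
      then show "(2 * m - 1 choose j) * g (Suc j) = 0" by (simp add: g_odd)
    qed
  qed auto
  also have "\<dots> = (\<Sum>k = 1..<m. (2 * m - 1 choose (2 * k - 1)) * g (Suc (2 * k - 1)))"
    by (subst sum.reindex) (auto simp: inj_on_def)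
  \<comment> \<open>The \<open>2 * m - 2 * k\<close> choices of \<open>d\<close> complete
    \<open>fact (2 * m - 2 * k - 1)\<close> to a full factorial, and the binomial coefficient then
    collapses everything to \<open>fact (2 * m - 1)\<close>. The choices of \<open>e\<close> remain
    as the factor \<open>2 * k - 1\<close>.\<close>
  also have "\<dots> = (\<Sum>k = 1..<m. fact (2 * m - 1) * ((2 * k - 1) * ccn k * ccn (Suc m - k)))"
  proof (rule sum.cong[OF refl])
    fix k assume k: "k \<in> {1..<m}"
    have "2 * m - 2 * k = Suc (2 * m - 2 * k - 1)" using k by auto
    then have f: "fact (2 * m - 2 * k) = (2 * m - 2 * k) * (fact (2 * m - 2 * k - 1) :: nat)"
      by (metis fact_Suc of_nat_id)
    have "fact (2 * k - 1) * fact (2 * m - 1 - (2 * k - 1)) * (2 * m - 1 choose (2 * k - 1)) = fact (2 * m - 1)"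
      using k by (intro binomial_fact_lemma) auto
    moreover have "2 * m - 1 - (2 * k - 1) = 2 * m - 2 * k" using k by auto
    ultimately have bin: "fact (2 * m - 1) = fact (2 * k - 1) * ((2 * m - 2 * k) * fact (2 * m - 2 * k - 1)) * (2 * m - 1 choose (2 * k - 1))"
      using f by simp
    have "Suc (2 * k - 1) = 2 * k" "Suc m - k = Suc (m - k)" using k by auto
    then show "(2 * m - 1 choose (2 * k - 1)) * g (Suc (2 * k - 1)) = fact (2 * m - 1) * ((2 * k - 1) * ccn k * ccn (Suc m - k))"
      unfolding bin by (simp only: g_even) (simp only: mult_ac)
  qed
  finally have unlinked: "(\<Sum>W | b \<in> W \<and> W \<subset> V. g (card W)) =
      fact (2 * m - 1) * (\<Sum>k = 1..<m. (2 * k - 1) * ccn k * ccn (Suc m - k))"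
    by (simp add: sum_distrib_left)
  have "yuk V {} = {p \<in> yuk V {}. bridgeless V (fst p) (unlink b (snd p))} \<union>
      {p \<in> yuk V {}. \<not> bridgeless V (fst p) (unlink b (snd p))}" by blast
  then have "card (yuk V {}) = card {p \<in> yuk V {}. bridgeless V (fst p) (unlink b (snd p))} +
      card {p \<in> yuk V {}. \<not> bridgeless V (fst p) (unlink b (snd p))}"
    by (metis (no_types, lifting) card_Un_disjoint disjoint_iff finite_Un finite_yuk V(1) mem_Collect_eq)
  also have "\<dots> = (2 * m - 1) * (fact (2 * m - 1) * ccn m) +
      fact (2 * m - 1) * (\<Sum>k = 1..<m. (2 * k - 1) * ccn k * ccn (Suc m - k))"
    unfolding card_yuk_linked[OF V(1) b] card_yuk_unlinked[OF V(1) b] linked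
    using unlinked unlinked_W by simp
  also have "\<dots> = fact (2 * m - 1) * (\<Sum>k = 1..<Suc m. (2 * k - 1) * ccn k * ccn (Suc m - k))"
  proof -
    have "(\<Sum>k = 1..<Suc m. (2 * k - 1) * ccn k * ccn (Suc m - k)) =
        (\<Sum>k = 1..<m. (2 * k - 1) * ccn k * ccn (Suc m - k)) + (2 * m - 1) * ccn m"
      using less.prems(3) by (simp add: sum.atLeastLessThan_Suc)
    then show ?thesis by (simp only: add_mult_distrib2 mult_ac add_ac)
  qed
  also have "\<dots> = fact (2 * m - 1) * ccn (Suc m)"
    using less.prems(3) by (simp add: ccn_rec)
  finally show ?case .
qed

lemma card_yuk_tadpole:
  assumes "finite V" "r \<in> V" "card V = 2 * n + 1"
  shows "card (yuk V {r}) = fact (2 * n) * ccn (Suc n)"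
  using card_yuk_one_leg[OF card_yuk_vacuum assms] .

section \<open>Isomorphism classes of tadpoles\<close>

definition graph_of :: "nat \<Rightarrow> (nat \<Rightarrow> nat) \<Rightarrow> (nat \<Rightarrow> nat) \<Rightarrow> ygraph" where
  "graph_of m \<sigma> \<beta> =
     (m, \<lambda>v. if v < m then Some (\<sigma> v) else None, \<lambda>v. if \<beta> v = v then None else Some (\<beta> v))"

text \<open>Passes from paths to cuts, the language of \<open>bridgeless\<close>. The ends are
  assumed to be vertices so that the set of vertices reachable from a given one is left by no
  edge.\<close>

lemma connected_via_iff:
  assumes "\<And>e. e \<in> E \<Longrightarrow> fst (yends G e) < fst G \<and> snd (yends G e) < fst G"
  shows "connected_via G E \<longleftrightarrow> (\<forall>S. S \<subseteq> {..<fst G} \<and> S \<noteq> {} \<and> S \<noteq> {..<fst G} \<longrightarrow>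
           (\<exists>e\<in>E. (fst (yends G e) \<in> S) \<noteq> (snd (yends G e) \<in> S)))"
proof -
  define adj where "adj = {(a, b). \<exists>e\<in>E. yends G e = (a, b) \<or> yends G e = (b, a)}"
  have conn: "connected_via G E \<longleftrightarrow> (\<forall>a b. a < fst G \<and> b < fst G \<longrightarrow> (a, b) \<in> adj\<^sup>*)"
    by (simp add: connected_via_def adj_def Let_def)
  show ?thesis
  proof (intro iffI allI impI)
    fix S assume L: "connected_via G E" and S: "S \<subseteq> {..<fst G} \<and> S \<noteq> {} \<and> S \<noteq> {..<fst G}"
    then obtain a b where ab: "a \<in> S" "b < fst G" "b \<notin> S" by blast
    show "\<exists>e\<in>E. (fst (yends G e) \<in> S) \<noteq> (snd (yends G e) \<in> S)"
    proof (rule ccontr)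
      assume no: "\<not> ?thesis"
      have "(a, b) \<in> adj\<^sup>*" using L ab S conn by auto
      then have "b \<in> S"
      proof (induction rule: rtrancl_induct)
        case (step y z)
        then obtain e where "e \<in> E" "yends G e = (y, z) \<or> yends G e = (z, y)"
          by (auto simp: adj_def)
        then show ?case using no step.IH by (metis fst_conv snd_conv)
      qed (use ab in simp)
      then show False using ab by simp
    qed
  next
    assume R: "\<forall>S. S \<subseteq> {..<fst G} \<and> S \<noteq> {} \<and> S \<noteq> {..<fst G} \<longrightarrow>
           (\<exists>e\<in>E. (fst (yends G e) \<in> S) \<noteq> (snd (yends G e) \<in> S))"
    show "connected_via G E" unfolding conn
    proof (intro allI impI)
      fix a b assume ab: "a < fst G \<and> b < fst G"
      define S where "S = {x. x < fst G \<and> (a, x) \<in> adj\<^sup>*}"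
      have "S = {..<fst G}"
      proof (rule ccontr)
        assume "S \<noteq> {..<fst G}"
        moreover have "S \<subseteq> {..<fst G}" "S \<noteq> {}" using ab by (auto simp: S_def)
        ultimately obtain e where e: "e \<in> E" "(fst (yends G e) \<in> S) \<noteq> (snd (yends G e) \<in> S)"
          using R by blast
        obtain x y where xy: "yends G e = (x, y)" by fastforce
        have "(x, y) \<in> adj" "(y, x) \<in> adj" using e(1) xy by (auto simp: adj_def)
        moreover have "x < fst G" "y < fst G" using assms[OF e(1)] xy by auto
        ultimately show False using e(2) xy by (auto simp: S_def intro: rtrancl_into_rtrancl)
      qed
      then show "(a, b) \<in> adj\<^sup>*" using ab by (auto simp: S_def)
    qed
  qed
qed

locale graph_data =
  fixes m :: nat and \<sigma> \<beta> :: "nat \<Rightarrow> nat" and M :: "nat set"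
  assumes s: "\<sigma> permutes {..<m}" and mt: "matching M \<beta>" and M: "M \<subseteq> {..<m}"
begin

lemma beta_lt: "\<beta> v < m \<longleftrightarrow> v < m"
proof (cases "v \<in> M")
  case True
  then show ?thesis using mt M matching_in_iff[OF mt, of v] by auto
next
  case False
  then show ?thesis using matching_fix_iff[OF mt, of v] by simp
qed

lemma beta_neq_lt: "\<beta> v \<noteq> v \<Longrightarrow> v < m"
  using mt M by (auto simp: matching_fix_iff)

lemma sigma_lt: "\<sigma> v < m \<longleftrightarrow> v < m"
  using permutes_in_image[OF s, of v] by simp

lemma yedges_graph_of: "yedges (graph_of m \<sigma> \<beta>) = Inl ` {..<m} \<union> Inr ` {u \<in> M. u < \<beta> u}"
proof -
  have "{u. u < m \<and> (\<exists>v. (if \<beta> u = u then None else Some (\<beta> u)) = Some v \<and> u < v)} = {u \<in> M. u < \<beta> u}"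
    (is "?L = ?R")
  proof (rule set_eqI)
    fix u show "u \<in> ?L \<longleftrightarrow> u \<in> ?R"
      using beta_neq_lt[of u] matching_fix_iff[OF mt, of u] by auto
  qed
  moreover have "{v. v < m \<and> (if v < m then Some (\<sigma> v) else None) \<noteq> None} = {..<m}" by auto
  ultimately show ?thesis unfolding yedges_def graph_of_def by simp
qed

lemma yends_Inl: "v < m \<Longrightarrow> yends (graph_of m \<sigma> \<beta>) (Inl v) = (v, \<sigma> v)"
  by (simp add: yends_def graph_of_def)

lemma yends_Inr: "\<beta> u \<noteq> u \<Longrightarrow> yends (graph_of m \<sigma> \<beta>) (Inr u) = (u, \<beta> u)"
  by (simp add: yends_def graph_of_def)

lemma Inr_edge:
  assumes "\<beta> u \<noteq> u"
  shows "Inr (min u (\<beta> u)) \<in> yedges (graph_of m \<sigma> \<beta>)"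
proof -
  have "u \<in> M" "\<beta> u \<in> M" using assms mt by (auto simp: matching_fix_iff matching_in_iff)
  then have "min u (\<beta> u) \<in> {u \<in> M. u < \<beta> u}" using assms mt by (auto simp: min_def)
  then show ?thesis unfolding yedges_graph_of by blast
qed

lemma yends_min: 
  assumes "\<beta> u \<noteq> u"
  shows "yends (graph_of m \<sigma> \<beta>) (Inr (min u (\<beta> u))) \<in> {(u, \<beta> u), (\<beta> u, u)}"
  using yends_Inr[OF assms] yends_Inr[of "\<beta> u"] assms mt by (auto simp: min_def)

lemma yedge_cases:
  assumes "e \<in> yedges (graph_of m \<sigma> \<beta>)"
  obtains v where "e = Inl v" "v < m" "yends (graph_of m \<sigma> \<beta>) e = (v, \<sigma> v)"
    | u where "e = Inr u" "u < \<beta> u" "yends (graph_of m \<sigma> \<beta>) e = (u, \<beta> u)"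
proof -
  have "(\<exists>v<m. e = Inl v) \<or> (\<exists>u. e = Inr u \<and> u < \<beta> u)"
    using assms unfolding yedges_graph_of by auto
  then show ?thesis using that yends_Inl yends_Inr by (metis nat_neq_iff)
qed

lemma connected_via_graph_of:
  assumes "E \<subseteq> yedges (graph_of m \<sigma> \<beta>)"
  shows "connected_via (graph_of m \<sigma> \<beta>) E \<longleftrightarrow> (\<forall>S. S \<subseteq> {..<m} \<and> S \<noteq> {} \<and> S \<noteq> {..<m} \<longrightarrow>
     (\<exists>e\<in>E. (fst (yends (graph_of m \<sigma> \<beta>) e) \<in> S) \<noteq> (snd (yends (graph_of m \<sigma> \<beta>) e) \<in> S)))"
proof -
  have "fst (graph_of m \<sigma> \<beta>) = m" by (simp add: graph_of_def)
  moreover have "fst (yends (graph_of m \<sigma> \<beta>) e) < m \<and> snd (yends (graph_of m \<sigma> \<beta>) e) < m" if "e \<in> E" for e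
  proof -
    have "e \<in> yedges (graph_of m \<sigma> \<beta>)" using assms that by blast
    then show ?thesis using sigma_lt beta_lt beta_neq_lt by (cases rule: yedge_cases) auto
  qed
  ultimately show ?thesis using connected_via_iff[of E "graph_of m \<sigma> \<beta>"] by metis
qed

text \<open>Across a set closed under fermion edges, connectivity gives one boson edge, and
  connectivity without that edge gives a second. Conversely, a set that is not closed has a fermion
  edge leaving it and, by finiteness, another entering it, so no single deletion isolates
  it.\<close>

lemma one_PI_graph_of: "one_PI (graph_of m \<sigma> \<beta>) \<longleftrightarrow> bridgeless {..<m} \<sigma> \<beta>"
proof
  let ?G = "graph_of m \<sigma> \<beta>"
  assume L: "one_PI ?G"
  show "bridgeless {..<m} \<sigma> \<beta>" unfolding bridgeless_def
  proof (intro allI impI)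
    fix S assume S: "S \<subseteq> {..<m} \<and> S \<noteq> {} \<and> S \<noteq> {..<m} \<and> \<sigma> ` S = S"
    have sig: "\<sigma> v \<in> S \<longleftrightarrow> v \<in> S" for v
      using S permutes_inj[OF s] by (metis inj_image_mem_iff)
    have ex: "\<exists>u\<in>S. \<beta> u \<notin> S \<and> Inr (min u (\<beta> u)) \<in> E"
      if E: "E \<subseteq> yedges ?G" "connected_via ?G E" for E
    proof -
      obtain e where e: "e \<in> E" "(fst (yends ?G e) \<in> S) \<noteq> (snd (yends ?G e) \<in> S)"
        using connected_via_graph_of[OF E(1), THEN iffD1, OF E(2), THEN spec, of S] S by fast
      have "e \<in> yedges ?G" using e E by blast
      then show ?thesis
      proof (cases rule: yedge_cases)
        case 1
        then show ?thesis using e(2) sig by simp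
      next
        case (2 u)
        then have "(u \<in> S) \<noteq> (\<beta> u \<in> S)" using e(2) by simp
        moreover have "min u (\<beta> u) = u" "min (\<beta> u) (\<beta> (\<beta> u)) = u" using 2 mt by auto
        ultimately show ?thesis using e(1) 2 mt by (metis matching_invol)
      qed
    qed
    have "connected_via ?G (yedges ?G)" using L by (simp add: one_PI_def)
    then obtain x where x: "x \<in> S" "\<beta> x \<notin> S" using ex by blast
    let ?e = "Inr (min x (\<beta> x))"
    have "?e \<in> yedges ?G" using x by (intro Inr_edge) auto
    then have "connected_via ?G (yedges ?G - {?e})" using L by (simp add: one_PI_def)
    from ex[OF Diff_subset this] obtain y where
      "y \<in> S" "\<beta> y \<notin> S" "Inr (min y (\<beta> y)) \<in> yedges ?G - {?e}" by blast
    then have "y \<in> S" "\<beta> y \<notin> S" "y \<noteq> x" by auto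
    then show "crossed_twice \<beta> S" using x unfolding crossed_twice_def by blast
  qed
next
  let ?G = "graph_of m \<sigma> \<beta>"
  assume R: "bridgeless {..<m} \<sigma> \<beta>"
  \<comment> \<open>Since \<open>e0\<close> is arbitrary, the same statement also yields
    connectivity with nothing deleted.\<close>
  have two: "\<exists>e \<in> yedges ?G - {e0}. (fst (yends ?G e) \<in> S) \<noteq> (snd (yends ?G e) \<in> S)"
    if S: "S \<subseteq> {..<m}" "S \<noteq> {}" "S \<noteq> {..<m}" for S e0
  proof (cases "\<sigma> ` S = S")
    case True
    then have "crossed_twice \<beta> S" using S by (intro bridgelessD[OF R]) auto
    then obtain x y where xy: "x \<in> S" "y \<in> S" "x \<noteq> y" "\<beta> x \<notin> S" "\<beta> y \<notin> S"
      unfolding crossed_twice_def by blast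
    have "min x (\<beta> x) \<noteq> min y (\<beta> y)"
      using xy matching_eq_iff[OF mt, of x y] by (auto simp: min_def)
    then obtain z where z: "z \<in> S" "\<beta> z \<notin> S" "Inr (min z (\<beta> z)) \<noteq> e0"
      using xy by (metis sum.inject(2))
    have "\<beta> z \<noteq> z" using z by auto
    then have "Inr (min z (\<beta> z)) \<in> yedges ?G - {e0}" using z(3) Inr_edge by blast
    moreover have "yends ?G (Inr (min z (\<beta> z))) \<in> {(z, \<beta> z), (\<beta> z, z)}"
      using yends_min \<open>\<beta> z \<noteq> z\<close> by blast
    ultimately show ?thesis using z by (intro bexI[of _ "Inr (min z (\<beta> z))"]) auto
  next
    case False
    have fS: "finite S" using S(1) by (rule finite_subset) simp
    have inj: "inj \<sigma>" using s by (rule permutes_inj)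
    have "\<not> \<sigma> ` S \<subseteq> S" using False endo_inj_surj[OF fS] inj by (metis inj_on_subset subset_UNIV)
    then obtain x where x: "x \<in> S" "\<sigma> x \<notin> S" by blast
    have "\<not> \<sigma> ` (- S) \<subseteq> - S"
    proof
      assume "\<sigma> ` (- S) \<subseteq> - S"
      have "S \<subseteq> \<sigma> ` S"
      proof
        fix x assume "x \<in> S"
        obtain z where z: "x = \<sigma> z" using permutes_surj[OF s] by (metis surjD)
        then have "z \<in> S" using \<open>\<sigma> ` (- S) \<subseteq> - S\<close> \<open>x \<in> S\<close> by blast
        then show "x \<in> \<sigma> ` S" using z by blast
      qed
      moreover have "card (\<sigma> ` S) = card S" using inj by (metis card_image inj_on_subset subset_UNIV)
      ultimately have "\<sigma> ` S = S" using fS by (metis card_subset_eq finite_imageI)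
      then show False using False by simp
    qed
    then obtain y where y: "y \<notin> S" "\<sigma> y \<in> S" by blast
    have lt: "x < m" "y < m" using x y S(1) sigma_lt by auto
    obtain z where z: "z \<in> {x, y}" "Inl z \<noteq> e0" using x y by (metis insertCI sum.inject(1))
    have "Inl z \<in> yedges ?G - {e0}" using z lt by (auto simp: yedges_graph_of)
    moreover have "yends ?G (Inl z) = (z, \<sigma> z)" using z lt yends_Inl by blast
    ultimately show ?thesis using z x y by (intro bexI[of _ "Inl z"]) auto
  qed
  show "one_PI ?G" unfolding one_PI_def
    using connected_via_graph_of two by (metis DiffD1 Diff_subset subset_refl)
qed

lemma yukawa_graph_graph_of: "yukawa_graph (graph_of m \<sigma> \<beta>)"
  using beta_lt beta_neq_lt sigma_lt mt permutes_inj[OF s]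
  by (auto simp: yukawa_graph_def graph_of_def split: if_splits dest: injD) (metis not_le)

lemma ext_graph_of:
  "ext_fermion_out (graph_of m \<sigma> \<beta>) = {}" "ext_fermion_in (graph_of m \<sigma> \<beta>) = {}"
  "ext_boson (graph_of m \<sigma> \<beta>) = {..<m} - M"
proof -
  show "ext_fermion_out (graph_of m \<sigma> \<beta>) = {}" by (auto simp: ext_fermion_out_def graph_of_def)
  have "\<exists>v. (if v < m then Some (\<sigma> v) else None) = Some w" if "w < m" for w
  proof -
    obtain v where "w = \<sigma> v" using permutes_surj[OF s] by (metis surjD)
    then show ?thesis using that sigma_lt by (intro exI[of _ v]) auto
  qed
  then show "ext_fermion_in (graph_of m \<sigma> \<beta>) = {}"
    unfolding ext_fermion_in_def graph_of_def by auto
  show "ext_boson (graph_of m \<sigma> \<beta>) = {..<m} - M"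
    using mt by (auto simp: ext_boson_def graph_of_def matching_fix_iff)
qed

lemma card_yedges_graph_of: "2 * card (yedges (graph_of m \<sigma> \<beta>)) = 2 * m + card M"
proof -
  have fM: "finite M" using M by (rule finite_subset) simp
  have "card (yedges (graph_of m \<sigma> \<beta>)) = m + card {u \<in> M. u < \<beta> u}"
    unfolding yedges_graph_of using fM
    by (subst card_Un_disjoint) (auto simp: card_image)
  then show ?thesis using card_matching[OF mt fM] by simp
qed

end

lemma graph_data_yuk: "(\<sigma>, \<beta>) \<in> yuk {..<m} {r} \<Longrightarrow> graph_data m \<sigma> \<beta> ({..<m} - {r})"
  by (auto simp: yuk_def graph_data_def)

lemma tadpole_iff:
  "tadpole G \<longleftrightarrow> (\<exists>m \<sigma> \<beta> r. G = graph_of m \<sigma> \<beta> \<and> r < m \<and> (\<sigma>, \<beta>) \<in> yuk {..<m} {r})"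
proof
  assume T: "tadpole G"
  obtain m fo bo where G: "G = (m, fo, bo)" by (rule prod_cases3)
  have Y: "(\<forall>v w. fo v = Some w \<longrightarrow> v < m \<and> w < m) \<and>
      (\<forall>v v' w. fo v = Some w \<and> fo v' = Some w \<longrightarrow> v = v') \<and>
      (\<forall>u v. bo u = Some v \<longrightarrow> u < m \<and> v < m \<and> u \<noteq> v \<and> bo v = Some u) \<and>
      (\<forall>v. m \<le> v \<longrightarrow> fo v = None \<and> bo v = None)"
    using T unfolding tadpole_def yukawa_graph_def G prod.case by (elim conjE) (intro conjI)
  have fo: "\<And>v w. fo v = Some w \<Longrightarrow> v < m \<and> w < m" "\<And>v v' w. fo v = Some w \<Longrightarrow> fo v' = Some w \<Longrightarrow> v = v'"
    and bo: "\<And>u v. bo u = Some v \<Longrightarrow> u < m \<and> v < m \<and> u \<noteq> v \<and> bo v = Some u"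
    and none: "\<And>v. m \<le> v \<Longrightarrow> fo v = None \<and> bo v = None"
    using Y by blast+
  have fo_ex: "\<exists>w. fo v = Some w" if "v < m" for v
    using T that by (auto simp: tadpole_def ext_fermion_out_def G)
  have "card (ext_boson G) = 1" using T by (simp add: tadpole_def)
  then obtain r where "ext_boson G = {r}" by (auto simp: card_1_singleton_iff)
  then have r: "{v. v < m \<and> bo v = None} = {r}" by (simp add: ext_boson_def G)
  have r_iff: "v = r \<longleftrightarrow> v < m \<and> bo v = None" for v
    using eqset_imp_iff[OF r, of v] by simp
  \<comment> \<open>The default value is the argument itself: outside the graph for
    \<open>\<sigma>\<close>, at the leg and outside for \<open>\<beta>\<close>. This makes
    \<open>\<sigma>\<close> a permutation and \<open>\<beta>\<close> an involution of all
    naturals.\<close>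
  define \<sigma> where "\<sigma> v = (if v < m then the (fo v) else v)" for v
  define \<beta> where "\<beta> v = (case bo v of None \<Rightarrow> v | Some u \<Rightarrow> u)" for v
  have "inj_on \<sigma> {..<m}"
    unfolding inj_on_def \<sigma>_def using fo(2) fo_ex by (metis lessThan_iff option.sel)
  moreover have "\<sigma> ` {..<m} \<subseteq> {..<m}" using fo(1) fo_ex by (fastforce simp: \<sigma>_def)
  ultimately have "bij_betw \<sigma> {..<m} {..<m}"
    by (simp add: bij_betw_def endo_inj_surj)
  then have s: "\<sigma> permutes {..<m}" by (rule bij_imp_permutes) (auto simp: \<sigma>_def)
  have "\<beta> (\<beta> v) = v" for v
    using bo[of v "the (bo v)"] by (cases "bo v") (auto simp: \<beta>_def)
  moreover have "\<beta> v \<noteq> v \<longleftrightarrow> v \<in> {..<m} - {r}" for v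
  proof (cases "bo v")
    case None
    then show ?thesis using r_iff[of v] by (auto simp: \<beta>_def)
  next
    case (Some u)
    then show ?thesis using r_iff[of v] bo[OF Some] by (simp add: \<beta>_def)
  qed
  ultimately have mt: "matching ({..<m} - {r}) \<beta>" by (simp add: matching_def)
  have Geq: "G = graph_of m \<sigma> \<beta>"
  proof -
    have "fo v = (if v < m then Some (\<sigma> v) else None)" for v
      using fo_ex[of v] none[of v] by (auto simp: \<sigma>_def)
    moreover have "bo v = (if \<beta> v = v then None else Some (\<beta> v))" for v
      using bo[of v "the (bo v)"] by (cases "bo v") (auto simp: \<beta>_def)
    ultimately show ?thesis by (simp add: G graph_of_def fun_eq_iff)
  qed
  interpret graph_data m \<sigma> \<beta> "{..<m} - {r}" using s mt by unfold_locales auto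
  have "bridgeless {..<m} \<sigma> \<beta>" using T one_PI_graph_of by (simp add: tadpole_def Geq)
  then have "(\<sigma>, \<beta>) \<in> yuk {..<m} {r}" using s mt by (simp add: yuk_def)
  moreover have "r < m" using r_iff by blast
  ultimately show "\<exists>m \<sigma> \<beta> r. G = graph_of m \<sigma> \<beta> \<and> r < m \<and> (\<sigma>, \<beta>) \<in> yuk {..<m} {r}"
    using Geq by blast
next
  assume "\<exists>m \<sigma> \<beta> r. G = graph_of m \<sigma> \<beta> \<and> r < m \<and> (\<sigma>, \<beta>) \<in> yuk {..<m} {r}"
  then obtain m \<sigma> \<beta> r where G: "G = graph_of m \<sigma> \<beta>" "r < m" "(\<sigma>, \<beta>) \<in> yuk {..<m} {r}" by blast
  interpret graph_data m \<sigma> \<beta> "{..<m} - {r}" using G(3) by (rule graph_data_yuk)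
  have "{..<m} - ({..<m} - {r}) = {r}" using G(2) by auto
  then show "tadpole G" using G
    by (simp add: tadpole_def yukawa_graph_graph_of ext_graph_of one_PI_graph_of yuk_def)
qed

text \<open>There are \<open>m\<close> fermion and \<open>(m - 1) / 2\<close> boson edges, so the
  loop number is \<open>(m + 1) / 2\<close>.\<close>

lemma loop_number_graph_of:
  assumes "(\<sigma>, \<beta>) \<in> yuk {..<m} {r}" "r < m"
  shows "loop_number (graph_of m \<sigma> \<beta>) = int n \<longleftrightarrow> m + 1 = 2 * n"
proof -
  interpret graph_data m \<sigma> \<beta> "{..<m} - {r}" using assms(1) by (rule graph_data_yuk)
  have "fst (graph_of m \<sigma> \<beta>) = m" by (simp add: graph_of_def)
  then show ?thesis using card_yedges_graph_of assms(2) by (auto simp: loop_number_def)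
qed

lemma tadpoles_loops_eq:
  assumes "m + 1 = 2 * n"
  shows "tadpoles_loops n = (\<lambda>(\<sigma>, \<beta>). graph_of m \<sigma> \<beta>) ` (\<Union>r<m. yuk {..<m} {r})"
proof (intro equalityI subsetI)
  fix G assume "G \<in> tadpoles_loops n"
  then obtain m' \<sigma> \<beta> r where G: "G = graph_of m' \<sigma> \<beta>" "r < m'" "(\<sigma>, \<beta>) \<in> yuk {..<m'} {r}"
    "loop_number G = int n" by (auto simp: tadpoles_loops_def tadpole_iff)
  then have "m' = m" using loop_number_graph_of[OF G(3,2), of n] assms by simp
  then show "G \<in> (\<lambda>(\<sigma>, \<beta>). graph_of m \<sigma> \<beta>) ` (\<Union>r<m. yuk {..<m} {r})" using G by force
next
  fix G assume "G \<in> (\<lambda>(\<sigma>, \<beta>). graph_of m \<sigma> \<beta>) ` (\<Union>r<m. yuk {..<m} {r})"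
  then obtain \<sigma> \<beta> r where G: "G = graph_of m \<sigma> \<beta>" "r < m" "(\<sigma>, \<beta>) \<in> yuk {..<m} {r}" by auto
  then show "G \<in> tadpoles_loops n"
    using loop_number_graph_of[OF G(3,2), of n] assms by (auto simp: tadpoles_loops_def tadpole_iff)
qed

text \<open>A tadpole has at least one loop; this fixes the constant coefficient of the generating
  function.\<close>

lemma tadpoles_loops_0: "tadpoles_loops 0 = {}"
proof -
  have False if "tadpole G" "loop_number G = int 0" for G
  proof -
    obtain m \<sigma> \<beta> r where G: "G = graph_of m \<sigma> \<beta>" "r < m" "(\<sigma>, \<beta>) \<in> yuk {..<m} {r}"
      using \<open>tadpole G\<close> unfolding tadpole_iff by blast
    then show False using loop_number_graph_of[OF G(3,2), of 0] that by simp
  qed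
  then show ?thesis by (auto simp: tadpoles_loops_def)
qed

section \<open>Isomorphism as conjugation by a permutation\<close>

lemma yiso_graph_of:
  assumes "graph_data m \<sigma> \<beta> M" "graph_data m \<sigma>' \<beta>' M'"
  shows "yiso (graph_of m \<sigma> \<beta>) (graph_of m \<sigma>' \<beta>') \<longleftrightarrow>
           (\<exists>f. f permutes {..<m} \<and> \<sigma>' \<circ> f = f \<circ> \<sigma> \<and> \<beta>' \<circ> f = f \<circ> \<beta>)"
proof
  interpret G: graph_data m \<sigma> \<beta> M by fact
  interpret H: graph_data m \<sigma>' \<beta>' M' by fact
  assume "yiso (graph_of m \<sigma> \<beta>) (graph_of m \<sigma>' \<beta>')"
  then obtain f where f: "bij_betw f {..<m} {..<m}"
    and fv: "\<And>v. v < m \<Longrightarrow> (if f v < m then Some (\<sigma>' (f v)) else None) = map_option f (if v < m then Some (\<sigma> v) else None)"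
    "\<And>v. v < m \<Longrightarrow> (if \<beta>' (f v) = f v then None else Some (\<beta>' (f v))) = map_option f (if \<beta> v = v then None else Some (\<beta> v))"
    unfolding yiso_def graph_of_def by auto
  \<comment> \<open>An isomorphism is prescribed on vertices only; extended by the identity it
    becomes a permutation of all naturals, by which functions can be conjugated.\<close>
  define g where "g = restrict_id f {..<m}"
  have g: "g permutes {..<m}" unfolding g_def using f by (rule permutes_restrict_id)
  have gv: "g v = f v" if "v < m" for v using that by (simp add: g_def)
  have gv': "g v = v" if "\<not> v < m" for v using that by (simp add: g_def)
  have "\<sigma>' (g v) = g (\<sigma> v)" for v
  proof (cases "v < m")
    case True
    then have "f v < m" using f by (auto simp: bij_betw_def)
    then show ?thesis using fv(1)[OF True] True G.sigma_lt[of v] by (simp add: gv)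
  next
    case False
    then show ?thesis using G.s H.s by (simp add: gv' permutes_not_in)
  qed
  moreover have "\<beta>' (g v) = g (\<beta> v)" for v
  proof (cases "v < m")
    case True
    then show ?thesis using fv(2)[OF True] G.beta_lt[of v] by (auto simp: gv split: if_splits)
  next
    case False
    then have "\<beta> v = v" "\<beta>' v = v" using G.beta_neq_lt H.beta_neq_lt by blast+
    then show ?thesis using False by (simp add: gv')
  qed
  ultimately show "\<exists>f. f permutes {..<m} \<and> \<sigma>' \<circ> f = f \<circ> \<sigma> \<and> \<beta>' \<circ> f = f \<circ> \<beta>"
    using g by (intro exI[of _ g]) (simp add: fun_eq_iff)
next
  interpret G: graph_data m \<sigma> \<beta> M by fact
  assume "\<exists>f. f permutes {..<m} \<and> \<sigma>' \<circ> f = f \<circ> \<sigma> \<and> \<beta>' \<circ> f = f \<circ> \<beta>"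
  then obtain f where f: "f permutes {..<m}" "\<And>v. \<sigma>' (f v) = f (\<sigma> v)" "\<And>v. \<beta>' (f v) = f (\<beta> v)"
    unfolding fun_eq_iff comp_def by blast
  have "f x = f y \<longleftrightarrow> x = y" for x y using permutes_inj[OF f(1)] by (rule inj_eq)
  moreover have "f v < m \<longleftrightarrow> v < m" for v using permutes_in_image[OF f(1), of v] by simp
  ultimately show "yiso (graph_of m \<sigma> \<beta>) (graph_of m \<sigma>' \<beta>')"
    unfolding yiso_def graph_of_def
    using permutes_imp_bij[OF f(1)] f(2,3) by (auto intro!: exI[of _ f])
qed

lemma matching_relabel:
  assumes "bij f" "matching M \<beta>"
  shows "matching (f ` M) (f \<circ> \<beta> \<circ> inv f)"
proof -
  have inv_f: "inv f (f x) = x" "f (inv f x) = x" for x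
    using assms(1) by (simp_all add: bij_is_inj bij_is_surj surj_f_inv_f)
  have "f (\<beta> (inv f x)) = x \<longleftrightarrow> \<beta> (inv f x) = inv f x" for x
    using inv_f by metis
  moreover have "x \<in> f ` M \<longleftrightarrow> inv f x \<in> M" for x
    using inv_f by (metis imageE imageI)
  ultimately show ?thesis using assms(2) inv_f by (simp add: matching_def)
qed

lemma yuk_relabel:
  assumes f: "f permutes V" and p: "(\<sigma>, \<beta>) \<in> yuk V {r}" and r: "r \<in> V"
  shows "(f \<circ> \<sigma> \<circ> inv f, f \<circ> \<beta> \<circ> inv f) \<in> yuk V {f r}"
proof -
  have s: "\<sigma> permutes V" and mt: "matching (V - {r}) \<beta>" and bl: "bridgeless V \<sigma> \<beta>"
    using p by (auto simp: yuk_def)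
  have inj: "inj f" using f by (rule permutes_inj)
  have inv_f: "inv f (f x) = x" "f (inv f x) = x" for x
    using f by (simp_all add: permutes_inverses)
  have "f \<circ> \<sigma> \<circ> inv f permutes V" using f s by (intro permutes_compose permutes_inv)
  moreover have "f ` (V - {r}) = V - {f r}"
    using image_set_diff[OF inj, of V "{r}"] permutes_image[OF f] by simp
  then have "matching (V - {f r}) (f \<circ> \<beta> \<circ> inv f)"
    using matching_relabel[OF permutes_bij[OF f] mt] by simp
  moreover have "bridgeless V (f \<circ> \<sigma> \<circ> inv f) (f \<circ> \<beta> \<circ> inv f)"
    unfolding bridgeless_def
  proof (intro allI impI)
    fix S assume S: "S \<subseteq> V \<and> S \<noteq> {} \<and> S \<noteq> V \<and> (f \<circ> \<sigma> \<circ> inv f) ` S = S"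
    let ?T = "inv f ` S"
    have fT: "f ` ?T = S" using inv_f by (simp add: image_image)
    have mem: "x \<in> ?T \<longleftrightarrow> f x \<in> S" for x using fT inj by (metis inj_image_mem_iff)
    have "f ` \<sigma> ` ?T = f ` ?T" using S unfolding fT by (simp only: image_comp comp_assoc)
    then have "\<sigma> ` ?T = ?T" using inj by (simp only: inj_image_eq_iff)
    moreover have "?T \<subseteq> V" using S permutes_image[OF permutes_inv[OF f]] by blast
    moreover have "?T \<noteq> V" using S fT permutes_image[OF f] by blast
    ultimately have "crossed_twice \<beta> ?T" using S by (intro bridgelessD[OF bl]) auto
    then obtain x y where "x \<in> ?T" "y \<in> ?T" "x \<noteq> y" "\<beta> x \<notin> ?T" "\<beta> y \<notin> ?T"
      unfolding crossed_twice_def by blast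
    then show "crossed_twice (f \<circ> \<beta> \<circ> inv f) S"
      unfolding crossed_twice_def mem using inv_f inj
      by (intro bexI[of _ "f x"] bexI[of _ "f y"]) (auto simp: inj_eq)
  qed
  ultimately show ?thesis by (simp add: yuk_def)
qed

lemma graph_of_inject:
  assumes "graph_data m \<sigma> \<beta> M" "graph_data m \<sigma>' \<beta>' M'" "graph_of m \<sigma> \<beta> = graph_of m \<sigma>' \<beta>'"
  shows "\<sigma> = \<sigma>'" "\<beta> = \<beta>'"
proof -
  have fo: "(if v < m then Some (\<sigma> v) else None) = (if v < m then Some (\<sigma>' v) else None)"
    and bo: "(if \<beta> v = v then None else Some (\<beta> v)) = (if \<beta>' v = v then None else Some (\<beta>' v))" for v
    using assms(3) unfolding graph_of_def prod.inject by (meson fun_cong)+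
  have "\<sigma> v = \<sigma>' v" for v
    using fo[of v] graph_data.s[OF assms(1)] graph_data.s[OF assms(2)]
    by (cases "v < m") (auto simp: permutes_not_in)
  then show "\<sigma> = \<sigma>'" by blast
  have "\<beta> v = \<beta>' v" for v using bo[of v] by (auto split: if_splits)
  then show "\<beta> = \<beta>'" by blast
qed

text \<open>A relabelling that fixes a tadpole fixes the leg, and the set of its fixed vertices is
  closed under fermion edges and left by no boson edge; so it is the identity.\<close>
lemma relabel_inj:
  assumes p: "(\<sigma>, \<beta>) \<in> yuk V {r}" "r \<in> V" and f: "f permutes V" and g: "g permutes V"
    and eq: "f \<circ> \<sigma> \<circ> inv f = g \<circ> \<sigma> \<circ> inv g" "f \<circ> \<beta> \<circ> inv f = g \<circ> \<beta> \<circ> inv g"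
  shows "f = g"
proof -
  have s: "\<sigma> permutes V" and mt: "matching (V - {r}) \<beta>" and bl: "bridgeless V \<sigma> \<beta>"
    using p by (auto simp: yuk_def)
  have inv_f: "inv f (f x) = x" and inv_g: "inv g (g x) = x" "g (inv g x) = x" for x
    using f g by (simp_all add: permutes_inverses)
  define S where "S = {v \<in> V. f v = g v}"
  have step: "f (\<sigma> v) = g (\<sigma> v)" "f (\<beta> v) = g (\<beta> v)" if "f v = g v" for v
    using fun_cong[OF eq(1), of "f v"] fun_cong[OF eq(2), of "f v"] that inv_f[of v] inv_g(1)[of v] by simp_all
  \<comment> \<open>The common conjugate of \<open>\<beta>\<close> has a single fixed point in
    \<open>V\<close>, which is both \<open>f r\<close> and \<open>g r\<close>.\<close>
  have "f r = g r"
  proof -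
    have "\<beta> r = r" using mt by (simp add: matching_fix_iff)
    then have "g (\<beta> (inv g (f r))) = f r" using fun_cong[OF eq(2), of "f r"] inv_f[of r] by simp
    then have "\<beta> (inv g (f r)) = inv g (f r)" using inv_g(1) by metis
    then have "inv g (f r) \<notin> V - {r}" using mt by (simp add: matching_fix_iff)
    moreover have "inv g (f r) \<in> V" using p(2) f permutes_inv[OF g] by (simp add: permutes_in_image)
    ultimately show ?thesis using inv_g(2)[of "f r"] by simp
  qed
  then have "S \<noteq> {}" using p(2) by (auto simp: S_def)
  show ?thesis
  proof (rule ccontr)
    assume "f \<noteq> g"
    then obtain v where "f v \<noteq> g v" by blast
    then have "v \<in> V" using f g by (metis permutes_not_in)
    then have "S \<noteq> V" using \<open>f v \<noteq> g v\<close> by (auto simp: S_def)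
    moreover have "\<sigma> ` S = S"
    proof -
      have sub: "\<sigma> ` S \<subseteq> S" using step(1) s by (auto simp: S_def permutes_in_image)
      show ?thesis
      proof (intro equalityI sub subsetI)
        fix x assume x: "x \<in> S"
        obtain y where y: "x = \<sigma> y" using permutes_surj[OF s] by (metis surjD)
        have "y \<in> V" using x y s by (simp add: S_def permutes_in_image)
        \<comment> \<open>\<open>h\<close> commutes with \<open>\<sigma>\<close>, so if it fixes a
          vertex it also fixes the preceding one on the fermion cycle.\<close>
        define h where "h = inv g \<circ> f"
        have "h (\<sigma> y) = \<sigma> (h y)"
          using fun_cong[OF eq(1), of "f y"] inv_f[of y] inv_g(1) by (simp add: h_def)
        moreover have "h x = x" using x inv_g(1) by (simp add: h_def S_def)
        ultimately have "\<sigma> (h y) = \<sigma> y" using y by simp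
        then have "h y = y" using permutes_inj[OF s] by (simp add: inj_eq)
        then have "f y = g y" using inv_g(2)[of "f y"] by (simp add: h_def)
        then show "x \<in> \<sigma> ` S" using y \<open>y \<in> V\<close> by (auto simp: S_def)
      qed
    qed
    ultimately have "crossed_twice \<beta> S" using \<open>S \<noteq> {}\<close> by (intro bridgelessD[OF bl]) (auto simp: S_def)
    then obtain x where x: "x \<in> S" "\<beta> x \<notin> S" unfolding crossed_twice_def by blast
    then have "\<beta> x \<noteq> x" by auto
    then have "\<beta> x \<in> V" using mt by (metis DiffD1 matching_fix_iff matching_in_iff)
    then show False using x step(2) by (simp add: S_def)
  qed
qed

text \<open>The leg may sit at any of the \<open>2 * k + 1\<close> labels and is determined by
  \<open>\<beta>\<close>, so summing over its position completes the factorial.\<close>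

lemma card_tadpoles_loops: "card (tadpoles_loops (Suc k)) = fact (2 * k + 1) * ccn (Suc k)"
proof -
  define m where "m = 2 * k + 1"
  have T: "tadpoles_loops (Suc k) = (\<lambda>(\<sigma>, \<beta>). graph_of m \<sigma> \<beta>) ` (\<Union>r<m. yuk {..<m} {r})"
    by (rule tadpoles_loops_eq) (simp add: m_def)
  have "inj_on (\<lambda>(\<sigma>, \<beta>). graph_of m \<sigma> \<beta>) (\<Union>r<m. yuk {..<m} {r})"
    by (rule inj_onI) (auto dest!: graph_data_yuk dest: graph_of_inject)
  then have "card (tadpoles_loops (Suc k)) = card (\<Union>r<m. yuk {..<m} {r})"
    unfolding T by (rule card_image)
  also have "\<dots> = (\<Sum>r<m. card (yuk {..<m} {r}))"
  proof (rule card_UN_disjoint)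
    show "\<forall>i\<in>{..<m}. \<forall>j\<in>{..<m}. i \<noteq> j \<longrightarrow> yuk {..<m} {i} \<inter> yuk {..<m} {j} = {}"
    proof (intro ballI impI equals0I)
      fix i j p assume ij: "i \<in> {..<m}" "i \<noteq> j" and p: "p \<in> yuk {..<m} {i} \<inter> yuk {..<m} {j}"
      then have "matching ({..<m} - {i}) (snd p)" "matching ({..<m} - {j}) (snd p)"
        by (auto simp: yuk_def)
      then show False using ij by (metis DiffD2 DiffI matching_def singletonD singletonI)
    qed
  qed (auto intro: finite_yuk)
  also have "\<dots> = (\<Sum>r<m. fact (2 * k) * ccn (Suc k))"
    by (intro sum.cong refl card_yuk_tadpole) (auto simp: m_def)
  also have "\<dots> = fact (2 * k + 1) * ccn (Suc k)" by (simp add: m_def algebra_simps)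
  finally show ?thesis .
qed

text \<open>Isomorphism classes are the orbits of the permutations of the \<open>m\<close> labels,
  and by \<open>relabel_inj\<close> the action is free, so every class has size
  \<open>fact m\<close>. For positive \<open>n\<close> one has \<open>m = 2 * n - 1\<close>, and
  dividing leaves \<open>ccn n\<close>.\<close>

theorem tadpole_count_eq: "tadpole_count n = ccn n"
proof (cases n)
  case 0
  then show ?thesis by (simp add: tadpole_count_def tadpoles_loops_0)
next
  case (Suc k)
  define m where "m = 2 * k + 1"
  let ?Y = "tadpoles_loops n"
  let ?R = "{(G, H). G \<in> ?Y \<and> H \<in> ?Y \<and> yiso G H}"
  have Y: "G \<in> ?Y \<longleftrightarrow> (\<exists>\<sigma> \<beta> r. G = graph_of m \<sigma> \<beta> \<and> r < m \<and> (\<sigma>, \<beta>) \<in> yuk {..<m} {r})" for G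
    using tadpoles_loops_eq[of m n] Suc by (auto simp: m_def)
  have iso: "(graph_of m \<sigma> \<beta>, H) \<in> ?R \<longleftrightarrow>
      (\<exists>f. f permutes {..<m} \<and> H = graph_of m (f \<circ> \<sigma> \<circ> inv f) (f \<circ> \<beta> \<circ> inv f))"
    if p: "r < m" "(\<sigma>, \<beta>) \<in> yuk {..<m} {r}" for \<sigma> \<beta> r H
  proof
    assume "(graph_of m \<sigma> \<beta>, H) \<in> ?R"
    then obtain \<sigma>' \<beta>' r' where H: "H = graph_of m \<sigma>' \<beta>'" "r' < m" "(\<sigma>', \<beta>') \<in> yuk {..<m} {r'}"
      and "yiso (graph_of m \<sigma> \<beta>) H" using Y by auto
    then obtain f where f: "f permutes {..<m}" "\<sigma>' \<circ> f = f \<circ> \<sigma>" "\<beta>' \<circ> f = f \<circ> \<beta>"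
      using yiso_graph_of[OF graph_data_yuk[OF p(2)] graph_data_yuk[OF H(3)]] by auto
    have "f \<circ> inv f = id" using f(1) by (simp add: permutes_inv_o)
    then have "\<sigma>' = f \<circ> \<sigma> \<circ> inv f" "\<beta>' = f \<circ> \<beta> \<circ> inv f"
      using f(2,3) by (metis comp_assoc comp_id)+
    then show "\<exists>f. f permutes {..<m} \<and> H = graph_of m (f \<circ> \<sigma> \<circ> inv f) (f \<circ> \<beta> \<circ> inv f)"
      using f(1) H(1) by blast
  next
    assume "\<exists>f. f permutes {..<m} \<and> H = graph_of m (f \<circ> \<sigma> \<circ> inv f) (f \<circ> \<beta> \<circ> inv f)"
    then obtain f where f: "f permutes {..<m}" and H: "H = graph_of m (f \<circ> \<sigma> \<circ> inv f) (f \<circ> \<beta> \<circ> inv f)"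
      by blast
    have *: "(f \<circ> \<sigma> \<circ> inv f, f \<circ> \<beta> \<circ> inv f) \<in> yuk {..<m} {f r}" using yuk_relabel[OF f p(2)] p(1) by simp
    have "f r < m" using permutes_in_image[OF f, of r] p(1) by simp
    then have "H \<in> ?Y" using * H Y by blast
    moreover have "graph_of m \<sigma> \<beta> \<in> ?Y" using p Y by blast
    moreover have "yiso (graph_of m \<sigma> \<beta>) H" unfolding H
      unfolding yiso_graph_of[OF graph_data_yuk[OF p(2)] graph_data_yuk[OF *]]
      using f by (intro exI[of _ f]) (simp add: comp_assoc permutes_inv_o)
    ultimately show "(graph_of m \<sigma> \<beta>, H) \<in> ?R" by blast
  qed
  have equiv: "equiv ?Y ?R"
  proof (rule equivI)
    show "?R \<subseteq> ?Y \<times> ?Y" by blast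
    show "refl_on ?Y ?R"
    proof (rule refl_onI)
      fix G assume "G \<in> ?Y"
      then obtain \<sigma> \<beta> r where G: "G = graph_of m \<sigma> \<beta>" "r < m" "(\<sigma>, \<beta>) \<in> yuk {..<m} {r}" using Y by blast
      show "(G, G) \<in> ?R" unfolding G(1) iso[OF G(2,3)] by (intro exI[of _ id]) simp
    qed
    show "sym ?R"
    proof (rule symI)
      fix G H assume GH: "(G, H) \<in> ?R"
      then obtain \<sigma> \<beta> r \<sigma>' \<beta>' r' where G: "G = graph_of m \<sigma> \<beta>" "(\<sigma>, \<beta>) \<in> yuk {..<m} {r}"
        and H: "H = graph_of m \<sigma>' \<beta>'" "(\<sigma>', \<beta>') \<in> yuk {..<m} {r'}"
        using Y by (auto 0 3)
      obtain f where f: "f permutes {..<m}" "\<sigma>' \<circ> f = f \<circ> \<sigma>" "\<beta>' \<circ> f = f \<circ> \<beta>"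
        using GH yiso_graph_of[OF graph_data_yuk[OF G(2)] graph_data_yuk[OF H(2)]] G(1) H(1) by auto
      have "inv f permutes {..<m} \<and> \<sigma> \<circ> inv f = inv f \<circ> \<sigma>' \<and> \<beta> \<circ> inv f = inv f \<circ> \<beta>'"
        using f permutes_inv_o[OF f(1)] permutes_inv[OF f(1)] by (metis comp_assoc comp_id id_comp)
      then have "yiso H G"
        using yiso_graph_of[OF graph_data_yuk[OF H(2)] graph_data_yuk[OF G(2)]] G(1) H(1) by blast
      then show "(H, G) \<in> ?R" using GH by blast
    qed
    show "trans ?R"
    proof (rule transI)
      fix G H K assume GHK: "(G, H) \<in> ?R" "(H, K) \<in> ?R"
      then obtain \<sigma> \<beta> r \<sigma>' \<beta>' r' \<sigma>'' \<beta>'' r'' where G: "G = graph_of m \<sigma> \<beta>" "(\<sigma>, \<beta>) \<in> yuk {..<m} {r}"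
        and H: "H = graph_of m \<sigma>' \<beta>'" "(\<sigma>', \<beta>') \<in> yuk {..<m} {r'}"
        and K: "K = graph_of m \<sigma>'' \<beta>''" "(\<sigma>'', \<beta>'') \<in> yuk {..<m} {r''}"
        using Y by (auto 0 3)
      note data = graph_data_yuk[OF G(2)] graph_data_yuk[OF H(2)] graph_data_yuk[OF K(2)]
      obtain f where f: "f permutes {..<m}" "\<sigma>' \<circ> f = f \<circ> \<sigma>" "\<beta>' \<circ> f = f \<circ> \<beta>"
        using GHK(1) yiso_graph_of[OF data(1,2)] G(1) H(1) by auto
      obtain g where g: "g permutes {..<m}" "\<sigma>'' \<circ> g = g \<circ> \<sigma>'" "\<beta>'' \<circ> g = g \<circ> \<beta>'"
        using GHK(2) yiso_graph_of[OF data(2,3)] H(1) K(1) by auto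
      have "g \<circ> f permutes {..<m} \<and> \<sigma>'' \<circ> (g \<circ> f) = (g \<circ> f) \<circ> \<sigma> \<and> \<beta>'' \<circ> (g \<circ> f) = (g \<circ> f) \<circ> \<beta>"
        using f g permutes_compose[OF f(1) g(1)] by (metis comp_assoc)
      then have "yiso G K" using yiso_graph_of[OF data(1,3)] G(1) K(1) by blast
      then show "(G, K) \<in> ?R" using GHK by blast
    qed
  qed
  have class_card: "card C = fact m" if C: "C \<in> ?Y // ?R" for C
  proof -
    obtain G where G: "G \<in> ?Y" "C = ?R `` {G}" using C by (rule quotientE)
    then obtain \<sigma> \<beta> r where G': "G = graph_of m \<sigma> \<beta>" "r < m" "(\<sigma>, \<beta>) \<in> yuk {..<m} {r}" using Y by blast
    let ?h = "\<lambda>f. graph_of m (f \<circ> \<sigma> \<circ> inv f) (f \<circ> \<beta> \<circ> inv f)"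
    have "C = ?h ` {f. f permutes {..<m}}"
      unfolding G(2) G'(1) Image_singleton iso[OF G'(2,3)] by blast
    moreover have "inj_on ?h {f. f permutes {..<m}}"
    proof (rule inj_onI)
      fix f g assume fg: "f \<in> {f. f permutes {..<m}}" "g \<in> {f. f permutes {..<m}}" and eq: "?h f = ?h g"
      have r: "r \<in> {..<m}" using G'(2) by simp
      have f: "f permutes {..<m}" and g: "g permutes {..<m}" using fg by auto
      note inj = graph_of_inject[OF graph_data_yuk[OF yuk_relabel[OF f G'(3) r]]
          graph_data_yuk[OF yuk_relabel[OF g G'(3) r]] eq]
      show "f = g" using relabel_inj[OF G'(3) r f g inj] .
    qed
    ultimately have "card C = card {f. f permutes {..<m}}" by (simp add: card_image)
    then show ?thesis using card_permutations[of "{..<m}" m] by simp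
  qed
  have "card ?Y = fact m * ccn n" using card_tadpoles_loops[of k] Suc by (simp add: m_def)
  have "finite ?Y"
    using tadpoles_loops_eq[of m n] Suc by (auto simp: m_def finite_yuk)
  have "fact m * card (?Y // ?R) = card (\<Union>(?Y // ?R))"
  proof (rule card_partition)
    show "finite (?Y // ?R)" using \<open>finite ?Y\<close> by (rule finite_quotient) blast
    show "finite (\<Union>(?Y // ?R))" using \<open>finite ?Y\<close> by (simp add: Union_quotient[OF equiv])
    show "\<And>C. C \<in> ?Y // ?R \<Longrightarrow> card C = fact m" by (rule class_card)
    show "\<And>C D. C \<in> ?Y // ?R \<Longrightarrow> D \<in> ?Y // ?R \<Longrightarrow> C \<noteq> D \<Longrightarrow> C \<inter> D = {}"
      using quotient_disj[OF equiv] by blast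
  qed
  also have "\<dots> = fact m * ccn n"
    using \<open>card ?Y = fact m * ccn n\<close> by (simp add: Union_quotient[OF equiv])
  finally show ?thesis by (simp add: tadpole_count_def)
qed

section \<open>Connected chord diagrams\<close>

text \<open>Satisfied only by the left ends of two chords, so a crossing is witnessed by a single
  pair of points up to order.\<close>

definition crosses :: "(nat \<Rightarrow> nat) \<Rightarrow> nat \<Rightarrow> nat \<Rightarrow> bool" where
  "crosses \<beta> x y \<longleftrightarrow> x < y \<and> y < \<beta> x \<and> \<beta> x < \<beta> y \<or> y < x \<and> x < \<beta> y \<and> \<beta> y < \<beta> x"

lemma crosses_sym: "crosses \<beta> x y \<longleftrightarrow> crosses \<beta> y x"
  unfolding crosses_def by blast

text \<open>Connectivity of the intersection graph in cut form: closed under \<open>\<beta>\<close>,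
  the set \<open>S\<close> is a union of chords. Any set of points may carry a diagram, so
  components need no renumbering.\<close>

definition chord_connected :: "nat set \<Rightarrow> (nat \<Rightarrow> nat) \<Rightarrow> bool" where
  "chord_connected A \<beta> \<longleftrightarrow> (\<forall>S. S \<subseteq> A \<and> S \<noteq> {} \<and> S \<noteq> A \<and> (\<forall>x\<in>S. \<beta> x \<in> S) \<longrightarrow>
     (\<exists>x\<in>S. \<exists>y\<in>A - S. crosses \<beta> x y))"

definition con_chords :: "nat set \<Rightarrow> (nat \<Rightarrow> nat) set" where
  "con_chords A = {\<beta>. matching A \<beta> \<and> chord_connected A \<beta>}"

lemma finite_con_chords: "finite A \<Longrightarrow> finite (con_chords A)"
  by (rule finite_subset[OF _ finite_matchings]) (auto simp: con_chords_def)

lemma chord_connectedE: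
  assumes "chord_connected A \<beta>" "S \<subseteq> A" "S \<noteq> {}" "S \<noteq> A" "\<And>x. x \<in> S \<Longrightarrow> \<beta> x \<in> S"
  obtains x y where "x \<in> S" "y \<in> A" "y \<notin> S" "crosses \<beta> x y"
  using assms unfolding chord_connected_def by (metis DiffE)

lemma chord_connected_cong:
  assumes "chord_connected A \<beta>" and eq: "\<And>x. x \<in> A \<Longrightarrow> \<beta>' x = \<beta> x"
  shows "chord_connected A \<beta>'"
  unfolding chord_connected_def
proof (intro allI impI)
  fix S assume S: "S \<subseteq> A \<and> S \<noteq> {} \<and> S \<noteq> A \<and> (\<forall>x\<in>S. \<beta>' x \<in> S)"
  have "\<beta> x \<in> S" if "x \<in> S" for x
  proof -
    have "\<beta>' x = \<beta> x" using that S by (intro eq) blast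
    then show ?thesis using that S by metis
  qed
  then obtain x y where xy: "x \<in> S" "y \<in> A" "y \<notin> S" "crosses \<beta> x y"
    using chord_connectedE[OF assms(1), of S] S by metis
  have "\<beta>' x = \<beta> x" "\<beta>' y = \<beta> y" using xy S by (auto intro!: eq)
  then have "crosses \<beta>' x y" using xy(4) by (simp add: crosses_def)
  then show "\<exists>x\<in>S. \<exists>y\<in>A - S. crosses \<beta>' x y" using xy by blast
qed

lemma matching_un:
  assumes "matching A \<beta>\<^sub>1" "matching B \<beta>\<^sub>2" "A \<inter> B = {}"
  shows "matching (A \<union> B) (\<lambda>x. if x \<in> A then \<beta>\<^sub>1 x else \<beta>\<^sub>2 x)"
  using assms unfolding matching_def by (smt (verit) Un_iff disjoint_iff)

lemma matching_restrict:
  assumes "matching A \<beta>" "B \<subseteq> A" "\<And>x. x \<in> B \<Longrightarrow> \<beta> x \<in> B"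
  shows "matching B (restrict_id \<beta> B)"
  using assms unfolding matching_def restrict_id_def by auto

section \<open>Gluing and splitting at the root chord\<close>

definition core :: "nat set \<Rightarrow> nat \<Rightarrow> nat \<times> nat \<Rightarrow> nat set" where
  "core A a = (\<lambda>(l, u). insert a (A \<inter> {l<..<u}))"

locale rooted_chords =
  fixes A :: "nat set" and a :: nat
  assumes A: "finite A" and a: "a \<in> A" and a_min: "\<And>x. x \<in> A \<Longrightarrow> a \<le> x"
begin

lemma a_less: "x \<in> A \<Longrightarrow> x \<noteq> a \<Longrightarrow> a < x"
  using a_min[of x] by simp

lemma crosses_root:
  assumes "matching A \<beta>" "x \<in> A" "x \<noteq> a" "crosses \<beta> x y" "y = a \<or> y = \<beta> a"
  shows "y = a" "x < \<beta> a" "\<beta> a < \<beta> x"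
  using assms(4,5) a_less[OF assms(2,3)] matching_invol[OF assms(1), of a]
  by (auto simp: crosses_def)

end

text \<open>The core is the part of the root: its end \<open>a\<close> and the block between
  \<open>l\<close> and \<open>u\<close>. The outer part \<open>C\<close> is the complement, and
  \<open>l\<close>, \<open>u\<close> become neighbours in it because everything between them goes to
  the core. The pair thus encodes both \<open>C\<close> and the gap of \<open>C\<close> that holds
  the block.\<close>

locale chord_glued = rooted_chords +
  fixes l u :: nat and \<beta>\<^sub>1 \<beta>\<^sub>2 \<beta> :: "nat \<Rightarrow> nat"
  assumes lu: "l \<in> A" "u \<in> A" "a < l" "l < u"
    and outer: "\<beta>\<^sub>1 \<in> con_chords (A - core A a (l, u))" and inner: "\<beta>\<^sub>2 \<in> con_chords (core A a (l, u))"
    and glued: "\<beta> = (\<lambda>x. if x \<in> core A a (l, u) then \<beta>\<^sub>2 x else \<beta>\<^sub>1 x)"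
begin

abbreviation "B \<equiv> core A a (l, u)"

lemma B_iff: "x \<in> B \<longleftrightarrow> x = a \<or> x \<in> A \<and> l < x \<and> x < u"
  by (auto simp: core_def)

lemma B_sub: "B \<subseteq> A"
  using a by (auto simp: B_iff)

lemma m1: "matching (A - B) \<beta>\<^sub>1" and c1: "chord_connected (A - B) \<beta>\<^sub>1"
  and m2: "matching B \<beta>\<^sub>2" and c2: "chord_connected B \<beta>\<^sub>2"
  using outer inner by (auto simp: con_chords_def)

lemma matching_glued: "matching A \<beta>"
  using matching_un[OF m2 m1] B_sub unfolding glued by (simp add: Un_absorb1)

lemma beta_in_B: "\<beta> x \<in> B \<longleftrightarrow> x \<in> B"
proof (cases "x \<in> A")
  case True
  then show ?thesis using matching_in_iff[OF m1, of x] matching_in_iff[OF m2, of x]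
    by (auto simp: glued)
next
  case False
  then show ?thesis using matching_glued B_sub by (metis matching_fix_iff)
qed

lemma root_partner: "\<beta> a \<in> A" "l < \<beta> a" "\<beta> a < u" "\<beta> a \<noteq> a"
proof -
  have "\<beta> a \<in> B" using beta_in_B B_iff by blast
  moreover show "\<beta> a \<noteq> a" using a matching_glued by (simp add: matching_fix_iff)
  ultimately show "\<beta> a \<in> A" "l < \<beta> a" "\<beta> a < u" by (simp_all add: B_iff)
qed

lemma c1': "chord_connected (A - B) \<beta>" and c2': "chord_connected B \<beta>"
proof -
  show "chord_connected (A - B) \<beta>"
    by (rule chord_connected_cong[OF c1]) (simp add: glued)
  show "chord_connected B \<beta>"
    by (rule chord_connected_cong[OF c2]) (simp add: glued)
qed

text \<open>A non-root chord of the core has both ends between \<open>l\<close> and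
  \<open>u\<close>, where no outer point lies.\<close>

lemma outer_not_crosses:
  assumes "x \<in> A - B" "y \<in> B" "y \<noteq> a" "y \<noteq> \<beta> a"
  shows "\<not> crosses \<beta> x y"
proof -
  have "\<beta> y \<noteq> a" using assms(4) matching_glued by auto
  moreover have "\<beta> y \<in> B" "\<beta> x \<notin> B" using assms beta_in_B by auto
  moreover have "\<beta> x \<in> A" using assms(1) matching_glued by (simp add: matching_in_iff)
  ultimately show ?thesis using assms(1-3) a_min[of "\<beta> x"]
    by (auto simp: B_iff crosses_def not_less)
qed

lemma lu_outer: "l \<in> A - B" "u \<in> A - B"
  using lu by (auto simp: B_iff)

text \<open>Outer points lie on both sides of \<open>\<beta> a\<close>, because \<open>l\<close> and
  \<open>u\<close> do. If no outer chord passed over \<open>\<beta> a\<close>, the outer part would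
  split into chords on the left and chords on the right, which do not cross.\<close>

lemma root_crossed: "\<exists>x\<in>A - B. crosses \<beta> x a"
proof -
  let ?L = "{z \<in> A - B. z < \<beta> a}"
  have "\<exists>x\<in>?L. \<beta> x \<notin> ?L"
  proof (rule ccontr)
    assume "\<not> ?thesis"
    then have cl: "\<And>x. x \<in> ?L \<Longrightarrow> \<beta> x \<in> ?L" by blast
    have "l \<in> ?L" "u \<notin> ?L" using lu_outer root_partner by auto
    then obtain x y where xy: "x \<in> ?L" "y \<in> A - B" "y \<notin> ?L" "crosses \<beta> x y"
      using chord_connectedE[OF c1', of ?L] cl lu_outer by blast
    have "\<beta> y \<notin> ?L" using cl[of "\<beta> y"] xy(3) matching_glued by auto
    moreover have "\<beta> y \<in> A - B" using xy(2) beta_in_B matching_glued by (simp add: matching_in_iff)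
    ultimately show False using xy cl[of x] by (auto simp: crosses_def)
  qed
  then obtain x where x: "x \<in> A - B" "x < \<beta> a" "\<beta> x \<notin> ?L" by blast
  have "\<beta> x \<in> A - B" using x(1) beta_in_B matching_glued by (simp add: matching_in_iff)
  moreover have "\<beta> x \<noteq> \<beta> a" using x(1) matching_glued B_iff by (auto simp: matching_eq_iff)
  moreover have "a < x" using x(1) a_less B_iff by blast
  ultimately have "crosses \<beta> x a" using x by (auto simp: crosses_def)
  then show ?thesis using x(1) by blast
qed

lemma chord_connected_glued: "chord_connected A \<beta>"
  unfolding chord_connected_def
proof (intro allI impI)
  fix S assume S: "S \<subseteq> A \<and> S \<noteq> {} \<and> S \<noteq> A \<and> (\<forall>x\<in>S. \<beta> x \<in> S)"
  have split: "\<exists>x\<in>S. \<exists>y\<in>A - S. crosses \<beta> x y"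
    if C: "C \<subseteq> A" "chord_connected C \<beta>" "\<And>x. \<beta> x \<in> C \<longleftrightarrow> x \<in> C" "S \<inter> C \<noteq> {}" "\<not> C \<subseteq> S" for C
  proof -
    have "\<And>x. x \<in> S \<inter> C \<Longrightarrow> \<beta> x \<in> S \<inter> C" using S C(3) by blast
    moreover have "S \<inter> C \<subseteq> C" "S \<inter> C \<noteq> C" using C(5) by blast+
    ultimately obtain x y where "x \<in> S \<inter> C" "y \<in> C" "y \<notin> S \<inter> C" "crosses \<beta> x y"
      using chord_connectedE[OF C(2), of "S \<inter> C"] C(4) by metis
    then show ?thesis using C(1) by blast
  qed
  have cl1: "\<beta> x \<in> A - B \<longleftrightarrow> x \<in> A - B" for x
    using beta_in_B matching_glued by (simp add: matching_in_iff)
  show "\<exists>x\<in>S. \<exists>y\<in>A - S. crosses \<beta> x y"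
  proof (cases "(S \<inter> B \<noteq> {} \<and> \<not> B \<subseteq> S) \<or> (S \<inter> (A - B) \<noteq> {} \<and> \<not> A - B \<subseteq> S)")
    case True
    then show ?thesis using split[OF B_sub c2' beta_in_B] split[OF Diff_subset c1' cl1] by blast
  next
    case False
    then have "S = B \<or> S = A - B" using S B_sub by blast
    moreover obtain x where x: "x \<in> A - B" "crosses \<beta> x a" using root_crossed by blast
    moreover have "a \<in> B" by (simp add: B_iff)
    ultimately show ?thesis using B_sub crosses_sym by blast
  qed
qed

text \<open>The second point is at most \<open>l\<close>, hence precedes the block. This pins the
  outer part down as the one containing it.\<close>

lemma second_outer:
  assumes "t \<in> A" "t \<noteq> a" "\<And>x. x \<in> A \<Longrightarrow> x \<noteq> a \<Longrightarrow> t \<le> x"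
  shows "t \<in> A - B"
  using assms(1,2) assms(3)[of l] lu by (auto simp: B_iff)

end

text \<open>Both outer parts contain the second point. If the first were not inside the other,
  connectivity would make a chord of the intersection cross a chord outside it; seen from the other
  decomposition, an outer chord would cross a non-root chord of the core.\<close>

lemma chord_glued_le:
  assumes 1: "chord_glued A a l u \<beta>\<^sub>1 \<beta>\<^sub>2 \<beta>" and 2: "chord_glued A a l' u' \<beta>\<^sub>1' \<beta>\<^sub>2' \<beta>"
  shows "A - core A a (l, u) \<subseteq> A - core A a (l', u')"
proof (rule ccontr)
  let ?C = "A - core A a (l, u)" and ?C' = "A - core A a (l', u')"
  assume n: "\<not> ?C \<subseteq> ?C'"
  interpret G: chord_glued A a l u \<beta>\<^sub>1 \<beta>\<^sub>2 \<beta> by fact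
  interpret H: chord_glued A a l' u' \<beta>\<^sub>1' \<beta>\<^sub>2' \<beta> by fact
  define t where "t = Min (A - {a})"
  have "l \<in> A - {a}" using G.lu by simp
  then have "t \<in> A - {a}" "\<And>x. x \<in> A - {a} \<Longrightarrow> t \<le> x"
    unfolding t_def using G.A by (metis Min_in empty_iff finite_Diff, simp)
  then have t: "t \<in> ?C" "t \<in> ?C'" using G.second_outer H.second_outer by auto
  have cl: "\<beta> x \<in> ?C \<inter> ?C'" if "x \<in> ?C \<inter> ?C'" for x
    using that G.beta_in_B H.beta_in_B G.matching_glued by (simp add: matching_in_iff)
  obtain x y where xy: "x \<in> ?C \<inter> ?C'" "y \<in> ?C" "y \<notin> ?C \<inter> ?C'" "crosses \<beta> x y"
    using chord_connectedE[OF G.c1', of "?C \<inter> ?C'"] cl t n by blast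
  have "a \<notin> ?C" "\<beta> a \<notin> ?C" using G.beta_in_B G.B_iff by blast+
  then have "y \<noteq> a" "y \<noteq> \<beta> a" using xy(2) by blast+
  then show False using H.outer_not_crosses[of x y] xy by blast
qed

lemma chord_glued_unique:
  assumes 1: "chord_glued A a l u \<beta>\<^sub>1 \<beta>\<^sub>2 \<beta>" and 2: "chord_glued A a l' u' \<beta>\<^sub>1' \<beta>\<^sub>2' \<beta>"
  shows "l = l'" "u = u'" "\<beta>\<^sub>1 = \<beta>\<^sub>1'" "\<beta>\<^sub>2 = \<beta>\<^sub>2'"
proof -
  interpret G: chord_glued A a l u \<beta>\<^sub>1 \<beta>\<^sub>2 \<beta> by fact
  interpret H: chord_glued A a l' u' \<beta>\<^sub>1' \<beta>\<^sub>2' \<beta> by fact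
  have "A - G.B = A - H.B" using chord_glued_le[OF 1 2] chord_glued_le[OF 2 1] by blast
  then have B: "G.B = H.B" using G.B_sub H.B_sub by blast
  have out: "l \<notin> H.B" "u \<notin> H.B" "l' \<notin> G.B" "u' \<notin> G.B"
    using B G.lu_outer H.lu_outer by auto
  \<comment> \<open>\<open>l\<close> is the last outer point before \<open>\<beta> a\<close>: a
    different candidate would put one of the two inside the block. The same holds for
    \<open>u\<close> on the other side.\<close>
  show l: "l = l'"
    using out G.lu H.lu G.root_partner H.root_partner unfolding G.B_iff H.B_iff by auto
  show u: "u = u'"
    using out G.lu H.lu G.root_partner H.root_partner unfolding G.B_iff H.B_iff by auto
  have "\<beta>\<^sub>1 x = \<beta>\<^sub>1' x" for x
    using fun_cong[OF G.glued, of x] fun_cong[OF H.glued, of x] B G.m1 H.m1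
    by (cases "x \<in> G.B") (auto simp: matching_def)
  then show "\<beta>\<^sub>1 = \<beta>\<^sub>1'" by blast
  have "\<beta>\<^sub>2 x = \<beta>\<^sub>2' x" for x
    using fun_cong[OF G.glued, of x] fun_cong[OF H.glued, of x] B G.m2 H.m2
    by (cases "x \<in> G.B") (auto simp: matching_def)
  then show "\<beta>\<^sub>2 = \<beta>\<^sub>2'" by blast
qed

text \<open>All points outside the component \<open>C\<close> of the second point, except
  \<open>a\<close>, lie in the gap of \<open>C\<close> around the partner \<open>p\<close> of the
  root: a chord outside \<open>C\<close> cannot enclose points of \<open>C\<close>, and only the
  root chord connects such chords to \<open>C\<close>.\<close>

lemma (in rooted_chords) decompose:
  assumes \<beta>: "\<beta> \<in> con_chords A" and card_A: "card A > 2"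
  obtains l u \<beta>\<^sub>1 \<beta>\<^sub>2 where "chord_glued A a l u \<beta>\<^sub>1 \<beta>\<^sub>2 \<beta>"
proof -
  have mt: "matching A \<beta>" and con: "chord_connected A \<beta>" using \<beta> by (auto simp: con_chords_def)
  define p where "p = \<beta> a"
  have p: "p \<in> A" "a < p" "\<beta> p = a"
    using a mt a_less[of p] by (auto simp: p_def matching_in_iff matching_fix_iff)
  define R where "R = A - {a, p}"
  have beta_A: "\<beta> x \<in> A \<longleftrightarrow> x \<in> A" for x using mt by (rule matching_in_iff)
  have beta_R: "\<beta> x \<in> R \<longleftrightarrow> x \<in> R" for x
    using beta_A[of x] matching_invol[OF mt, of x] p matching_invol[OF mt, of a] by (auto simp: R_def p_def)
  have cross_root: "y = a \<and> x < p \<and> p < \<beta> x" if "x \<in> R" "crosses \<beta> x y" "y \<in> {a, p}" for x y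
  proof -
    have "x \<in> A" "x \<noteq> a" "y = a \<or> y = \<beta> a" using that by (auto simp: R_def p_def)
    then show ?thesis using crosses_root[OF mt _ _ that(2)] unfolding p_def by blast
  qed
  have "A \<noteq> {a, p}" using card_A p by auto
  then have "R \<noteq> {}" using a p(1) by (auto simp: R_def)
  have fR: "finite R" using A by (simp add: R_def)
  define t where "t = Min R"
  have t: "t \<in> R" "\<And>x. x \<in> R \<Longrightarrow> t \<le> x"
    using Min_in[OF fR \<open>R \<noteq> {}\<close>] Min_le[OF fR] by (auto simp: t_def)
  \<comment> \<open>The component of \<open>t\<close> is obtained without paths, as a smallest union
    of chords that contains \<open>t\<close> and is not crossed from the rest of
    \<open>R\<close>.\<close>
  define P where "P S \<longleftrightarrow> S \<subseteq> R \<and> t \<in> S \<and> (\<forall>x\<in>S. \<beta> x \<in> S) \<and> (\<forall>x\<in>S. \<forall>y\<in>R - S. \<not> crosses \<beta> x y)" for S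
  have "P R" using t(1) beta_R by (simp add: P_def)
  then obtain C where PC: "P C" and C_min: "\<And>S. P S \<Longrightarrow> card C \<le> card S"
    using ex_has_least_nat[of P R card] by blast
  have C: "C \<subseteq> R" "t \<in> C" and C_cl: "\<And>x. x \<in> C \<Longrightarrow> \<beta> x \<in> C"
    and C_nc: "\<And>x y. x \<in> C \<Longrightarrow> y \<in> R \<Longrightarrow> y \<notin> C \<Longrightarrow> \<not> crosses \<beta> x y"
    using PC unfolding P_def by blast+
  have CA: "C \<subseteq> A" "a \<notin> C" "p \<notin> C" "finite C" using C(1) A by (auto simp: R_def intro: finite_subset)
  have C_cl': "\<beta> x \<in> C \<longleftrightarrow> x \<in> C" for x using C_cl[of x] C_cl[of "\<beta> x"] mt by auto
  \<comment> \<open>If \<open>C\<close> split into two unions of chords that do not cross, the one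
    with \<open>t\<close> would satisfy \<open>P\<close> and be smaller.\<close>
  have conC: "chord_connected C \<beta>" unfolding chord_connected_def
  proof (intro allI impI, rule ccontr)
    fix S assume S: "S \<subseteq> C \<and> S \<noteq> {} \<and> S \<noteq> C \<and> (\<forall>x\<in>S. \<beta> x \<in> S)"
      and nc: "\<not> (\<exists>x\<in>S. \<exists>y\<in>C - S. crosses \<beta> x y)"
    have smaller: "\<not> P S'" if "S' \<subseteq> C" "S' \<noteq> C" for S'
      using C_min[of S'] psubset_card_mono[OF CA(4), of S'] that by (metis leD psubsetI)
    show False
    proof (cases "t \<in> S")
      case True
      have "P S" using S True C(1) nc C_nc unfolding P_def by blast
      then show False using smaller S by blast
    next
      case False
      have "\<beta> x \<in> C - S" if "x \<in> C - S" for x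
        using that C_cl S matching_invol[OF mt, of x] by (metis Diff_iff)
      moreover have "\<not> crosses \<beta> x y" if "x \<in> C - S" "y \<in> R - (C - S)" for x y
        using that nc C_nc[of x y] crosses_sym by blast
      ultimately have "P (C - S)" using S False C unfolding P_def by blast
      then show False using smaller[of "C - S"] S by blast
    qed
  qed
  \<comment> \<open>Otherwise \<open>p\<close> directly follows \<open>a\<close> and no chord
    crosses the root chord, although there are other chords.\<close>
  have "t < p"
  proof (rule ccontr)
    assume "\<not> t < p"
    then have p_min: "p \<le> x" if "x \<in> R" for x using t(2)[OF that] by simp
    have "{a, p} \<subseteq> A" "{a, p} \<noteq> {}" using a p by auto
    moreover have "\<beta> x \<in> {a, p}" if "x \<in> {a, p}" for x using that p by (auto simp: p_def)
    ultimately obtain x y where "x \<in> {a, p}" "y \<in> A" "y \<notin> {a, p}" "crosses \<beta> x y"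
      using chord_connectedE[OF con, of "{a, p}"] \<open>A \<noteq> {a, p}\<close> by metis
    then show False using cross_root[of y x] crosses_sym[of \<beta> x y] p_min[of y] by (auto simp: R_def)
  qed
  \<comment> \<open>Something must cross \<open>C\<close>, and only the root chord is left to do so;
    the chord of \<open>C\<close> that it crosses ends beyond \<open>p\<close>.\<close>
  have beyond: "\<exists>x\<in>C. p < x"
  proof -
    have "C \<noteq> {}" "C \<noteq> A" using C(2) CA(2) a by blast+
    then obtain x y where xy: "x \<in> C" "y \<in> A" "y \<notin> C" "crosses \<beta> x y"
      using chord_connectedE[OF con CA(1)] C_cl by metis
    then have "y \<in> {a, p}" using C_nc[of x y] by (auto simp: R_def)
    then have "p < \<beta> x" using cross_root[of x y] xy C(1) by blast
    then show ?thesis using C_cl xy(1) by blast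
  qed
  define l where "l = Max {z \<in> C. z < p}"
  define u where "u = Min {z \<in> C. p < z}"
  have l: "l \<in> C" "l < p" "\<And>z. z \<in> C \<Longrightarrow> z < p \<Longrightarrow> z \<le> l"
  proof -
    have ne: "finite {z \<in> C. z < p}" "{z \<in> C. z < p} \<noteq> {}" using CA(4) C(2) \<open>t < p\<close> by auto
    show "l \<in> C" "l < p" using Max_in[OF ne] by (auto simp: l_def)
    show "\<And>z. z \<in> C \<Longrightarrow> z < p \<Longrightarrow> z \<le> l" using ne by (auto simp: l_def)
  qed
  have u: "u \<in> C" "p < u" "\<And>z. z \<in> C \<Longrightarrow> p < z \<Longrightarrow> u \<le> z"
  proof -
    have ne: "finite {z \<in> C. p < z}" "{z \<in> C. p < z} \<noteq> {}" using CA(4) beyond by auto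
    show "u \<in> C" "p < u" using Min_in[OF ne] by (auto simp: u_def)
    show "\<And>z. z \<in> C \<Longrightarrow> p < z \<Longrightarrow> u \<le> z" using ne by (auto simp: u_def)
  qed
  have gap: "\<not> (l < z \<and> z < u)" if "z \<in> C" for z
    using l(3)[OF that] u(3)[OF that] CA(3) that by (metis leD linorder_neqE_nat)
  \<comment> \<open>The points of \<open>C\<close> under a chord outside \<open>C\<close> form a
    union of chords that no other chord of \<open>C\<close> crosses. It misses the least point
    \<open>t\<close>, so it is empty by connectivity of \<open>C\<close>.\<close>
  have nest: "\<not> (q < z \<and> z < \<beta> q)" if q: "q \<in> R" "q \<notin> C" and z: "z \<in> C" for q z
  proof
    assume qz: "q < z \<and> z < \<beta> q"
    define X where "X = {z \<in> C. q < z \<and> z < \<beta> q}"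
    have q': "\<beta> q \<in> R" "\<beta> q \<notin> C" using q beta_R C_cl' by auto
    have nc: "\<not> crosses \<beta> x q" if "x \<in> C" for x using C_nc[OF that q] .
    have Xcl: "\<beta> x \<in> X" if x: "x \<in> X" for x
    proof -
      have xC: "x \<in> C" "\<beta> x \<in> C" using x C_cl by (auto simp: X_def)
      have "\<beta> x \<noteq> q" "\<beta> x \<noteq> \<beta> q" using xC q q' by auto
      moreover have "\<beta> (\<beta> x) = x" using mt by simp
      ultimately show ?thesis using nc[OF xC(1)] nc[OF xC(2)] xC x
        by (auto simp: X_def crosses_def)
    qed
    have "t \<notin> X" using t(2)[OF q(1)] by (auto simp: X_def)
    then have "X \<noteq> C" using C(2) by blast
    moreover have "X \<subseteq> C" "X \<noteq> {}" using z qz by (auto simp: X_def)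
    ultimately obtain x y where xy: "x \<in> X" "y \<in> C" "y \<notin> X" "crosses \<beta> x y"
      using chord_connectedE[OF conC] Xcl by metis
    have "\<beta> y \<notin> X" using Xcl[of "\<beta> y"] xy(3) mt by auto
    then show False using xy Xcl[OF xy(1)] C_cl[OF xy(2)] by (auto simp: X_def crosses_def)
  qed
  have nest': "l < q \<and> q < u \<longleftrightarrow> l < \<beta> q \<and> \<beta> q < u" if q: "q \<in> R" "q \<notin> C" for q
  proof -
    have q': "\<beta> q \<in> R" "\<beta> q \<notin> C" using q beta_R C_cl' by auto
    have "q \<noteq> l" "q \<noteq> u" "\<beta> q \<noteq> l" "\<beta> q \<noteq> u" using q q' l u by auto
    then show ?thesis
      using nest[OF q l(1)] nest[OF q u(1)] nest[OF q' l(1)] nest[OF q' u(1)] mt by auto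
  qed
  \<comment> \<open>Points of \<open>R\<close> outside both \<open>C\<close> and the gap would form
    a union of chords crossed by nothing: not by \<open>C\<close>, not by chords inside the gap, and
    not by the root chord, since crossing it from outside the gap means enclosing
    \<open>l\<close>.\<close>
  have inside: "l < q \<and> q < u" if "q \<in> R" "q \<notin> C" for q
  proof (rule ccontr)
    assume nq: "\<not> (l < q \<and> q < u)"
    define S where "S = {q \<in> R. q \<notin> C \<and> \<not> (l < q \<and> q < u)}"
    have Scl: "\<beta> x \<in> S" if "x \<in> S" for x
      using that beta_R[of x] C_cl'[of x] nest'[of x] by (auto simp: S_def)
    have "S \<subseteq> A" "S \<noteq> {}" "S \<noteq> A" using nq that a by (auto simp: S_def R_def)
    then obtain x y where xy: "x \<in> S" "y \<in> A" "y \<notin> S" "crosses \<beta> x y"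
      using chord_connectedE[OF con] Scl by metis
    have x: "x \<in> R" "x \<notin> C" "\<not> (l < x \<and> x < u)" using xy(1) by (auto simp: S_def)
    have bx: "\<not> (l < \<beta> x \<and> \<beta> x < u)" using Scl[OF xy(1)] by (auto simp: S_def)
    have "x \<noteq> l" using x l by auto
    consider "y \<in> C" | "y \<in> {a, p}" | "y \<in> R" "y \<notin> C" "l < y" "y < u"
      using xy(2,3) by (auto simp: R_def S_def)
    then show False
    proof cases
      case 1
      then show False using C_nc[OF 1 x(1,2)] xy(4) crosses_sym by blast
    next
      case 2
      then have "x < p" "p < \<beta> x" using cross_root[OF x(1) xy(4)] by auto
      then have "x < l" using x(3) u(2) \<open>x \<noteq> l\<close> by linarith
      then show False using nest[OF x(1,2) l(1)] l(2) \<open>p < \<beta> x\<close> by linarith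
    next
      case 3
      then have "l < \<beta> y" "\<beta> y < u" using nest'[of y] by auto
      then show False using 3 xy(4) x(3) bx unfolding crosses_def by linarith
    qed
  qed
  let ?B = "core A a (l, u)"
  have B: "?B = A - C"
  proof -
    have "x \<in> ?B \<longleftrightarrow> x \<in> A - C" for x
      using inside[of x] gap[of x] a CA(2) p l(2) u(2) CA(3) by (auto simp: core_def R_def)
    then show ?thesis by blast
  qed
  then have AB: "A - ?B = C" using CA(1) by blast
  have conB: "chord_connected (A - C) \<beta>" unfolding chord_connected_def
  proof (intro allI impI)
    \<comment> \<open>By complements, sets missing the root suffice. Within all of \<open>A\<close>
      such a set is crossed, and the crossing chord is not in \<open>C\<close>.\<close>
    have main: "\<exists>x\<in>S. \<exists>y\<in>A - C - S. crosses \<beta> x y"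
      if S: "S \<subseteq> A - C" "S \<noteq> {}" "\<And>x. x \<in> S \<Longrightarrow> \<beta> x \<in> S" and aS: "a \<notin> S" for S
    proof -
      have "p \<notin> S" using S(3)[of p] p(3) aS by auto
      then have SR: "S \<subseteq> R" using S(1) aS by (auto simp: R_def)
      have "S \<subseteq> A" "S \<noteq> A" using S(1) aS a by blast+
      then obtain x y where xy: "x \<in> S" "y \<in> A" "y \<notin> S" "crosses \<beta> x y"
        using chord_connectedE[OF con] S(2,3) by metis
      then have "y \<notin> C" using C_nc[of y x] SR S(1) crosses_sym by blast
      then show ?thesis using xy by blast
    qed
    fix S assume S: "S \<subseteq> A - C \<and> S \<noteq> {} \<and> S \<noteq> A - C \<and> (\<forall>x\<in>S. \<beta> x \<in> S)"
    show "\<exists>x\<in>S. \<exists>y\<in>A - C - S. crosses \<beta> x y"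
    proof (cases "a \<in> S")
      case False
      then show ?thesis using main S by blast
    next
      case True
      have cl: "\<beta> x \<in> A - C - S" if "x \<in> A - C - S" for x
        using that beta_A[of x] C_cl'[of x] S matching_invol[OF mt, of x] by (metis Diff_iff)
      have "\<exists>x\<in>A - C - S. \<exists>y\<in>A - C - (A - C - S). crosses \<beta> x y"
        using S True cl by (intro main) auto
      then show ?thesis using crosses_sym by blast
    qed
  qed
  have "restrict_id \<beta> C \<in> con_chords C"
    using matching_restrict[OF mt CA(1) C_cl] chord_connected_cong[OF conC, of "restrict_id \<beta> C"]
    by (simp add: con_chords_def)
  moreover have "restrict_id \<beta> (A - C) \<in> con_chords (A - C)"
    using matching_restrict[OF mt Diff_subset] beta_A C_cl' chord_connected_cong[OF conB, of "restrict_id \<beta> (A - C)"]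
    by (simp add: con_chords_def)
  moreover have "\<beta> = (\<lambda>x. if x \<in> A - C then restrict_id \<beta> (A - C) x else restrict_id \<beta> C x)"
  proof
    fix x show "\<beta> x = (if x \<in> A - C then restrict_id \<beta> (A - C) x else restrict_id \<beta> C x)"
      using mt CA(1) by (auto simp: restrict_id_def matching_fix_iff)
  qed
  ultimately have "chord_glued A a l u (restrict_id \<beta> C) (restrict_id \<beta> (A - C)) \<beta>"
    using l u CA a_less[of l] unfolding chord_glued_def chord_glued_axioms_def AB
    by (auto simp: B intro: rooted_chords_axioms)
  then show ?thesis by (rule that)
qed

section \<open>Recursion for connected matchings\<close>

lemma card_con_chords_rec:
  assumes rooted: "finite A" "a \<in> A" "\<And>x. x \<in> A \<Longrightarrow> a \<le> x" "card A > 2"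
  shows "card (con_chords A) = (\<Sum>q | fst q \<in> A \<and> snd q \<in> A \<and> a < fst q \<and> fst q < snd q.
     card (con_chords (A - core A a q)) * card (con_chords (core A a q)))"
proof -
  interpret rooted_chords A a by unfold_locales (use rooted in auto)
  let ?I = "{q. fst q \<in> A \<and> snd q \<in> A \<and> a < fst q \<and> fst q < snd q}"
  let ?X = "SIGMA q:?I. con_chords (A - core A a q) \<times> con_chords (core A a q)"
  let ?f = "\<lambda>(q, \<beta>\<^sub>1, \<beta>\<^sub>2). \<lambda>x. if x \<in> core A a q then \<beta>\<^sub>2 x else \<beta>\<^sub>1 x"
  have glued: "chord_glued A a l u \<beta>\<^sub>1 \<beta>\<^sub>2 \<beta> \<longleftrightarrow> ((l, u), \<beta>\<^sub>1, \<beta>\<^sub>2) \<in> ?X \<and> \<beta> = ?f ((l, u), \<beta>\<^sub>1, \<beta>\<^sub>2)" for l u \<beta>\<^sub>1 \<beta>\<^sub>2 \<beta>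
    using rooted_chords_axioms by (auto simp: chord_glued_def chord_glued_axioms_def)
  have "bij_betw ?f ?X (con_chords A)"
  proof (rule bij_betw_imageI)
    show "inj_on ?f ?X"
    proof (rule inj_onI)
      fix z z' assume z: "z \<in> ?X" "z' \<in> ?X" "?f z = ?f z'"
      obtain l u \<beta>\<^sub>1 \<beta>\<^sub>2 where e: "z = ((l, u), \<beta>\<^sub>1, \<beta>\<^sub>2)" by (metis prod.exhaust)
      obtain l' u' \<beta>\<^sub>1' \<beta>\<^sub>2' where e': "z' = ((l', u'), \<beta>\<^sub>1', \<beta>\<^sub>2')" by (metis prod.exhaust)
      have g: "chord_glued A a l u \<beta>\<^sub>1 \<beta>\<^sub>2 (?f z)" unfolding glued using z(1) unfolding e by blast
      have g': "chord_glued A a l' u' \<beta>\<^sub>1' \<beta>\<^sub>2' (?f z)" unfolding glued using z(2,3) unfolding e' by blast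
      show "z = z'" unfolding e e' using chord_glued_unique[OF g g'] by (intro prod_eqI) simp_all
    qed
    show "?f ` ?X = con_chords A"
    proof (intro equalityI subsetI)
      fix \<beta> assume "\<beta> \<in> ?f ` ?X"
      then obtain z where z: "z \<in> ?X" "\<beta> = ?f z" by blast
      obtain l u \<beta>\<^sub>1 \<beta>\<^sub>2 where e: "z = ((l, u), \<beta>\<^sub>1, \<beta>\<^sub>2)" by (metis prod.exhaust)
      have G: "chord_glued A a l u \<beta>\<^sub>1 \<beta>\<^sub>2 \<beta>" unfolding glued using z unfolding e by blast
      show "\<beta> \<in> con_chords A"
        using chord_glued.matching_glued[OF G] chord_glued.chord_connected_glued[OF G]
        by (simp add: con_chords_def)
    next
      fix \<beta> assume "\<beta> \<in> con_chords A"
      then obtain l u \<beta>\<^sub>1 \<beta>\<^sub>2 where "chord_glued A a l u \<beta>\<^sub>1 \<beta>\<^sub>2 \<beta>" by (rule decompose[OF _ rooted(4)])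
      then show "\<beta> \<in> ?f ` ?X" unfolding glued by blast
    qed
  qed
  then have "card (con_chords A) = card ?X" by (rule bij_betw_same_card[symmetric])
  also have "\<dots> = (\<Sum>q\<in>?I. card (con_chords (A - core A a q) \<times> con_chords (core A a q)))"
  proof (rule card_SigmaI)
    show "finite ?I" by (rule finite_subset[of _ "A \<times> A"]) (use rooted in auto)
    show "\<forall>q\<in>?I. finite (con_chords (A - core A a q) \<times> con_chords (core A a q))"
      using rooted by (auto simp: core_def intro!: finite_con_chords)
  qed
  finally show ?thesis by (simp only: card_cartesian_product)
qed

text \<open>Strictly between positions \<open>i\<close> and \<open>j\<close> there are
  \<open>j - i - 1\<close> points; the root, at position 0, adds one.\<close>

lemma core_enum:
  assumes h: "bij_betw h {..<N} A" and mono: "strict_mono_on {..<N} h" and ij: "0 < i" "i < j" "j < N"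
  shows "card (core A (h 0) (h i, h j)) = j - i"
proof -
  have lt: "h x < h y \<longleftrightarrow> x < y" if "x < N" "y < N" for x y
    using strict_mono_on_less[OF mono, of x y] that by simp
  have "A \<inter> {h i<..<h j} = h ` {i<..<j}"
  proof (intro equalityI subsetI)
    fix x assume x: "x \<in> A \<inter> {h i<..<h j}"
    then obtain k where "k < N" "x = h k" using h by (auto simp: bij_betw_def)
    then show "x \<in> h ` {i<..<j}" using x lt ij by auto
  next
    fix x assume "x \<in> h ` {i<..<j}"
    then obtain k where k: "i < k" "k < j" "x = h k" by auto
    then have "h k \<in> A" using h ij by (auto simp: bij_betw_def)
    then show "x \<in> A \<inter> {h i<..<h j}" using k lt[of i k] lt[of k j] ij by simp
  qed
  moreover have "inj_on h {i<..<j}" using h ij by (auto simp: bij_betw_def intro: inj_on_subset)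
  moreover have "h 0 \<notin> h ` {i<..<j}"
  proof
    assume "h 0 \<in> h ` {i<..<j}"
    then obtain k where "i < k" "k < j" "h 0 = h k" by auto
    then show False using lt[of 0 k] ij by simp
  qed
  ultimately have "card (core A (h 0) (h i, h j)) = Suc (card {i<..<j})"
    by (simp add: core_def card_image)
  then show ?thesis using ij by simp
qed

lemma con_chords_odd: "finite A \<Longrightarrow> odd (card A) \<Longrightarrow> con_chords A = {}"
  using even_card_matching by (auto simp: con_chords_def)

lemma card_con_chords_2:
  assumes "card A = 2"
  shows "card (con_chords A) = 1"
proof -
  obtain x y where A: "A = {x, y}" "x \<noteq> y" using assms by (auto simp: card_2_iff)
  have "con_chords A = {transpose x y}"
  proof (intro equalityI subsetI)
    fix \<beta> assume "\<beta> \<in> con_chords A"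
    then have mt: "matching A \<beta>" by (simp add: con_chords_def)
    have "\<beta> x = y" using matching_in_iff[OF mt, of x] matching_fix_iff[OF mt, of x] A by auto
    then have "\<beta> y = x" using mt by auto
    then have "\<beta> z = transpose x y z" for z
      using \<open>\<beta> x = y\<close> matching_fix_iff[OF mt, of z] A by (auto simp: transpose_def)
    then show "\<beta> \<in> {transpose x y}" by auto
  next
    fix \<beta> assume "\<beta> \<in> {transpose x y}"
    then have b: "\<beta> = transpose x y" by simp
    have "matching A \<beta>" using A by (auto simp: b matching_def transpose_def)
    moreover have "chord_connected A \<beta>" unfolding chord_connected_def
    proof (intro allI impI)
      fix S assume S: "S \<subseteq> A \<and> S \<noteq> {} \<and> S \<noteq> A \<and> (\<forall>z\<in>S. \<beta> z \<in> S)"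
      then have "x \<in> S \<longleftrightarrow> y \<in> S" unfolding b by (metis transpose_apply_first transpose_apply_second)
      then show "\<exists>x\<in>S. \<exists>y\<in>A - S. crosses \<beta> x y" using S A by blast
    qed
    ultimately show "\<beta> \<in> con_chords A" by (simp add: con_chords_def)
  qed
  then show ?thesis by simp
qed

lemma card_con_chords:
  "finite A \<Longrightarrow> card A = 2 * n \<Longrightarrow> n \<ge> 1 \<Longrightarrow> card (con_chords A) = ccn n"
proof (induction n arbitrary: A rule: less_induct)
  case (less n)
  show ?case
  proof (cases "n = 1")
    case True
    then show ?thesis using less.prems card_con_chords_2 by simp
  next
    case False
    then have n: "n > 1" using less.prems by simp
    define N where "N = 2 * n"
    obtain h where h: "bij_betw h {..<N} A" and mono: "strict_mono_on {..<N} h"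
      using ex_bij_betw_strict_mono_card[OF less.prems(1)] less.prems(2) by (auto simp: N_def)
    have lt: "h x < h y \<longleftrightarrow> x < y" if "x < N" "y < N" for x y
      using strict_mono_on_less[OF mono, of x y] that by simp
    have hA: "A = h ` {..<N}" using h by (simp add: bij_betw_def)
    have N: "N > 2" using n by (simp add: N_def)
    define a where "a = h 0"
    have a: "a \<in> A" "\<And>x. x \<in> A \<Longrightarrow> a \<le> x"
    proof -
      show "a \<in> A" using N by (auto simp: hA a_def)
      fix x assume "x \<in> A"
      then obtain k where "k < N" "x = h k" by (auto simp: hA)
      then show "a \<le> x" using lt[of k 0] N by (simp add: a_def not_less[symmetric])
    qed
    define F where "F q = card (con_chords (A - core A a q)) * card (con_chords (core A a q))" for q
    \<comment> \<open>\<open>d\<close> is the size of the core and \<open>k\<close> the number of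
      outer chords; the sum has at most one term and vanishes for odd \<open>d\<close>.\<close>
    define g where "g d = (\<Sum>k | k < n \<and> d = 2 * (n - k). ccn k * ccn (n - k))" for d
    let ?I = "{q. fst q \<in> A \<and> snd q \<in> A \<and> a < fst q \<and> fst q < snd q}"
    \<comment> \<open>Pairs of positions are grouped by their distance \<open>d\<close>; the lower
      one starts at 1, position 0 being the root, and has \<open>N - d - 1\<close> choices. At
      \<open>d = 2 * (n - k)\<close> this number is \<open>2 * k - 1\<close>, the number of
      gaps.\<close>
    let ?D = "SIGMA d:{1..<N}. {1..<N - d}"
    have F: "F (h i, h (i + d)) = g d" if id: "(d, i) \<in> ?D" for d i
    proof -
      let ?q = "(h i, h (i + d))"
      have d: "0 < d" "0 < i" "i + d < N" using id by auto
      have c: "card (core A a ?q) = d" using core_enum[OF h mono, of i "i + d"] d by (simp add: a_def)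
      have sub: "core A a ?q \<subseteq> A" using a(1) by (auto simp: core_def)
      then have fin: "finite (core A a ?q)" using less.prems(1) by (rule finite_subset)
      have c': "card (A - core A a ?q) = N - d"
        using sub fin c less.prems(2) by (simp add: card_Diff_subset N_def)
      show ?thesis
      proof (cases "even d")
        case True
        then obtain e where e: "d = 2 * e" by (auto elim: evenE)
        have en: "1 \<le> e" "e < n" using d e by (auto simp: N_def)
        have "card (con_chords (core A a ?q)) = ccn e" using less.IH[OF en(2) fin _ en(1)] c e by simp
        moreover have "card (con_chords (A - core A a ?q)) = ccn (n - e)"
          using less.IH[of "n - e" "A - core A a ?q"] en c' e less.prems(1)
          by (simp add: N_def diff_mult_distrib2)
        moreover have "{k. k < n \<and> d = 2 * (n - k)} = {n - e}" using en e by auto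
        ultimately show ?thesis using en by (simp only: F_def g_def) simp
      next
        case False
        then have "{k. k < n \<and> d = 2 * (n - k)} = {}" by auto
        then have "g d = 0" unfolding g_def by (simp only: sum.empty)
        then show ?thesis using con_chords_odd[OF fin] False c by (simp add: F_def)
      qed
    qed
    have "bij_betw (\<lambda>(d, i). (h i, h (i + d))) ?D ?I"
    proof (rule bij_betw_imageI)
      have inj: "h x = h y \<longleftrightarrow> x = y" if "x < N" "y < N" for x y
        using that h by (auto simp: bij_betw_def inj_on_def)
      show "inj_on (\<lambda>(d, i). (h i, h (i + d))) ?D"
      proof (rule inj_onI)
        fix p q assume pq: "p \<in> ?D" "q \<in> ?D" "(\<lambda>(d, i). (h i, h (i + d))) p = (\<lambda>(d, i). (h i, h (i + d))) q"
        obtain d i where p: "p = (d, i)" by (metis prod.exhaust)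
        obtain e j where q: "q = (e, j)" by (metis prod.exhaust)
        have *: "i + d < N" "j + e < N" "h i = h j" "h (i + d) = h (j + e)"
          using pq unfolding p q by auto
        have "i = j" using inj[of i j] * by simp
        moreover have "i + d = j + e" using inj[of "i + d" "j + e"] * by simp
        ultimately show "p = q" by (simp add: p q)
      qed
      show "(\<lambda>(d, i). (h i, h (i + d))) ` ?D = ?I"
      proof (intro equalityI subsetI)
        fix q assume "q \<in> (\<lambda>(d, i). (h i, h (i + d))) ` ?D"
        then obtain z where z: "q = (\<lambda>(d, i). (h i, h (i + d))) z" "z \<in> ?D" by (rule imageE)
        obtain d i where di: "z = (d, i)" by (metis prod.exhaust)
        have q: "q = (h i, h (i + d))" using z(1) unfolding di by simp
        have "0 < d" "0 < i" "i + d < N" using z(2) unfolding di by auto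
        then show "q \<in> ?I" using lt[of 0 i] lt[of i "i + d"] q by (simp add: a_def hA)
      next
        fix q assume q: "q \<in> ?I"
        then obtain i j where ij: "i < N" "j < N" "q = (h i, h j)" by (cases q) (auto simp: hA)
        then have "0 < i" "i < j" using q lt[of 0 i] lt[of i j] N by (auto simp: a_def)
        then have "(j - i, i) \<in> ?D" "q = (\<lambda>(d, i). (h i, h (i + d))) (j - i, i)" using ij by auto
        then show "q \<in> (\<lambda>(d, i). (h i, h (i + d))) ` ?D" by blast
      qed
    qed
    then have "(\<Sum>q\<in>?I. F q) = (\<Sum>p\<in>?D. F ((\<lambda>(d, i). (h i, h (i + d))) p))"
      by (rule sum.reindex_bij_betw[symmetric])
    also have "\<dots> = (\<Sum>(d, i)\<in>?D. g d)"
    proof (rule sum.cong[OF refl])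
      fix p assume "p \<in> ?D"
      then show "F ((\<lambda>(d, i). (h i, h (i + d))) p) = (case p of (d, i) \<Rightarrow> g d)"
        using F by (cases p) auto
    qed
    also have "\<dots> = (\<Sum>d = 1..<N. \<Sum>i = 1..<N - d. g d)"
      by (rule sum.Sigma[symmetric]) auto
    also have "\<dots> = (\<Sum>d = 1..<N. (N - d - 1) * g d)" by simp
    also have "\<dots> = (\<Sum>d\<in>(\<lambda>k. 2 * (n - k)) ` {1..<n}. (N - d - 1) * g d)"
    proof (rule sum.mono_neutral_right)
      show "(\<lambda>k. 2 * (n - k)) ` {1..<n} \<subseteq> {1..<N}" by (auto simp: N_def)
      show "\<forall>d\<in>{1..<N} - (\<lambda>k. 2 * (n - k)) ` {1..<n}. (N - d - 1) * g d = 0"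
      proof
        fix d assume d: "d \<in> {1..<N} - (\<lambda>k. 2 * (n - k)) ` {1..<n}"
        have "{k. k < n \<and> d = 2 * (n - k)} \<subseteq> {0}"
        proof
          fix k assume k: "k \<in> {k. k < n \<and> d = 2 * (n - k)}"
          show "k \<in> {0}"
          proof (rule ccontr)
            assume "k \<notin> {0}"
            then have "k \<in> {1..<n}" "d = 2 * (n - k)" using k by auto
            then show False using d by blast
          qed
        qed
        then have "g d = 0" unfolding g_def by (intro sum.neutral) auto
        then show "(N - d - 1) * g d = 0" by simp
      qed
    qed simp
    also have "\<dots> = (\<Sum>k = 1..<n. (N - 2 * (n - k) - 1) * g (2 * (n - k)))"
      by (rule sum.reindex_cong[of "\<lambda>k. 2 * (n - k)"]) (auto simp: inj_on_def)
    also have "\<dots> = (\<Sum>k = 1..<n. (2 * k - 1) * ccn k * ccn (n - k))"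
    proof (rule sum.cong[OF refl])
      fix k assume k: "k \<in> {1..<n}"
      then have "{k'. k' < n \<and> 2 * (n - k) = 2 * (n - k')} = {k}" by auto
      then have "g (2 * (n - k)) = ccn k * ccn (n - k)" by (simp add: g_def)
      moreover have "N - 2 * (n - k) - 1 = 2 * k - 1" using k by (auto simp: N_def)
      ultimately show "(N - 2 * (n - k) - 1) * g (2 * (n - k)) = (2 * k - 1) * ccn k * ccn (n - k)"
        by (simp only: mult.assoc)
    qed
    also have "\<dots> = ccn n" using ccn_rec[OF n] by simp
    finally show ?thesis
      using card_con_chords_rec[OF less.prems(1) a] n less.prems(2) by (simp add: F_def)
  qed
qed

section \<open>Chord diagrams as involutions\<close>

definition chords_of :: "nat set \<Rightarrow> (nat \<Rightarrow> nat) \<Rightarrow> (nat \<times> nat) set" where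
  "chords_of A \<beta> = {(x, \<beta> x) | x. x \<in> A \<and> x < \<beta> x}"

lemma chords_of_ends:
  assumes "matching A \<beta>"
  shows "c \<in> chords_of A \<beta> \<and> (fst c = x \<or> snd c = x) \<longleftrightarrow> x \<in> A \<and> c = (min x (\<beta> x), max x (\<beta> x))"
proof -
  have "\<beta> x \<noteq> x" if "x \<in> A" using assms that by (simp add: matching_fix_iff)
  then show ?thesis
    by (cases c) (auto simp: chords_of_def min_def max_def matching_in_iff[OF assms] matching_invol[OF assms])
qed

lemma chord_diagram_chords_of:
  assumes "matching {1..2 * n} \<beta>"
  shows "chord_diagram n (chords_of {1..2 * n} \<beta>)"
  unfolding chord_diagram_def
proof (intro conjI ballI)
  fix c assume "c \<in> chords_of {1..2 * n} \<beta>"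
  then obtain x where x: "c = (x, \<beta> x)" "x \<in> {1..2 * n}" "x < \<beta> x" by (auto simp: chords_of_def)
  then have "\<beta> x \<in> {1..2 * n}" using matching_in_iff[OF assms] by blast
  then show "case c of (a, b) \<Rightarrow> 1 \<le> a \<and> a < b \<and> b \<le> 2 * n" using x by simp
next
  fix x assume "x \<in> {1..2 * n}"
  then show "\<exists>!c. c \<in> chords_of {1..2 * n} \<beta> \<and> (fst c = x \<or> snd c = x)"
    unfolding chords_of_ends[OF assms] by auto
qed

lemma chords_of_inj:
  assumes m: "matching A \<beta>" "matching A \<beta>'" and eq: "chords_of A \<beta> = chords_of A \<beta>'"
  shows "\<beta> = \<beta>'"
proof
  fix x show "\<beta> x = \<beta>' x"
  proof (cases "x \<in> A")
    case True
    then have "(min x (\<beta> x), max x (\<beta> x)) = (min x (\<beta>' x), max x (\<beta>' x))"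
      using chords_of_ends[OF m(1), of "(min x (\<beta> x), max x (\<beta> x))" x, unfolded eq]
        chords_of_ends[OF m(2), of "(min x (\<beta> x), max x (\<beta> x))" x] by blast
    then show ?thesis by (auto simp: min_def max_def split: if_splits)
  next
    case False
    then show ?thesis using m by (auto simp: matching_def)
  qed
qed

lemma chord_diagram_obtain:
  assumes P: "chord_diagram n P"
  obtains \<beta> where "matching {1..2 * n} \<beta>" "P = chords_of {1..2 * n} \<beta>"
proof -
  let ?A = "{1..2 * n}"
  have bd: "1 \<le> x \<and> x < y \<and> y \<le> 2 * n" if "(x, y) \<in> P" for x y
    using P that by (auto simp: chord_diagram_def)
  have ex: "\<exists>!c. c \<in> P \<and> (fst c = x \<or> snd c = x)" if "x \<in> ?A" for x
    using P that by (simp add: chord_diagram_def)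
  have uq: "c = d" if "c \<in> P" "d \<in> P" "fst c = x \<or> snd c = x" "fst d = x \<or> snd d = x" for c d x
  proof -
    have "x \<in> ?A" using that(1,3) bd[of "fst c" "snd c"] by auto
    then show ?thesis using ex that by blast
  qed
  define \<beta> where "\<beta> x = (if x \<in> ?A then THE y. (x, y) \<in> P \<or> (y, x) \<in> P else x)" for x
  have out: "\<beta> x = x" if "x \<notin> ?A" for x by (simp only: \<beta>_def that if_False)
  have b: "\<beta> x = y" if xy: "(x, y) \<in> P \<or> (y, x) \<in> P" for x y
  proof -
    have "x \<in> ?A" using that bd[of x y] bd[of y x] by auto
    moreover have "(THE y. (x, y) \<in> P \<or> (y, x) \<in> P) = y"
    proof (rule the_equality)
      show "(x, y) \<in> P \<or> (y, x) \<in> P" by (rule that)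
      fix z assume z: "(x, z) \<in> P \<or> (z, x) \<in> P"
      then obtain c where c: "c \<in> P" "c = (x, z) \<or> c = (z, x)" by blast
      obtain d where d: "d \<in> P" "d = (x, y) \<or> d = (y, x)" using xy by blast
      have "c = d" using uq[of c d x] c d by auto
      then show "z = y" using c(2) d(2) by auto
    qed
    ultimately show ?thesis by (simp add: \<beta>_def)
  qed
  have b_ex: "(x, \<beta> x) \<in> P \<or> (\<beta> x, x) \<in> P" if "x \<in> ?A" for x
  proof -
    obtain c where "c \<in> P" "fst c = x \<or> snd c = x" using ex[OF \<open>x \<in> ?A\<close>] by blast
    then have "\<exists>y. (x, y) \<in> P \<or> (y, x) \<in> P" by (cases c) auto
    then show ?thesis using b by blast
  qed
  have "matching ?A \<beta>" unfolding matching_def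
  proof (intro conjI allI)
    fix x
    show "\<beta> (\<beta> x) = x"
    proof (cases "x \<in> ?A")
      case True
      then show ?thesis using b_ex[OF True] b by blast
    next
      case False
      then show ?thesis using out by simp
    qed
    show "\<beta> x \<noteq> x \<longleftrightarrow> x \<in> ?A"
    proof (cases "x \<in> ?A")
      case True
      then show ?thesis using b_ex[OF True] bd[of x x] by auto
    next
      case False
      then show ?thesis using out by simp
    qed
  qed
  moreover have "P = chords_of ?A \<beta>"
  proof (intro equalityI subsetI)
    fix c assume "c \<in> P"
    moreover obtain x y where "c = (x, y)" by (metis prod.exhaust)
    ultimately show "c \<in> chords_of ?A \<beta>" using b[of x y] bd[of x y] by (auto simp: chords_of_def)
  next
    fix c assume "c \<in> chords_of ?A \<beta>"
    then obtain x where x: "c = (x, \<beta> x)" "x \<in> ?A" "x < \<beta> x" by (auto simp: chords_of_def)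
    then show "c \<in> P" using b_ex[OF x(2)] bd[of "\<beta> x" x] by auto
  qed
  ultimately show ?thesis by (rule that)
qed

text \<open>Along a path of crossing chords the left end cannot leave a union of chords that nothing
  crosses. Conversely, the points whose chord is reachable from \<open>c\<close> form such a
  union.\<close>

lemma connected_chords_of:
  assumes mt: "matching A \<beta>"
  shows "connected_chord_diagram (chords_of A \<beta>) \<longleftrightarrow> chord_connected A \<beta>"
proof
  let ?P = "chords_of A \<beta>"
  let ?r = "{(x, y). x \<in> ?P \<and> y \<in> ?P \<and> crossing x y}"
  have chord: "(min x (\<beta> x), max x (\<beta> x)) \<in> ?P" if "x \<in> A" for x
    using chords_of_ends[OF mt] that by blast
  assume L: "connected_chord_diagram ?P"
  show "chord_connected A \<beta>" unfolding chord_connected_def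
  proof (intro allI impI, rule ccontr)
    fix S assume S: "S \<subseteq> A \<and> S \<noteq> {} \<and> S \<noteq> A \<and> (\<forall>x\<in>S. \<beta> x \<in> S)"
      and no: "\<not> (\<exists>x\<in>S. \<exists>y\<in>A - S. crosses \<beta> x y)"
    obtain x y where xy: "x \<in> S" "y \<in> A" "y \<notin> S" using S by blast
    have "((min x (\<beta> x), max x (\<beta> x)), (min y (\<beta> y), max y (\<beta> y))) \<in> ?r\<^sup>*"
      using L chord[of x] chord[of y] xy S unfolding connected_chord_diagram_def by blast
    then have "fst (min y (\<beta> y), max y (\<beta> y)) \<in> S"
    proof (induction rule: rtrancl_induct)
      case base
      then show ?case using xy S by (simp add: min_def)
    next
      case (step c d)
      obtain z where z: "c = (z, \<beta> z)" "z \<in> A" "z < \<beta> z" using step.hyps by (auto simp: chords_of_def)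
      obtain w where w: "d = (w, \<beta> w)" "w \<in> A" "w < \<beta> w" using step.hyps by (auto simp: chords_of_def)
      have "crosses \<beta> z w" using step.hyps z w by (auto simp: crossing_def crosses_def)
      then show ?case using no step.IH z w by auto
    qed
    then have "y \<in> S \<or> \<beta> y \<in> S" by (auto simp: min_def split: if_splits)
    then show False using S xy(3) matching_invol[OF mt, of y] by metis
  qed
next
  let ?P = "chords_of A \<beta>"
  let ?r = "{(x, y). x \<in> ?P \<and> y \<in> ?P \<and> crossing x y}"
  assume R: "chord_connected A \<beta>"
  show "connected_chord_diagram ?P" unfolding connected_chord_diagram_def
  proof (intro ballI)
    fix c d assume cd: "c \<in> ?P" "d \<in> ?P"
    define S where "S = {x \<in> A. (c, (min x (\<beta> x), max x (\<beta> x))) \<in> ?r\<^sup>*}"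
    obtain x where x: "c = (x, \<beta> x)" "x \<in> A" "x < \<beta> x" using cd by (auto simp: chords_of_def)
    have Sx: "x \<in> S" using x by (simp add: S_def)
    have cl: "\<beta> z \<in> S" if "z \<in> S" for z
      using that mt by (simp add: S_def matching_in_iff min.commute max.commute)
    have "S = A"
    proof (rule ccontr)
      assume "S \<noteq> A"
      moreover have "S \<subseteq> A" "S \<noteq> {}" using Sx by (auto simp: S_def)
      ultimately obtain z w where zw: "z \<in> S" "w \<in> A" "w \<notin> S" "crosses \<beta> z w"
        using chord_connectedE[OF R] cl by metis
      have lt: "z < \<beta> z" "w < \<beta> w" using zw(4) by (auto simp: crosses_def)
      have zA: "z \<in> A" and path: "(c, (z, \<beta> z)) \<in> ?r\<^sup>*" using zw(1) lt by (auto simp: S_def)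
      have "((z, \<beta> z), (w, \<beta> w)) \<in> ?r"
        using zA zw(2,4) lt by (auto simp: chords_of_def crossing_def crosses_def)
      with path have "(c, (w, \<beta> w)) \<in> ?r\<^sup>*" by (rule rtrancl_into_rtrancl)
      then show False using zw(2,3) lt by (simp add: S_def)
    qed
    obtain y where y: "d = (y, \<beta> y)" "y \<in> A" "y < \<beta> y" using cd by (auto simp: chords_of_def)
    then have "y \<in> S" using \<open>S = A\<close> by simp
    then show "(c, d) \<in> ?r\<^sup>*" using y by (simp add: S_def)
  qed
qed

lemma connected_chord_count_eq:
  assumes "n \<ge> 1"
  shows "connected_chord_count n = ccn n"
proof -
  let ?A = "{1..2 * n}"
  have "{P. chord_diagram n P \<and> connected_chord_diagram P} = chords_of ?A ` con_chords ?A"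
  proof (intro equalityI subsetI)
    fix P assume "P \<in> {P. chord_diagram n P \<and> connected_chord_diagram P}"
    then obtain \<beta> where "matching ?A \<beta>" "P = chords_of ?A \<beta>" "connected_chord_diagram P"
      by (blast elim: chord_diagram_obtain)
    then show "P \<in> chords_of ?A ` con_chords ?A"
      by (auto simp: con_chords_def connected_chords_of)
  next
    fix P assume "P \<in> chords_of ?A ` con_chords ?A"
    then obtain \<beta> where "matching ?A \<beta>" "chord_connected ?A \<beta>" "P = chords_of ?A \<beta>"
      unfolding con_chords_def by blast
    then show "P \<in> {P. chord_diagram n P \<and> connected_chord_diagram P}"
      using connected_chords_of chord_diagram_chords_of by blast
  qed
  moreover have "inj_on (chords_of ?A) (con_chords ?A)"
    by (rule inj_onI) (auto simp: con_chords_def intro: chords_of_inj)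
  ultimately have "connected_chord_count n = card (con_chords ?A)"
    by (simp add: connected_chord_count_def card_image)
  then show ?thesis using card_con_chords[of ?A n] assms by simp
qed

text \<open>The \<open>k\<close>-th coefficient of \<open>2xT' - T\<close> is
  \<open>(2 * k - 1) * ccn k\<close>, so the recursion says that
  \<open>(2xT' - T) T = T - x\<close>. The terms \<open>k = 0\<close> and \<open>k = n\<close> of
  the product vanish because \<open>ccn 0 = 0\<close>, and \<open>x\<close> corrects
  \<open>n = 1\<close>, where the sum is empty.\<close>

lemma ccn_ode:
  defines "T \<equiv> Abs_fps (\<lambda>n. of_nat (ccn n)) :: int fps"
  shows "2 * fps_X * T * fps_deriv T = T ^ 2 + T - fps_X"
proof -
  have "(fps_X * fps_deriv T + fps_X * fps_deriv T - T) * T = T - fps_X"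
  proof (rule fps_ext)
    fix n
    have D: "fps_nth (fps_X * fps_deriv T + fps_X * fps_deriv T - T) k = (2 * int k - 1) * int (ccn k)" for k
    proof -
      have "fps_nth (fps_X * fps_deriv T) k = int k * int (ccn k)"
        by (cases k) (simp_all add: T_def)
      then show ?thesis by (simp only: fps_add_nth fps_sub_nth) (simp add: T_def algebra_simps)
    qed
    have "fps_nth ((fps_X * fps_deriv T + fps_X * fps_deriv T - T) * T) n
        = (\<Sum>k = 0..n. (2 * int k - 1) * int (ccn k) * int (ccn (n - k)))"
      unfolding fps_mult_nth D by (simp add: T_def)
    also have "\<dots> = (\<Sum>k = 1..<n. (2 * int k - 1) * int (ccn k) * int (ccn (n - k)))"
      by (rule sum.mono_neutral_right) (auto simp: not_less Suc_le_eq)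
    also have "\<dots> = int (\<Sum>k = 1..<n. (2 * k - 1) * ccn k * ccn (n - k))"
      unfolding of_nat_sum by (rule sum.cong) (auto simp: of_nat_diff)
    also have "\<dots> = fps_nth (T - fps_X) n"
    proof (cases "n > 1")
      case True
      then show ?thesis by (simp add: T_def ccn_rec fps_X_def)
    next
      case False
      then have "n = 0 \<or> n = 1" by auto
      then show ?thesis by (auto simp: T_def fps_X_def)
    qed
    finally show "fps_nth ((fps_X * fps_deriv T + fps_X * fps_deriv T - T) * T) n = fps_nth (T - fps_X) n" .
  qed
  then show ?thesis by (simp add: algebra_simps power2_eq_square)
qed

theorem theorem4p7p3:
  shows "(\<forall>n\<ge>1. tadpole_count n = connected_chord_count n) \<and>
         (let T = Abs_fps (\<lambda>n. of_nat (tadpole_count n) :: int)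
          in 2 * fps_X * T * fps_deriv T = T ^ 2 + T - fps_X)"
  using ccn_ode by (simp add: tadpole_count_eq connected_chord_count_eq Let_def)

end
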